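(* Let $K$ be a field of characteristic $0$, let $N\ge 1$ be an integer, and let $q\in K$, $q\neq 0$, $q^8\neq 1$. Then the $(-)$-part $U_q^-(A_N)$ of the Drinfeld-Jimbo quantum group of type $A_N$ over $K$ is a solvable polynomial algebra (with respect to its generators $y_{ij}$, $1\le i<j\le N+1$, and its standard PBW basis).
   Context: All algebras are associative $K$-algebras with $1$; $K^*=K\setminus\{0\}$; $\mathbb{N}=\{0,1,2,\dots\}$. **The algebra $U_q^-(A_N)$.** Let $(a_{ij})$ be the Cartan matrix of type $A_N$ ($a_{ii}=2$, $a_{ij}=-1$ if $|i-j|=1$, $a_{ij}=0$ otherwise), with $d_i=1$ for all $i$. $U_q(A_N)$ is the $K$-algebra generated by $E_i,K_i^{\pm1},F_i$ ($1\le i\le N$) subject to: $K_iK_j=K_jK_i$, $K_iK_i^{-1}=K_i^{-1}K_i=1$, $E_jK_i^{\pm1}=q^{\mp d_ia_{ij}}K_i^{\pm1}E_j$, $K_i^{\pm1}F_j=q^{\mp d_ia_{ij}}F_jK_i^{\pm1}$, $E_iF_j-F_jE_i=\delta_{ij}\frac{K_i^2-K_i^{-2}}{q^{2d_i}-q^{-2d_i}}$, and for $i\ne j$, with $t=q^{2d_i}$, $\sum_{v=0}^{1-a_{ij}}(-1)^v{1-a_{ij}\brack v}_t E_i^{1-a_{ij}-v}E_jE_i^v=0$ and the same relation with each $E$ replaced by $F$. Here ${m\brack n}_t=\prod_{i=1}^n\frac{t^{m-i+1}-t^{i-m-1}}{t^i-t^{-i}}$ for $m>n>0$, and ${m\brack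 n}_t=1$ if $n=0$ or $n=m$. $U_q^-(A_N)$ is the subalgebra generated by $F_1,\dots,F_N$. **Jimbo presentation and PBW basis (known, Yamane).** Let $\Lambda_N=\{(i,j)\in\mathbb{N}\times\mathbb{N}: 1\le i<j\le N+1\}$. For $q^8\ne1$, $U_q^-(A_N)$ is (just as $U_q^+(A_N)$, since the $F_i$ satisfy the same Serre relations as the $E_i$) the $K$-algebra with generators $y_{ij}$, $(i,j)\in\Lambda_N$ (with $y_{i,i+1}=F_i$) and defining relations - $y_{mn}y_{ij}=q^{-2}y_{ij}y_{mn}$ if $i=m<j<n$ or $i<m<j=n$; - $y_{mn}y_{ij}=y_{ij}y_{mn}$ if $i<m<n<j$ or $i<j<m<n$; - $y_{mn}y_{ij}=y_{ij}y_{mn}-(q^2-q^{-2})y_{in}y_{mj}$ if $i<m<j<n$; - $y_{mn}y_{ij}=q^2y_{ij}y_{mn}-q\,y_{in}$ if $i<j=m<n$. Its standard PBW $K$-basis is $\mathcal{B}=\{1\}\cup\{y_{i_1j_1}\cdots y_{i_kj_k}: k\ge1,\ (i_\ell,j_\ell)\in\Lambda_N,\ (i_1,j_1)\le_{lex}\cdots\le_{lex}(i_k,j_k)\}$, where $\le_{lex}$ is the lexicographic order on $\Lambda_N$. Thus the generators are listed as $a_1,\dots,a_n$, $n=N(N+1)/2$, in increasing lexicographic order of their indices. **Leading monomials.** Let $A=K[a_1,\dots,a_n]$ be a finitely generated $K$-algebra with PBW $K$-basis $\mathcal{B}=\{a^\alpha=a_1^{\alpha_1}\cdots a_n^{\alpha_n}:\alpha\in\mathbb{N}^n\}$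 and let $\prec$ be a total ordering on $\mathcal{B}$. For $0\ne f\in A$, $\mathbf{LM}(f)$ is the $\prec$-largest element of $\mathcal{B}$ occurring with nonzero coefficient in $f$; $\mathbf{LM}(0)=0$. **Monomial ordering.** A total ordering $\prec$ on $\mathcal{B}$ is a monomial ordering if: 1. it is a well-ordering; 2. for $a^\gamma,a^\alpha,a^\beta,a^\eta\in\mathcal{B}$, if $a^\gamma\ne1$, $a^\beta\ne a^\gamma$ and $a^\gamma=\mathbf{LM}(a^\alpha a^\beta a^\eta)$, then $a^\beta\prec a^\gamma$ (hence $1\prec a^\gamma$ for all $a^\gamma\neq 1$); 3. for $a^\gamma,a^\alpha,a^\beta,a^\eta\in\mathcal{B}$, if $a^\alpha\prec a^\beta$, $\mathbf{LM}(a^\gamma a^\alpha a^\eta)\ne0$ and $\mathbf{LM}(a^\gamma a^\beta a^\eta)\notin\{0,1\}$, then $\mathbf{LM}(a^\gamma a^\alpha a^\eta)\prec\mathbf{LM}(a^\gamma a^\beta a^\eta)$. **Solvable polynomial algebra.** $A=K[a_1,\dots,a_n]$ is a solvable polynomial algebra if it has the PBW $K$-basis $\mathcal{B}=\{a^\alpha=a_1^{\alpha_1}\cdots a_n^{\alpha_n}:\alpha=(\alpha_1,\dots,\alpha_n)\in\mathbb{N}^n\}$ and there is a monomial ordering $\prec$ on $\mathcal{B}$ such that for all $1\le i<j\le n$ one has $a_ja_i=\lambda_{ji}a_ia_j+f_{ji}$ with $\lambda_{ji}\in K^*$, $f_{ji}\in A$, and $\mathbf{LM}(f_{ji})\prec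 a_ia_j$ whenever $f_{ji}\ne0$. *)

theory Defs
  imports
    "HOL-Library.Poly_Mapping"
    "HOL-Algebra.QuotRing"
    "HOL-Algebra.Subrings"
    "Jordan_Normal_Form.VS_Connect"
begin

section \<open>Algebras over a field\<close>

text \<open>The locale \<^locale>\<open>algebra\<close> of HOL-Algebra is restricted to commutative algebras, hence the
  following variant. Algebras are carried by the record type of \<^theory>\<open>HOL-Algebra.Module\<close>.\<close>

locale assoc_algebra = vectorspace K A + ring A
  for K :: "('k, 'm) ring_scheme" and A :: "('k, 'a, 'n) module_scheme" +
  assumes smult_mult_left:
      "\<lbrakk>c \<in> carrier K; x \<in> carrier A; y \<in> carrier A\<rbrakk>
       \<Longrightarrow> (c \<odot>\<^bsub>A\<^esub> x) \<otimes>\<^bsub>A\<^esub> y = c \<odot>\<^bsub>A\<^esub> (x \<otimes>\<^bsub>A\<^esub> y)"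
    and smult_mult_right:
      "\<lbrakk>c \<in> carrier K; x \<in> carrier A; y \<in> carrier A\<rbrakk>
       \<Longrightarrow> x \<otimes>\<^bsub>A\<^esub> (c \<odot>\<^bsub>A\<^esub> y) = c \<odot>\<^bsub>A\<^esub> (x \<otimes>\<^bsub>A\<^esub> y)"

definition subalgebra_generated ::
  "('k, 'm) ring_scheme \<Rightarrow> ('k, 'a, 'n) module_scheme \<Rightarrow> 'a set \<Rightarrow> ('k, 'a, 'n) module_scheme" where
  "subalgebra_generated K A S = A\<lparr>carrier :=
     \<Inter>{B. subring B A \<and> (\<forall>c\<in>carrier K. \<forall>x\<in>B. c \<odot>\<^bsub>A\<^esub> x \<in> B) \<and> S \<subseteq> B}\<rparr>"

text \<open>The ring \<open>A Quot I\<close> with the induced scalar multiplication \<open>c (I + x) = I + c x\<close>.\<close>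

definition quotient_algebra :: "('k, 'a, 'n) module_scheme \<Rightarrow> 'a set \<Rightarrow> ('k, 'a set) module" where
  "quotient_algebra A I =
     ring.extend (A Quot I) (module.fields (\<lambda>c X. \<Union>x\<in>X. I +>\<^bsub>A\<^esub> (c \<odot>\<^bsub>A\<^esub> x)))"


section \<open>Free algebras\<close>

datatype 'g free_word = Word (letters: "'g list")

text \<open>\<^typ>\<open>'g free_word\<close> is the free monoid on \<^typ>\<open>'g\<close>, written additively, so that
  \<^typ>\<open>'g free_word \<Rightarrow>\<^sub>0 'k\<close> with the convolution product of
  \<^theory>\<open>HOL-Library.Poly_Mapping\<close> is the free algebra on \<^typ>\<open>'g\<close>.\<close>

instantiation free_word :: (type) monoid_add
begin

definition zero_free_word :: "'a free_word" where
  "0 = Word []"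

definition plus_free_word :: "'a free_word \<Rightarrow> 'a free_word \<Rightarrow> 'a free_word" where
  "u + v = Word (letters u @ letters v)"

instance
  by standard (simp_all add: zero_free_word_def plus_free_word_def)

end

definition scal :: "'k::field \<Rightarrow> ('g free_word \<Rightarrow>\<^sub>0 'k) \<Rightarrow> ('g free_word \<Rightarrow>\<^sub>0 'k)" where
  "scal c p = Poly_Mapping.single 0 c * p"

definition gen :: "'g \<Rightarrow> ('g free_word \<Rightarrow>\<^sub>0 'k::field)" where
  "gen g = Poly_Mapping.single (Word [g]) 1"

text \<open>The free algebra on the subset \<open>X\<close> of the letters.\<close>

definition free_algebra :: "'g set \<Rightarrow> ('k::field, 'g free_word \<Rightarrow>\<^sub>0 'k) module" where
  "free_algebra X =
     \<lparr>carrier = {p. \<forall>w\<in>Poly_Mapping.keys p. set (letters w) \<subseteq> X},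
      monoid.mult = (*), one = 1, ring.zero = 0, add = (+), smult = scal\<rparr>"


section \<open>The Drinfeld-Jimbo algebra of type A\<close>

definition cartan :: "nat \<Rightarrow> nat \<Rightarrow> int" where
  "cartan i j = (if i = j then 2 else if i = Suc j \<or> j = Suc i then -1 else 0)"

definition qbinom :: "'k::field \<Rightarrow> nat \<Rightarrow> nat \<Rightarrow> 'k" where
  "qbinom t m n = (if n = 0 \<or> n = m then 1 else
     (\<Prod>i = 1..n. (t powi (int m - int i + 1) - t powi (int i - int m - 1)) /
                  (t powi int i - t powi (- int i))))"

text \<open>\<open>GK' i\<close> stands for \<open>K\<^sub>i\<inverse>\<close>.\<close>

datatype Uq_gen = GE nat | GK nat | GK' nat | GF nat

definition Uq_gens :: "nat \<Rightarrow> Uq_gen set" where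
  "Uq_gens N = (\<Union>i\<in>{1..N}. {GE i, GK i, GK' i, GF i})"

type_synonym 'k Uq_free = "Uq_gen free_word \<Rightarrow>\<^sub>0 'k"

text \<open>All \<open>d\<^sub>i\<close> are \<open>1\<close>, so the Serre relations use the binomials at \<open>t = q\<^sup>2\<close>.\<close>

definition serre :: "'k::field \<Rightarrow> (nat \<Rightarrow> Uq_gen) \<Rightarrow> nat \<Rightarrow> nat \<Rightarrow> 'k Uq_free" where
  "serre q X i j = (let m = nat (1 - cartan i j) in
     (\<Sum>v = 0..m. scal ((-1) ^ v * qbinom (q\<^sup>2) m v)
                   (gen (X i) ^ (m - v) * gen (X j) * gen (X i) ^ v)))"

text \<open>The elements of the free algebra that are set to zero.\<close>

definition Uq_relations :: "'k::field \<Rightarrow> nat \<Rightarrow> 'k Uq_free set" where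
  "Uq_relations q N = (\<Union>i\<in>{1..N}. \<Union>j\<in>{1..N}.
     {gen (GK i) * gen (GK j) - gen (GK j) * gen (GK i),
      gen (GK i) * gen (GK' i) - 1,
      gen (GK' i) * gen (GK i) - 1,
      gen (GE j) * gen (GK i) - scal (q powi (- cartan i j)) (gen (GK i) * gen (GE j)),
      gen (GE j) * gen (GK' i) - scal (q powi cartan i j) (gen (GK' i) * gen (GE j)),
      gen (GK i) * gen (GF j) - scal (q powi (- cartan i j)) (gen (GF j) * gen (GK i)),
      gen (GK' i) * gen (GF j) - scal (q powi cartan i j) (gen (GF j) * gen (GK' i)),
      gen (GE i) * gen (GF j) - gen (GF j) * gen (GE i)
        - (if i = j then scal (1 / (q\<^sup>2 - q powi (-2))) (gen (GK i) ^ 2 - gen (GK' i) ^ 2) else 0)}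
     \<union> (if i \<noteq> j then {serre q GE i j, serre q GF i j} else {}))"

definition Uq_ideal :: "'k::field \<Rightarrow> nat \<Rightarrow> 'k Uq_free set" where
  "Uq_ideal q N = Idl\<^bsub>free_algebra (Uq_gens N)\<^esub> (Uq_relations q N)"

definition Uq :: "'k::field \<Rightarrow> nat \<Rightarrow> ('k, 'k Uq_free set) module" where
  "Uq q N = quotient_algebra (free_algebra (Uq_gens N)) (Uq_ideal q N)"

definition Uq_F :: "'k::field \<Rightarrow> nat \<Rightarrow> nat \<Rightarrow> 'k Uq_free set" where
  "Uq_F q N i = Uq_ideal q N +>\<^bsub>free_algebra (Uq_gens N) :: ('k, 'k Uq_free) module\<^esub> gen (GF i)"

definition Uq_minus :: "'k::field \<Rightarrow> nat \<Rightarrow> ('k, 'k Uq_free set) module" where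
  "Uq_minus q N = subalgebra_generated class_ring (Uq q N) (Uq_F q N ` {1..N})"


section \<open>Jimbo's generators of the negative part\<close>

definition Lambda :: "nat \<Rightarrow> (nat \<times> nat) set" where
  "Lambda N = {(i, j). 1 \<le> i \<and> i < j \<and> j \<le> N + 1}"

text \<open>The pairs \<open>(i, j) \<in> Lambda N\<close> in increasing lexicographic order.\<close>

definition Lambda_list :: "nat \<Rightarrow> (nat \<times> nat) list" where
  "Lambda_list N = [(i, j). i \<leftarrow> [1..<N + 1], j \<leftarrow> [i + 1..<N + 2]]"

text \<open>The last relation together with \<open>y i (i + 1) = F\<^sub>i\<close> determines all \<open>y i j\<close> with
  \<open>(i, j) \<in> Lambda N\<close> recursively when \<open>q \<noteq> 0\<close>.\<close>

definition jimbo_generators ::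
  "'k::field \<Rightarrow> nat \<Rightarrow> (nat \<Rightarrow> nat \<Rightarrow> 'k Uq_free set) \<Rightarrow> bool" where
  "jimbo_generators q N y \<longleftrightarrow> (let A = Uq_minus q N in
     (\<forall>(i, j)\<in>Lambda N. y i j \<in> carrier A) \<and>
     (\<forall>i\<in>{1..N}. y i (i + 1) = Uq_F q N i) \<and>
     (\<forall>(i, j)\<in>Lambda N. \<forall>(m, n)\<in>Lambda N.
       ((i = m \<and> m < j \<and> j < n) \<or> (i < m \<and> m < j \<and> j = n) \<longrightarrow>
          y m n \<otimes>\<^bsub>A\<^esub> y i j = q powi (-2) \<odot>\<^bsub>A\<^esub> (y i j \<otimes>\<^bsub>A\<^esub> y m n)) \<and>
       ((i < m \<and> m < n \<and> n < j) \<or> (i < j \<and> j < m \<and> m < n) \<longrightarrow>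
          y m n \<otimes>\<^bsub>A\<^esub> y i j = y i j \<otimes>\<^bsub>A\<^esub> y m n) \<and>
       (i < m \<and> m < j \<and> j < n \<longrightarrow>
          y m n \<otimes>\<^bsub>A\<^esub> y i j = y i j \<otimes>\<^bsub>A\<^esub> y m n
            \<ominus>\<^bsub>A\<^esub> (q\<^sup>2 - q powi (-2)) \<odot>\<^bsub>A\<^esub> (y i n \<otimes>\<^bsub>A\<^esub> y m j)) \<and>
       (i < j \<and> j = m \<and> m < n \<longrightarrow>
          y m n \<otimes>\<^bsub>A\<^esub> y i j = q\<^sup>2 \<odot>\<^bsub>A\<^esub> (y i j \<otimes>\<^bsub>A\<^esub> y m n) \<ominus>\<^bsub>A\<^esub> q \<odot>\<^bsub>A\<^esub> y i n)))"


section \<open>Solvable polynomial algebras\<close>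

text \<open>\<open>pbw_monomial A [a\<^sub>1, \<dots>, a\<^sub>n] [\<alpha>\<^sub>1, \<dots>, \<alpha>\<^sub>n]\<close> is the ordered product of the powers
  \<open>a\<^sub>i [^] \<alpha>\<^sub>i\<close>.\<close>

definition pbw_monomial :: "('a, 'n) ring_scheme \<Rightarrow> 'a list \<Rightarrow> nat list \<Rightarrow> 'a" where
  "pbw_monomial A as \<alpha> = foldr (\<otimes>\<^bsub>A\<^esub>) (map2 (\<lambda>a e. a [^]\<^bsub>A\<^esub> e) as \<alpha>) \<one>\<^bsub>A\<^esub>"

definition pbw_monomials :: "('a, 'n) ring_scheme \<Rightarrow> 'a list \<Rightarrow> 'a set" where
  "pbw_monomials A as = pbw_monomial A as ` {\<alpha>. length \<alpha> = length as}"

text \<open>Being a basis is meant for the family indexed by the exponents, hence the injectivity.\<close>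

definition has_pbw_basis ::
  "('k, 'm) ring_scheme \<Rightarrow> ('k, 'a, 'n) module_scheme \<Rightarrow> 'a list \<Rightarrow> bool" where
  "has_pbw_basis K A as \<longleftrightarrow>
     inj_on (pbw_monomial A as) {\<alpha>. length \<alpha> = length as} \<and>
     vectorspace.basis K A (pbw_monomials A as)"

text \<open>The elements of the basis \<open>B\<close> occurring in \<open>f\<close> with nonzero coefficient.\<close>

definition basis_support ::
  "('k, 'm) ring_scheme \<Rightarrow> ('k, 'a, 'n) module_scheme \<Rightarrow> 'a set \<Rightarrow> 'a \<Rightarrow> 'a set" where
  "basis_support K A B f = (THE S. finite S \<and> S \<subseteq> B \<and>
     (\<exists>c \<in> S \<rightarrow> carrier K - {\<zero>\<^bsub>K\<^esub>}. f = module.lincomb A c S))"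

text \<open>Orderings are given by their reflexive relation \<open>r\<close>, as in \<^const>\<open>well_order_on\<close>; the strict
  ordering is \<open>r - Id\<close>.\<close>

definition LM ::
  "('k, 'm) ring_scheme \<Rightarrow> ('k, 'a, 'n) module_scheme \<Rightarrow> 'a set \<Rightarrow> 'a rel \<Rightarrow> 'a \<Rightarrow> 'a" where
  "LM K A B r f = (if f = \<zero>\<^bsub>A\<^esub> then \<zero>\<^bsub>A\<^esub> else
     (THE b. b \<in> basis_support K A B f \<and> (\<forall>b'\<in>basis_support K A B f. (b', b) \<in> r)))"

definition monomial_ordering ::
  "('k, 'm) ring_scheme \<Rightarrow> ('k, 'a, 'n) module_scheme \<Rightarrow> 'a set \<Rightarrow> 'a rel \<Rightarrow> bool" where
  "monomial_ordering K A B r \<longleftrightarrow>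
     well_order_on B r \<and>
     (\<forall>g\<in>B. \<forall>a\<in>B. \<forall>b\<in>B. \<forall>h\<in>B.
        g \<noteq> \<one>\<^bsub>A\<^esub> \<and> b \<noteq> g \<and> g = LM K A B r (a \<otimes>\<^bsub>A\<^esub> b \<otimes>\<^bsub>A\<^esub> h) \<longrightarrow> (b, g) \<in> r - Id) \<and>
     (\<forall>g\<in>B. \<forall>a\<in>B. \<forall>b\<in>B. \<forall>h\<in>B.
        (a, b) \<in> r - Id \<and>
        LM K A B r (g \<otimes>\<^bsub>A\<^esub> a \<otimes>\<^bsub>A\<^esub> h) \<noteq> \<zero>\<^bsub>A\<^esub> \<and>
        LM K A B r (g \<otimes>\<^bsub>A\<^esub> b \<otimes>\<^bsub>A\<^esub> h) \<notin> {\<zero>\<^bsub>A\<^esub>, \<one>\<^bsub>A\<^esub>} \<longrightarrow>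
        (LM K A B r (g \<otimes>\<^bsub>A\<^esub> a \<otimes>\<^bsub>A\<^esub> h), LM K A B r (g \<otimes>\<^bsub>A\<^esub> b \<otimes>\<^bsub>A\<^esub> h)) \<in> r - Id)"

definition solvable_polynomial_algebra ::
  "('k, 'm) ring_scheme \<Rightarrow> ('k, 'a, 'n) module_scheme \<Rightarrow> 'a list \<Rightarrow> bool" where
  "solvable_polynomial_algebra K A as \<longleftrightarrow>
     assoc_algebra K A \<and> set as \<subseteq> carrier A \<and> has_pbw_basis K A as \<and>
     (\<exists>r. monomial_ordering K A (pbw_monomials A as) r \<and>
       (\<forall>i j. i < j \<and> j < length as \<longrightarrow>
         (\<exists>c\<in>carrier K - {\<zero>\<^bsub>K\<^esub>}. \<exists>f\<in>carrier A.
            as ! j \<otimes>\<^bsub>A\<^esub> as ! i = c \<odot>\<^bsub>A\<^esub> (as ! i \<otimes>\<^bsub>A\<^esub> as ! j) \<oplus>\<^bsub>A\<^esub> f \<and>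
            (f \<noteq> \<zero>\<^bsub>A\<^esub> \<longrightarrow>
              (LM K A (pbw_monomials A as) r f, as ! i \<otimes>\<^bsub>A\<^esub> as ! j) \<in> r - Id))))"

end

theory Submission
  imports Defs
begin

text \<open>Jimbo's commutation relations are consequences of the Serre relations, by induction on the
  lengths of the roots. Their correction terms have smaller weight than the leading product if the
  root \<open>(i, j)\<close> has weight \<open>w (j - i)\<close> for a positive, strictly concave \<open>w\<close>; hence the ordered
  monomials span, and the leading monomial of a product, with respect to the weight refined
  lexicographically, has the sum of the exponents as its exponent.

  For the linear independence the whole algebra is made to act on a tensor product of
  \<open>q\<close>-oscillator representations, one for each row \<open>{(i, j) | j > i}\<close> of roots. With the factors in
  the right order each root vector acts, on the vectors that matter, as a single creation operator
  with a nonzero coefficient, so that the ordered monomials send the vacuum to multiples of distinct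
  basis vectors. This works for roots of unity as well.\<close>

section \<open>Algebras and the quantum Serre relations\<close>

text \<open>\<open>Uq_minus\<close> is a subalgebra of a quotient of the full algebra, not an
  algebra presented by the letters \<open>GF i\<close>. A relation between ordered monomials thus
  means membership in an ideal that also involves \<open>GE\<close>, \<open>GK\<close> and
  \<open>GK'\<close>, and excluding it takes operators for all four kinds of generators. Quantum
  integers may vanish at a root of unity, so nonzero coefficients have to come from powers of
  \<open>q\<close>: in a root vector the difference of two consecutive quantum integers, suitably
  scaled, collapses to such a power. Total degree cannot order the correction terms: in the crossing
  relation \<open>y i n * y m j\<close> has the same degree as \<open>y i j * y m n\<close>.
  Concavity is what puts the nested pair of roots below the crossing pair. All identities are
  checked in ring types (the free algebra, linear operators), modulo an ideal given as a set. The
  record-based quotient is reached through an ideal of the whole type that agrees with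
  \<open>Uq_ideal\<close> on the carrier.\<close>

locale K_algebra =
  fixes sc :: "'k::field \<Rightarrow> 'a::ring_1 \<Rightarrow> 'a"
  assumes sc_add_right: "sc c (x + y) = sc c x + sc c y"
    and sc_add_left: "sc (c + d) x = sc c x + sc d x"
    and sc_sc: "sc c (sc d x) = sc (c * d) x"
    and sc_one: "sc 1 x = x"
    and mult_sc_left: "sc c x * y = sc c (x * y)"
    and mult_sc_right: "x * sc c y = sc c (x * y)"
begin

sublocale vector_space sc
  by unfold_locales (simp_all add: sc_add_right sc_add_left sc_sc sc_one)

lemmas sc_expand = sc_add_left sc_add_right scale_left_diff_distrib scale_right_diff_distrib
  sc_sc sc_one mult_sc_left mult_sc_right scale_minus_left scale_minus_right

text \<open>The Serre expression for \<open>cartan i j = -1\<close>, with \<open>t\<close> the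
  square of \<open>q\<close>; its middle coefficient is the binomial
  \<open>qbinom t 2 1\<close>.\<close>

definition qserre :: "'k \<Rightarrow> 'a \<Rightarrow> 'a \<Rightarrow> 'a" where
  "qserre t x y = x * x * y - sc (t + inverse t) (x * y * x) + y * x * x"

lemma qserre_inverse: "qserre (inverse t) x y = qserre t x y"
  by (simp add: qserre_def add.commute)

text \<open>The hypotheses allow every \<open>b\<close> and \<open>d\<close> to be moved to the left
  of \<open>a\<close> and \<open>c\<close>. In this normal form the mixed terms cancel in each
  multidegree, as in the quantum binomial formula. This is why the coproduct respects the Serre
  relations.\<close>

lemma qserre_add:
  assumes t: "t \<noteq> 0" and ab: "a * b = sc (inverse t * inverse t) (b * a)"
    and ad: "a * d = sc t (d * a)" and cb: "c * b = sc t (b * c)"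
    and ac: "qserre t a c = 0" and bd: "qserre t b d = 0"
  shows "qserre t (a + b) (c + d) = 0"
proof -
  define s where "s = inverse t"
  have ts: "t * s = 1" "s * t = 1" "t * (s * z) = z" "s * (t * z) = z" for z
    using t by (simp_all add: s_def)
  have ab': "a * (b * z) = sc (s * s) (b * (a * z))" and ad': "a * (d * z) = sc t (d * (a * z))"
    and cb': "c * (b * z) = sc t (b * (c * z))" for z
    using ab ad cb by (simp_all add: mult_sc_left s_def flip: mult.assoc)
  have "qserre t (a + b) (c + d) = qserre t a c + qserre t b d"
    unfolding qserre_def s_def[symmetric] ab[folded s_def]
    by (simp add: distrib_left distrib_right mult.assoc sc_expand
        ab[folded s_def] ad cb ab' ad' cb' ts algebra_simps)
  thus ?thesis using ac bd by simp
qed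

text \<open>Handles the factors \<open>K2 i\<close> and \<open>K1' i\<close> that a coproduct
  attaches to \<open>F1 i\<close> and \<open>F2 i\<close>: they come out as a common factor
  \<open>k * k * l\<close>.\<close>

lemma qserre_mult:
  assumes "x * k = k * x" "x * l = l * x" "y * k = k * y" "y * l = l * y" "k * l = l * k"
    and "qserre t x y = 0"
  shows "qserre t (x * k) (y * l) = 0"
proof -
  have a: "k * (x * z) = x * (k * z)" "l * (x * z) = x * (l * z)"
    "k * (y * z) = y * (k * z)" "l * (y * z) = y * (l * z)" "l * (k * z) = k * (l * z)" for z
    using assms by (simp_all flip: mult.assoc)
  have "qserre t (x * k) (y * l) = qserre t x y * (k * k * l)"
    unfolding qserre_def using assms(1-5)[symmetric]
    by (simp add: a mult.assoc sc_expand left_diff_distrib distrib_right)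
  thus ?thesis using assms by simp
qed

text \<open>The relations \<^const>\<open>Uq_relations\<close>, read in an arbitrary algebra.\<close>

definition uq_rep :: "'k \<Rightarrow> nat \<Rightarrow> (nat \<Rightarrow> 'a) \<Rightarrow> (nat \<Rightarrow> 'a) \<Rightarrow> (nat \<Rightarrow> 'a) \<Rightarrow> (nat \<Rightarrow> 'a) \<Rightarrow> bool" where
  "uq_rep q N E F K K' \<longleftrightarrow> (\<forall>i\<in>{1..N}. \<forall>j\<in>{1..N}.
     K i * K j = K j * K i \<and> K i * K' i = 1 \<and> K' i * K i = 1 \<and>
     E j * K i = sc (q powi (- cartan i j)) (K i * E j) \<and>
     E j * K' i = sc (q powi cartan i j) (K' i * E j) \<and>
     K i * F j = sc (q powi (- cartan i j)) (F j * K i) \<and>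
     K' i * F j = sc (q powi cartan i j) (F j * K' i) \<and>
     E i * F j - F j * E i =
       (if i = j then sc (1 / (q\<^sup>2 - q powi (-2))) (K i * K i - K' i * K' i) else 0) \<and>
     (cartan i j = -1 \<longrightarrow> qserre (q\<^sup>2) (E i) (E j) = 0 \<and> qserre (q\<^sup>2) (F i) (F j) = 0) \<and>
     (cartan i j = 0 \<longrightarrow> E i * E j = E j * E i \<and> F i * F j = F j * F i))"

lemma cartan_sym: "cartan i j = cartan j i"
  by (auto simp: cartan_def)

lemma uq_rep_KK':
  assumes r: "uq_rep q N E F K K'" and i: "i \<in> {1..N}" and j: "j \<in> {1..N}"
  shows "K i * K' j = K' j * K i" "K' i * K' j = K' j * K' i"
proof -
  have KK: "K a * K b = K b * K a" "K b * K' b = 1" "K' b * K b = 1"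
    if "a \<in> {1..N}" "b \<in> {1..N}" for a b
    using r that by (auto simp: uq_rep_def)
  have *: "K a * K' b = K' b * K a" if "a \<in> {1..N}" "b \<in> {1..N}" for a b
  proof -
    have "K a * K' b = K' b * (K b * K a) * K' b" using KK[OF that] by (simp flip: mult.assoc)
    also have "\<dots> = K' b * K a" using KK[OF that] by (metis mult.assoc mult_1_right)
    finally show ?thesis .
  qed
  show "K i * K' j = K' j * K i" by (rule *[OF i j])
  have "K' i * K' j = K' i * (K' j * K i) * K' i"
    using KK[OF i i] by (simp add: mult.assoc)
  also have "\<dots> = K' j * K' i" using KK[OF i i] *[OF i j] by (metis mult.assoc mult_1_left)
  finally show "K' i * K' j = K' j * K' i" .
qed

text \<open>Two representations that commute inside one algebra stand in for a tensor product. Both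
  \<open>E\<close> and \<open>F\<close> have the coproduct (X tensor K) + (K' tensor X); every
  relation reduces to the two summands and to the way they commute up to a power of
  \<open>q\<close>.\<close>

lemma uq_rep_comult:
  assumes q: "q \<noteq> 0" and r1: "uq_rep q N E1 F1 K1 K1'" and r2: "uq_rep q N E2 F2 K2 K2'"
    and comm: "\<And>i j x y. \<lbrakk>i \<in> {1..N}; j \<in> {1..N}; x \<in> {E1 i, F1 i, K1 i, K1' i};
       y \<in> {E2 j, F2 j, K2 j, K2' j}\<rbrakk> \<Longrightarrow> x * y = y * x"
  shows "uq_rep q N (\<lambda>i. E1 i * K2 i + K1' i * E2 i) (\<lambda>i. F1 i * K2 i + K1' i * F2 i)
      (\<lambda>i. K1 i * K2 i) (\<lambda>i. K1' i * K2' i)"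
proof -
  obtain I where I: "I = {1..N}" by simp
  have KK1: "K1 i * K1 j = K1 j * K1 i" "K1 i * K1' j = K1' j * K1 i" "K1' i * K1' j = K1' j * K1' i"
    and KK2: "K2 i * K2 j = K2 j * K2 i" "K2 i * K2' j = K2' j * K2 i" "K2' i * K2' j = K2' j * K2' i"
    if "i \<in> I" "j \<in> I" for i j
    using uq_rep_KK'[OF r1] uq_rep_KK'[OF r2] r1 r2 that by (auto simp: uq_rep_def I)
  have inv: "K1 i * K1' i = 1" "K1' i * K1 i = 1" "K2 i * K2' i = 1" "K2' i * K2 i = 1"
    if "i \<in> I" for i
    using r1 r2 that by (auto simp: uq_rep_def I)
  have EK: "E1 j * K1 i = sc (q powi (- cartan i j)) (K1 i * E1 j)"
      "E2 j * K2 i = sc (q powi (- cartan i j)) (K2 i * E2 j)"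
      "E1 j * K1' i = sc (q powi (cartan i j)) (K1' i * E1 j)"
      "E2 j * K2' i = sc (q powi (cartan i j)) (K2' i * E2 j)"
    and KF: "K1 i * F1 j = sc (q powi (- cartan i j)) (F1 j * K1 i)"
      "K2 i * F2 j = sc (q powi (- cartan i j)) (F2 j * K2 i)"
      "K1' i * F1 j = sc (q powi (cartan i j)) (F1 j * K1' i)"
      "K2' i * F2 j = sc (q powi (cartan i j)) (F2 j * K2' i)"
    and EF: "E1 i * F1 j - F1 j * E1 i =
        (if i = j then sc (1 / (q\<^sup>2 - q powi (-2))) (K1 i * K1 i - K1' i * K1' i) else 0)"
      "E2 i * F2 j - F2 j * E2 i =
        (if i = j then sc (1 / (q\<^sup>2 - q powi (-2))) (K2 i * K2 i - K2' i * K2' i) else 0)"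
    if "i \<in> I" "j \<in> I" for i j
    using r1 r2 that unfolding uq_rep_def I by blast+
  have serre: "cartan i j = -1 \<Longrightarrow> qserre (q\<^sup>2) (E1 i) (E1 j) = 0 \<and> qserre (q\<^sup>2) (F1 i) (F1 j) = 0"
      "cartan i j = -1 \<Longrightarrow> qserre (q\<^sup>2) (E2 i) (E2 j) = 0 \<and> qserre (q\<^sup>2) (F2 i) (F2 j) = 0"
    and far: "cartan i j = 0 \<Longrightarrow> E1 i * E1 j = E1 j * E1 i \<and> F1 i * F1 j = F1 j * F1 i"
      "cartan i j = 0 \<Longrightarrow> E2 i * E2 j = E2 j * E2 i \<and> F2 i * F2 j = F2 j * F2 i"
    if "i \<in> I" "j \<in> I" for i j
    using r1 r2 that unfolding uq_rep_def I by blast+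
  have cm: "E2 j * x = x * E2 j" "F2 j * x = x * F2 j" "K2 j * x = x * K2 j" "K2' j * x = x * K2' j"
    if "i \<in> I" "j \<in> I" "x \<in> {E1 i, F1 i, K1 i, K1' i}" for i j x
    using comm[OF that(1,2)[unfolded I] that(3)] by auto
  have cm1: "E2 j * E1 i = E1 i * E2 j" "E2 j * F1 i = F1 i * E2 j" "E2 j * K1 i = K1 i * E2 j"
      "E2 j * K1' i = K1' i * E2 j" "F2 j * E1 i = E1 i * F2 j" "F2 j * F1 i = F1 i * F2 j"
      "F2 j * K1 i = K1 i * F2 j" "F2 j * K1' i = K1' i * F2 j"
      "K2 j * E1 i = E1 i * K2 j" "K2 j * F1 i = F1 i * K2 j" "K2 j * K1 i = K1 i * K2 j"
      "K2 j * K1' i = K1' i * K2 j" "K2' j * E1 i = E1 i * K2' j" "K2' j * F1 i = F1 i * K2' j"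
      "K2' j * K1 i = K1 i * K2' j" "K2' j * K1' i = K1' i * K2' j"
    if "i \<in> I" "j \<in> I" for i j
    using cm[OF that] by auto
  have mid: "(a * b) * (c * d) = (a * c) * (b * d)" if "b * c = c * b" for a b c d :: 'a
    using that by (metis mult.assoc)
  have pw: "q powi a * q powi (-a) = 1" "q powi (-a) * q powi a = 1" for a
    using q by (simp_all add: power_int_minus)
  have pw2: "q powi a * q powi a = (q\<^sup>2) powi a" for a
    using q by (metis power2_eq_square power_int_mult_distrib)
  define AE where "AE i = E1 i * K2 i" for i
  define BE where "BE i = K1' i * E2 i" for i
  define AF where "AF i = F1 i * K2 i" for i
  define BF where "BF i = K1' i * F2 i" for i
  \<comment> \<open>Moving a generator past \<open>K1'\<close> and moving \<open>K2\<close> past a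
    generator each cost one power of \<open>q\<close>. The two powers agree for \<open>E\<close>
    with \<open>E\<close> and for \<open>F\<close> with \<open>F\<close>, hence the square; they
    cancel for \<open>E\<close> with \<open>F\<close>.\<close>
  have ABE: "AE i * BE j = sc ((q\<^sup>2) powi (cartan i j)) (BE j * AE i)"
    and ABF: "AF i * BF j = sc ((q\<^sup>2) powi (- cartan i j)) (BF j * AF i)"
    and AEBF: "AE i * BF j = BF j * AE i" and BEAF: "BE i * AF j = AF j * BE i"
    if i: "i \<in> I" and j: "j \<in> I" for i j
  proof -
    have EK': "K2 i * E2 j = sc (q powi (cartan i j)) (E2 j * K2 i)"
      using EK(2)[OF i j] by (simp add: sc_sc pw sc_one)
    have KF': "F1 i * K1' j = sc (q powi (- cartan i j)) (K1' j * F1 i)"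
      using KF(3)[OF j i] by (simp add: sc_sc pw sc_one cartan_sym[of i j])
    have "AE i * BE j = (E1 i * K1' j) * (K2 i * E2 j)"
      unfolding AE_def BE_def by (rule mid) (use cm1 i j in auto)
    also have "\<dots> = sc ((q\<^sup>2) powi (cartan i j)) ((K1' j * E1 i) * (E2 j * K2 i))"
      unfolding EK(3)[OF j i] EK' by (simp add: mult_sc_left mult_sc_right sc_sc pw2 cartan_sym[of j i])
    also have "(K1' j * E1 i) * (E2 j * K2 i) = BE j * AE i"
      unfolding AE_def BE_def by (rule mid) (use cm1 i j in auto)
    finally show "AE i * BE j = sc ((q\<^sup>2) powi (cartan i j)) (BE j * AE i)" .
    have "AF i * BF j = (F1 i * K1' j) * (K2 i * F2 j)"
      unfolding AF_def BF_def by (rule mid) (use cm1 i j in auto)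
    also have "\<dots> = sc ((q\<^sup>2) powi (- cartan i j)) ((K1' j * F1 i) * (F2 j * K2 i))"
      unfolding KF(2)[OF i j] KF' by (simp add: mult_sc_left mult_sc_right sc_sc pw2)
    also have "(K1' j * F1 i) * (F2 j * K2 i) = BF j * AF i"
      unfolding AF_def BF_def by (rule mid) (use cm1 i j in auto)
    finally show "AF i * BF j = sc ((q\<^sup>2) powi (- cartan i j)) (BF j * AF i)" .
    have "AE i * BF j = (E1 i * K1' j) * (K2 i * F2 j)"
      unfolding AE_def BF_def by (rule mid) (use cm1 i j in auto)
    also have "\<dots> = (K1' j * E1 i) * (F2 j * K2 i)"
      unfolding KF(2)[OF i j] EK(3)[OF j i]
      by (simp add: mult_sc_left mult_sc_right sc_sc pw sc_one cartan_sym[of j i])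
    also have "\<dots> = BF j * AE i"
      unfolding AE_def BF_def by (rule mid) (use cm1 i j in auto)
    finally show "AE i * BF j = BF j * AE i" .
    have "AF j * BE i = (F1 j * K1' i) * (K2 j * E2 i)"
      unfolding AF_def BE_def by (rule mid) (use cm1 i j in auto)
    also have "\<dots> = (K1' i * F1 j) * (E2 i * K2 j)"
      unfolding EK(2)[OF j i] KF(3)[OF i j]
      by (simp add: mult_sc_left mult_sc_right sc_sc pw sc_one cartan_sym[of j i])
    also have "\<dots> = BE i * AF j"
      unfolding AF_def BE_def by (rule mid) (use cm1 i j in auto)
    finally show "BE i * AF j = AF j * BE i" ..
  qed
  have q2: "q\<^sup>2 \<noteq> 0" using q by simp
  show ?thesis unfolding uq_rep_def I[symmetric] AE_def[symmetric] BE_def[symmetric] AF_def[symmetric] BF_def[symmetric]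
  proof (intro ballI conjI impI)
    fix i j assume i: "i \<in> I" and j: "j \<in> I"
    note cmi = cm1[OF i i] cm1[OF i j] cm1[OF j i] cm1[OF j j]
    show "K1 i * K2 i * (K1 j * K2 j) = K1 j * K2 j * (K1 i * K2 i)"
      using KK1(1)[OF i j] KK2(1)[OF i j] by (simp add: mid[OF cm1(11)] i j)
    show "K1 i * K2 i * (K1' i * K2' i) = 1" "K1' i * K2' i * (K1 i * K2 i) = 1"
      using inv[OF i] by (simp_all add: mid[OF cm1(12)] mid[OF cm1(15)] i)
    show "(AE j + BE j) * (K1 i * K2 i) = sc (q powi - cartan i j) (K1 i * K2 i * (AE j + BE j))"
    proof -
      have "AE j * (K1 i * K2 i) = sc (q powi - cartan i j) (K1 i * K2 i * AE j)"
        using EK(1)[OF i j] KK2(1)[OF i j] cmi 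
        by (simp add: AE_def mid[OF cm1(11)] mid[OF cm1(9)] i j mult_sc_left)
      moreover have "BE j * (K1 i * K2 i) = sc (q powi - cartan i j) (K1 i * K2 i * BE j)"
        using EK(2)[OF i j] KK1(2)[OF i j] 
        by (simp add: BE_def mid[OF cm1(3)] mid[OF cm1(12)] i j mult_sc_right)
      ultimately show ?thesis by (simp add: distrib_left distrib_right sc_add_right)
    qed
    show "(AE j + BE j) * (K1' i * K2' i) = sc (q powi cartan i j) (K1' i * K2' i * (AE j + BE j))"
    proof -
      have "AE j * (K1' i * K2' i) = sc (q powi cartan i j) (K1' i * K2' i * AE j)"
        using EK(3)[OF i j] KK2(2)[OF j i] 
        by (simp add: AE_def mid[OF cm1(12)] mid[OF cm1(13)] i j mult_sc_left)
      moreover have "BE j * (K1' i * K2' i) = sc (q powi cartan i j) (K1' i * K2' i * BE j)"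
        using EK(4)[OF i j] KK1(3)[OF i j] 
        by (simp add: BE_def mid[OF cm1(4)] mid[OF cm1(16)] i j mult_sc_right)
      ultimately show ?thesis by (simp add: distrib_left distrib_right sc_add_right)
    qed
    show "(K1 i * K2 i) * (AF j + BF j) = sc (q powi - cartan i j) ((AF j + BF j) * (K1 i * K2 i))"
    proof -
      have "(K1 i * K2 i) * AF j = sc (q powi - cartan i j) (AF j * (K1 i * K2 i))"
        using KF(1)[OF i j] KK2(1)[OF i j] 
        by (simp add: AF_def mid[OF cm1(11)] mid[OF cm1(10)] i j mult_sc_left)
      moreover have "(K1 i * K2 i) * BF j = sc (q powi - cartan i j) (BF j * (K1 i * K2 i))"
        using KF(2)[OF i j] KK1(2)[OF i j] 
        by (simp add: BF_def mid[OF cm1(7)] mid[OF cm1(12)] i j mult_sc_right)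
      ultimately show ?thesis by (simp add: distrib_left distrib_right sc_add_right)
    qed
    show "(K1' i * K2' i) * (AF j + BF j) = sc (q powi cartan i j) ((AF j + BF j) * (K1' i * K2' i))"
    proof -
      have "(K1' i * K2' i) * AF j = sc (q powi cartan i j) (AF j * (K1' i * K2' i))"
        using KF(3)[OF i j] KK2(2)[OF j i] 
        by (simp add: AF_def mid[OF cm1(12)] mid[OF cm1(14)] i j mult_sc_left)
      moreover have "(K1' i * K2' i) * BF j = sc (q powi cartan i j) (BF j * (K1' i * K2' i))"
        using KF(4)[OF i j] KK1(3)[OF i j] 
        by (simp add: BF_def mid[OF cm1(8)] mid[OF cm1(16)] i j mult_sc_right)
      ultimately show ?thesis by (simp add: distrib_left distrib_right sc_add_right)
    qed
    \<comment> \<open>For \<open>i = j\<close> the sum of \<open>AA\<close> and \<open>BB\<close>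
      telescopes: the product of the squares of \<open>K1'\<close> and \<open>K2\<close> occurs once
      with each sign.\<close>
    have AA: "AE i * AF j - AF j * AE i = (E1 i * F1 j - F1 j * E1 i) * (K2 i * K2 j)"
      using KK2(1)[OF i j]
      by (simp add: AE_def AF_def mid[OF cm1(9)] mid[OF cm1(10)] i j left_diff_distrib)
    have BB: "BE i * BF j - BF j * BE i = (K1' i * K1' j) * (E2 i * F2 j - F2 j * E2 i)"
      using KK1(3)[OF i j]
      by (simp add: BE_def BF_def mid[OF cm1(4)] mid[OF cm1(8)] i j right_diff_distrib)
    have "(AE i + BE i) * (AF j + BF j) - (AF j + BF j) * (AE i + BE i) =
        (AE i * AF j - AF j * AE i) + (BE i * BF j - BF j * BE i)"
      using AEBF[OF i j] BEAF[OF i j] by (simp add: distrib_left distrib_right)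
    also have "\<dots> = (if i = j then sc (1 / (q\<^sup>2 - q powi - 2))
          (K1 i * K2 i * (K1 i * K2 i) - K1' i * K2' i * (K1' i * K2' i)) else 0)"
      unfolding AA BB EF[OF i j] using KK1(3)[OF i i] KK2(1)[OF i i]
      by (simp add: mid[OF cm1(11)] mid[OF cm1(16)] i j mult_sc_left mult_sc_right
          left_diff_distrib right_diff_distrib flip: sc_add_right)
    finally show "(AE i + BE i) * (AF j + BF j) - (AF j + BF j) * (AE i + BE i) = \<dots>" .
    show "qserre (q\<^sup>2) (AE i + BE i) (AE j + BE j) = 0" if c: "cartan i j = -1"
    proof -
      \<comment> \<open>\<open>AE\<close> and \<open>BE\<close> commute with the exponents of
        \<open>qserre_add\<close> for the inverse parameter, and \<open>qserre\<close> does not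
        distinguish a parameter from its inverse.\<close>
      have "qserre (inverse (q\<^sup>2)) (AE i + BE i) (AE j + BE j) = 0"
      proof (rule qserre_add)
        show "AE i * BE i = sc (inverse (inverse (q\<^sup>2)) * inverse (inverse (q\<^sup>2))) (BE i * AE i)"
          unfolding ABE[OF i i] by (simp add: cartan_def power2_eq_square)
        show "AE i * BE j = sc (inverse (q\<^sup>2)) (BE j * AE i)"
          unfolding ABE[OF i j] using c by (simp add: power_int_minus)
        show "AE j * BE i = sc (inverse (q\<^sup>2)) (BE i * AE j)"
          unfolding ABE[OF j i] using c by (simp add: power_int_minus cartan_sym[of j i])
        show "qserre (inverse (q\<^sup>2)) (AE i) (AE j) = 0" "qserre (inverse (q\<^sup>2)) (BE i) (BE j) = 0"
          unfolding AE_def BE_def qserre_inverse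
          using qserre_mult[of "E1 i" "K2 i" "K2 j" "E1 j" "q\<^sup>2"] qserre_mult[of "E2 i" "K1' i" "K1' j" "E2 j" "q\<^sup>2"]
            serre(1,2)[OF i j c] KK2(1)[OF i j] KK1(3)[OF i j] cmi by simp_all
      qed (use q2 in simp)
      thus ?thesis by (simp only: qserre_inverse)
    qed
    show "qserre (q\<^sup>2) (AF i + BF i) (AF j + BF j) = 0" if c: "cartan i j = -1"
    proof (rule qserre_add)
      show "AF i * BF i = sc (inverse (q\<^sup>2) * inverse (q\<^sup>2)) (BF i * AF i)"
        unfolding ABF[OF i i] by (simp add: cartan_def power2_eq_square power_int_minus)
      show "AF i * BF j = sc (q\<^sup>2) (BF j * AF i)"
        unfolding ABF[OF i j] using c by simp
      show "AF j * BF i = sc (q\<^sup>2) (BF i * AF j)"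
        unfolding ABF[OF j i] using c by (simp add: cartan_sym[of j i])
      show "qserre (q\<^sup>2) (AF i) (AF j) = 0" "qserre (q\<^sup>2) (BF i) (BF j) = 0"
        unfolding AF_def BF_def
        using qserre_mult[of "F1 i" "K2 i" "K2 j" "F1 j" "q\<^sup>2"] qserre_mult[of "F2 i" "K1' i" "K1' j" "F2 j" "q\<^sup>2"]
          serre(1,2)[OF i j c] KK2(1)[OF i j] KK1(3)[OF i j] cmi by simp_all
    qed (use q2 in simp)
    show "(AE i + BE i) * (AE j + BE j) = (AE j + BE j) * (AE i + BE i)" if c: "cartan i j = 0"
    proof -
      have "AE i * AE j = AE j * AE i" "BE i * BE j = BE j * BE i"
        using far[OF i j c] KK2(1)[OF i j] KK1(3)[OF i j]
        by (simp_all add: AE_def BE_def mid[OF cm1(9)] mid[OF cm1(4)] i j)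
      thus ?thesis using ABE[OF i j] ABE[OF j i] c
        by (simp add: distrib_left distrib_right cartan_sym[of j i] sc_one)
    qed
    show "(AF i + BF i) * (AF j + BF j) = (AF j + BF j) * (AF i + BF i)" if c: "cartan i j = 0"
    proof -
      have "AF i * AF j = AF j * AF i" "BF i * BF j = BF j * BF i"
        using far[OF i j c] KK2(1)[OF i j] KK1(3)[OF i j]
        by (simp_all add: AF_def BF_def mid[OF cm1(10)] mid[OF cm1(8)] i j)
      thus ?thesis using ABF[OF i j] ABF[OF j i] c
        by (simp add: distrib_left distrib_right cartan_sym[of j i] sc_one)
    qed
  qed
qed

text \<open>Jimbo's last relation for the pairs \<open>(k, l)\<close> and \<open>(l, l + 1)\<close>,
  solved for \<open>y k (l + 1)\<close>. Only arguments with \<open>k < l\<close> are meaningful;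
  the other values are defaults.\<close>

primrec root_vec :: "'k \<Rightarrow> (nat \<Rightarrow> 'a) \<Rightarrow> nat \<Rightarrow> nat \<Rightarrow> 'a" where
  "root_vec q F k 0 = 0"
| "root_vec q F k (Suc l) = (if l \<le> k then F k
     else sc q (root_vec q F k l * F l) - sc (inverse q) (F l * root_vec q F k l))"

end

section \<open>Jimbo's relations modulo an ideal\<close>

locale K_algebra_ideal = K_algebra sc for sc :: "'k::field \<Rightarrow> 'a::ring_1 \<Rightarrow> 'a" +
  fixes I :: "'a set"
  assumes I_add: "x \<in> I \<Longrightarrow> y \<in> I \<Longrightarrow> x + y \<in> I"
    and I_left: "y \<in> I \<Longrightarrow> x * y \<in> I" and I_right: "x \<in> I \<Longrightarrow> x * y \<in> I"
    and I_zero: "0 \<in> I"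
begin

lemma I_sc: "x \<in> I \<Longrightarrow> sc c x \<in> I"
  using I_left[of x "sc c 1"] by (simp add: mult_sc_left)

lemma I_minus: "x \<in> I \<Longrightarrow> - x \<in> I"
  using I_left[of x "-1"] by simp

lemma I_diff: "x \<in> I \<Longrightarrow> y \<in> I \<Longrightarrow> x - y \<in> I"
  using I_add[of x "- y"] I_minus by simp

lemmas I_intros = I_add I_diff I_minus I_sc I_left I_right I_zero

definition eqv :: "'a \<Rightarrow> 'a \<Rightarrow> bool" (infix "\<approx>" 50) where "x \<approx> y \<longleftrightarrow> x - y \<in> I"

lemma eqv_refl: "x \<approx> x" by (simp add: eqv_def I_zero)

lemma eqv_sym: "x \<approx> y \<Longrightarrow> y \<approx> x" using I_minus[of "x - y"] by (simp add: eqv_def)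

lemma eqv_trans [trans]: "x \<approx> y \<Longrightarrow> y \<approx> z \<Longrightarrow> x \<approx> z"
  using I_add[of "x - y" "y - z"] by (simp add: eqv_def)

lemma eqv_mult: "x \<approx> x' \<Longrightarrow> y \<approx> y' \<Longrightarrow> x * y \<approx> x' * y'"
proof -
  assume "x \<approx> x'" "y \<approx> y'"
  hence "(x - x') * y + x' * (y - y') \<in> I" unfolding eqv_def by (blast intro: I_intros)
  thus ?thesis by (simp add: eqv_def algebra_simps)
qed

lemma eqv_diff: "x \<approx> x' \<Longrightarrow> y \<approx> y' \<Longrightarrow> x - y \<approx> x' - y'"
  using I_diff[of "x - x'" "y - y'"] by (simp add: eqv_def algebra_simps)

lemma eqv_sc: "x \<approx> x' \<Longrightarrow> sc c x \<approx> sc c x'"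
  using I_sc[of "x - x'" c] by (simp add: eqv_def scale_right_diff_distrib)

definition qcomm :: "'k \<Rightarrow> 'a \<Rightarrow> 'a \<Rightarrow> bool" where
  "qcomm c x y \<longleftrightarrow> x * y \<approx> sc c (y * x)"

lemma qcomm_cong: "qcomm c x y \<Longrightarrow> x' \<approx> x \<Longrightarrow> y' \<approx> y \<Longrightarrow> qcomm c x' y'"
  unfolding qcomm_def by (meson eqv_mult eqv_sc eqv_sym eqv_trans)

lemma qcomm_mult: "qcomm c x y \<Longrightarrow> qcomm d x z \<Longrightarrow> qcomm (c * d) x (y * z)"
proof -
  assume "qcomm c x y" "qcomm d x z"
  hence "(x * y - sc c (y * x)) * z + sc c (y * (x * z - sc d (z * x))) \<in> I"
    unfolding qcomm_def eqv_def by (blast intro: I_intros)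
  thus ?thesis by (simp add: qcomm_def eqv_def algebra_simps sc_expand)
qed

lemma qcomm_diff: "qcomm c x y \<Longrightarrow> qcomm c x z \<Longrightarrow> qcomm c x (y - z)"
proof -
  assume "qcomm c x y" "qcomm c x z"
  hence "(x * y - sc c (y * x)) - (x * z - sc c (z * x)) \<in> I"
    unfolding qcomm_def eqv_def by (blast intro: I_intros)
  thus ?thesis by (simp add: qcomm_def eqv_def algebra_simps sc_expand)
qed

lemma qcomm_sc: "qcomm c x y \<Longrightarrow> qcomm c x (sc d y)"
proof -
  assume "qcomm c x y"
  hence "sc d (x * y - sc c (y * x)) \<in> I"
    unfolding qcomm_def eqv_def by (blast intro: I_intros)
  thus ?thesis by (simp add: qcomm_def eqv_def algebra_simps sc_expand)
qed

lemma qcomm_flip: "c \<noteq> 0 \<Longrightarrow> qcomm c x y \<Longrightarrow> qcomm (inverse c) y x"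
proof -
  assume "c \<noteq> 0" "qcomm c x y"
  hence "sc (- inverse c) (x * y - sc c (y * x)) \<in> I"
    unfolding qcomm_def eqv_def by (blast intro: I_intros)
  thus ?thesis using \<open>c \<noteq> 0\<close> by (simp add: qcomm_def eqv_def algebra_simps sc_expand)
qed

lemma comm_flip: "qcomm 1 x y \<Longrightarrow> qcomm 1 y x"
  using qcomm_flip[of 1] by simp

end

locale serre_generators = K_algebra_ideal sc I
  for sc :: "'k::field \<Rightarrow> 'a::ring_1 \<Rightarrow> 'a" and I :: "'a set" +
  fixes q :: 'k and N :: nat and F :: "nat \<Rightarrow> 'a"
  assumes q: "q \<noteq> 0" and q8: "q ^ 8 \<noteq> 1"
    and F_serre: "\<lbrakk>i \<in> {1..N}; j \<in> {1..N}; cartan i j = -1\<rbrakk> \<Longrightarrow> qserre (q\<^sup>2) (F i) (F j) \<in> I"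
    and F_far: "\<lbrakk>i \<in> {1..N}; j \<in> {1..N}; cartan i j = 0\<rbrakk> \<Longrightarrow> F i * F j - F j * F i \<in> I"
begin

definition p :: 'k where "p = inverse q"

lemma pq: "p * q = 1" "q * p = 1" "p * (q * z) = z" "q * (p * z) = z"
  using q by (simp_all add: p_def)

lemma p0: "p \<noteq> 0" using q by (simp add: p_def)

definition br :: "'a \<Rightarrow> 'a \<Rightarrow> 'a" where
  "br x y = sc q (x * y) - sc p (y * x)"

abbreviation Y :: "nat \<Rightarrow> nat \<Rightarrow> 'a" where "Y \<equiv> root_vec q F"

lemma Y_Suc: "i < l \<Longrightarrow> Y i (Suc l) = br (Y i l) (F l)"
  by (simp add: br_def p_def)

lemma Y_gen: "Y i (Suc i) = F i"
  by simp

declare root_vec.simps(2) [simp del]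

lemma br_cong: "x \<approx> x' \<Longrightarrow> y \<approx> y' \<Longrightarrow> br x y \<approx> br x' y'"
  unfolding br_def by (intro eqv_diff eqv_sc eqv_mult)

lemma qcomm_br: "qcomm c x y \<Longrightarrow> qcomm d x z \<Longrightarrow> qcomm (c * d) x (br y z)"
  unfolding br_def using qcomm_mult[of c x y d z] qcomm_mult[of d x z c y]
  by (intro qcomm_diff qcomm_sc) (simp_all add: mult.commute)

lemma qcomm_br_left:
  assumes "c \<noteq> 0" "d \<noteq> 0" "qcomm c y x" "qcomm d z x"
  shows "qcomm (c * d) (br y z) x"
  using qcomm_flip[OF _ qcomm_br[OF qcomm_flip[OF assms(1,3)] qcomm_flip[OF assms(2,4)]]] assms(1,2) by simp

text \<open>With \<open>c = x * z - z * x\<close> the two bracketings differ by exactly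
  \<open>c * y - y * c\<close>; the remaining terms agree because \<open>p * q = 1\<close>.\<close>

lemma br_assoc: "qcomm 1 x z \<Longrightarrow> br (br x y) z \<approx> br x (br y z)"
proof -
  assume "qcomm 1 x z"
  hence "(x * z - z * x) * y - y * (x * z - z * x) \<in> I"
    unfolding qcomm_def eqv_def sc_one by (blast intro: I_intros)
  moreover have "br (br x y) z - br x (br y z) = (x * z - z * x) * y - y * (x * z - z * x)"
    unfolding br_def by (simp add: algebra_simps sc_expand pq)
  ultimately show ?thesis by (simp add: eqv_def)
qed

lemma comm_Y:
  assumes "\<And>k. i \<le> k \<Longrightarrow> k < j \<Longrightarrow> qcomm 1 x (F k)" "i < j"
  shows "qcomm 1 x (Y i j)"
  using assms
proof (induction j)
  case (Suc j)
  show ?case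
  proof (cases "i = j")
    case True
    then show ?thesis using Suc.prems by (simp add: Y_gen)
  next
    case False
    hence ij: "i < j" using Suc.prems by simp
    have "qcomm (1 * 1) x (br (Y i j) (F j))"
      by (rule qcomm_br) (use Suc ij in auto)
    thus ?thesis using ij by (simp add: Y_Suc)
  qed
qed simp

section \<open>Commuting root vectors and independence of the bracketing\<close>

lemma F_comm: "\<lbrakk>k \<in> {1..N}; l \<in> {1..N}; k + 1 < l \<or> l + 1 < k\<rbrakk> \<Longrightarrow> qcomm 1 (F k) (F l)"
  using F_far[of k l] by (auto simp: qcomm_def eqv_def sc_one cartan_def)

lemma F_comm_Y:
  "\<lbrakk>1 \<le> i; i < j; j \<le> N + 1; k \<in> {1..N}; j < k \<or> k + 1 < i\<rbrakk> \<Longrightarrow> qcomm 1 (F k) (Y i j)"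
  by (rule comm_Y) (auto intro!: F_comm)

lemma Y_comm_Y:
  "\<lbrakk>1 \<le> i; i < j; j < m; m < n; n \<le> N + 1\<rbrakk> \<Longrightarrow> qcomm 1 (Y m n) (Y i j)"
  by (rule comm_flip, rule comm_Y) (auto intro!: comm_flip[OF F_comm_Y])

text \<open>\<open>root_vec\<close> splits off the last letter only. Since \<open>Y i j\<close>
  commutes with the letters beyond \<open>j\<close>, \<open>br_assoc\<close> moves the bracket, so a
  root can be cut anywhere, in particular after its first letter.\<close>

lemma Y_split:
  assumes "1 \<le> i" "i < j" "j < n" "n \<le> N + 1"
  shows "Y i n \<approx> br (Y i j) (Y j n)"
  using assms
proof (induction n)
  case (Suc n)
  show ?case
  proof (cases "j = n")
    case True
    then show ?thesis using Suc.prems by (simp add: Y_Suc Y_gen eqv_refl)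
  next
    case False
    hence jn: "j < n" using Suc.prems by simp
    have "Y i (Suc n) = br (Y i n) (F n)" using Suc.prems jn by (simp add: Y_Suc)
    also have "\<dots> \<approx> br (br (Y i j) (Y j n)) (F n)"
      using Suc jn by (intro br_cong eqv_refl) simp
    also have "\<dots> \<approx> br (Y i j) (br (Y j n) (F n))"
      using Suc.prems jn by (intro br_assoc comm_flip[OF F_comm_Y]) auto
    also have "br (Y j n) (F n) = Y j (Suc n)" using jn by (simp add: Y_Suc)
    finally show ?thesis .
  qed
qed simp

section \<open>A letter against a root vector that contains it\<close>

lemma inv_q2: "inverse (q\<^sup>2) = p * p"
  by (simp add: p_def power2_eq_square)

text \<open>Written out, each of the two commutations is the Serre relation multiplied by
  \<open>- p\<close>.\<close>

lemma F_Y2: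
  assumes "1 \<le> i" "i < N"
  shows "qcomm (p * p) (Y i (Suc (Suc i))) (F i)" "qcomm (p * p) (F (Suc i)) (Y i (Suc (Suc i)))"
proof -
  have Y: "Y i (Suc (Suc i)) = br (F i) (F (Suc i))" by (simp add: Y_Suc Y_gen)
  have "sc (- p) (qserre (q\<^sup>2) (F i) (F (Suc i))) \<in> I" "sc (- p) (qserre (q\<^sup>2) (F (Suc i)) (F i)) \<in> I"
    by (intro I_sc F_serre; use assms in \<open>simp add: cartan_def\<close>)+
  thus "qcomm (p * p) (Y i (Suc (Suc i))) (F i)" "qcomm (p * p) (F (Suc i)) (Y i (Suc (Suc i)))"
    unfolding Y br_def qcomm_def eqv_def qserre_def inv_q2
    by (simp_all add: algebra_simps sc_expand pq power2_eq_square)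
qed

text \<open>Cut at \<open>i + 2\<close>: the right part consists of letters commuting with
  \<open>F i\<close>, so the rank two case supplies the whole factor.\<close>

lemma Y_F_first:
  assumes "1 \<le> i" "i + 1 < n" "n \<le> N + 1"
  shows "qcomm (p * p) (Y i n) (F i)"
proof (cases "n = i + 2")
  case True
  then show ?thesis using F_Y2(1)[of i] assms by simp
next
  case False
  have "qcomm (p * p * 1) (br (Y i (i + 2)) (Y (i + 2) n)) (F i)"
    using False assms F_Y2(1)[of i] p0
    by (intro qcomm_br_left comm_flip[OF F_comm_Y]) auto
  moreover have "Y i n \<approx> br (Y i (i + 2)) (Y (i + 2) n)"
    using False assms by (intro Y_split) auto
  ultimately show ?thesis by (auto intro: qcomm_cong eqv_refl)
qed

lemma F_last_Y:
  assumes "1 \<le> i" "i < n" "n \<le> N"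
  shows "qcomm (p * p) (F n) (Y i (Suc n))"
proof (cases "n = Suc i")
  case True
  then show ?thesis using F_Y2(2)[of i] assms by simp
next
  case False
  have n: "n = Suc (n - 1)" "n - 1 \<ge> 1" using assms by auto
  have "qcomm (1 * (p * p)) (F n) (br (Y i (n - 1)) (Y (n - 1) (Suc n)))"
    using False assms F_Y2(2)[of "n - 1"] n
    by (intro qcomm_br F_comm_Y) auto
  moreover have "Y i (Suc n) \<approx> br (Y i (n - 1)) (Y (n - 1) (Suc n))"
    using False assms by (intro Y_split) auto
  ultimately show ?thesis by (auto intro: qcomm_cong eqv_refl)
qed

lemma q2p2: "q * q + p * p \<noteq> 0"
proof
  assume "q * q + p * p = 0"
  hence "q * q * (q * q + p * p) = 0" by simp
  hence "q ^ 4 = - 1" using pq by (simp add: algebra_simps power4_eq_xxxx eq_neg_iff_add_eq_0)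
  hence "q ^ 8 = (- 1) ^ 2" by (metis power_mult numeral_Bit0 mult_2_right)
  thus False using q8 by simp
qed

text \<open>Expanding \<open>v * u\<close> through \<open>v\<close> and through \<open>u\<close> gives two results that differ by
  \<open>(q\<^sup>2 + q\<^sup>-\<^sup>2) (f y - y f)\<close>; this is where \<open>q\<^sup>8 \<noteq> 1\<close> is needed.\<close>

lemma F_comm_Y4:
  assumes u: "u = br x f" and v: "v = br f w" and y: "y = br u w" and y': "y \<approx> br x v"
    and fu: "qcomm (p * p) f u" and vf: "qcomm (p * p) v f"
  shows "qcomm 1 f y"
proof -
  define A1 where "A1 = f * u - sc (p * p) (u * f)"
  define A2 where "A2 = v * f - sc (p * p) (f * v)"
  define A3 where "A3 = y - br x v"
  have A: "A1 \<in> I" "A2 \<in> I" "A3 \<in> I"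
    using fu vf y' by (simp_all add: A1_def A2_def A3_def qcomm_def eqv_def)
  have "sc (q * q + p * p) (f * y - y * f) = sc (q * (q * q)) (A1 * w) - sc p (w * A1) - sc (q * (q * q)) (x * A2)
      - sc (q * q) (A3 * f) + sc p (A2 * x) + sc (p * p) (f * A3)"
    unfolding A1_def A2_def A3_def y u v br_def by (simp add: algebra_simps sc_expand pq)
  hence "sc (q * q + p * p) (f * y - y * f) \<in> I" using A by (force intro: I_intros)
  hence "sc (inverse (q * q + p * p)) (sc (q * q + p * p) (f * y - y * f)) \<in> I" by (rule I_sc)
  thus ?thesis using q2p2 by (simp add: qcomm_def eqv_def sc_sc sc_one)
qed

text \<open>The essential case is the root with the three letters \<open>m - 1\<close>,
  \<open>m\<close>, \<open>m + 1\<close>, settled by \<open>F_comm_Y4\<close>. Extending it to the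
  right and to the left only adds letters that are not neighbours of \<open>m\<close>.\<close>

lemma F_comm_inner:
  assumes "1 \<le> i" "i < m" "m + 1 < n" "n \<le> N + 1"
  shows "qcomm 1 (F m) (Y i n)"
proof -
  define h where "h = m - 1"
  have m: "m = Suc h" "1 \<le> h" "h + 3 \<le> N + 1" using assms by (auto simp: h_def)
  have base: "qcomm 1 (F m) (Y h (h + 3))"
  proof (rule F_comm_Y4)
    show "Y h (h + 2) = br (F h) (F m)" "Y m (m + 2) = br (F m) (F (m + 1))"
      "Y h (h + 3) = br (Y h (h + 2)) (F (m + 1))"
      by (simp_all add: Y_Suc Y_gen m numeral_3_eq_3)
    show "Y h (h + 3) \<approx> br (F h) (Y m (m + 2))"
      using Y_split[of h m "h + 3"] m by (simp add: Y_gen numeral_3_eq_3)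
    show "qcomm (p * p) (F m) (Y h (h + 2))" using F_Y2(2)[of h] m by simp
    show "qcomm (p * p) (Y m (m + 2)) (F m)" using F_Y2(1)[of m] m by simp
  qed
  have right: "qcomm 1 (F m) (Y h n)"
  proof (cases "n = h + 3")
    case False
    have "qcomm (1 * 1) (F m) (br (Y h (h + 3)) (Y (h + 3) n))"
      using False assms m by (intro qcomm_br base F_comm_Y) auto
    moreover have "Y h n \<approx> br (Y h (h + 3)) (Y (h + 3) n)"
      using False assms m by (intro Y_split) auto
    ultimately show ?thesis by (auto intro: qcomm_cong eqv_refl)
  qed (use base in simp)
  show ?thesis
  proof (cases "i = h")
    case False
    have "qcomm (1 * 1) (F m) (br (Y i h) (Y h n))"
      using False assms m by (intro qcomm_br right F_comm_Y) auto
    moreover have "Y i n \<approx> br (Y i h) (Y h n)"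
      using False assms m by (intro Y_split) auto
    ultimately show ?thesis by (auto intro: qcomm_cong eqv_refl)
  qed (use right in simp)
qed

section \<open>Jimbo's relations between two root vectors\<close>

lemma Y_same_row:
  assumes "1 \<le> i" "i < j" "j < n" "n \<le> N + 1"
  shows "qcomm (p * p) (Y i n) (Y i j)"
  using assms(2,3)
proof (induction j)
  case (Suc j)
  show ?case
  proof (cases "i = j")
    case True
    then show ?thesis using Suc.prems assms by (simp add: Y_gen Y_F_first)
  next
    case False
    hence ij: "i < j" using Suc.prems by simp
    \<comment> \<open>The factor \<open>p * p\<close> comes from the first letter \<open>F i\<close>
      alone; each later letter \<open>F j\<close> is interior to \<open>Y i n\<close> and commutes
      with it.\<close>
    have "qcomm (p * p * 1) (Y i n) (br (Y i j) (F j))"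
      using Suc ij assms by (intro qcomm_br comm_flip[OF F_comm_inner]) auto
    thus ?thesis using ij by (simp add: Y_Suc)
  qed
qed simp

lemma Y_same_column:
  assumes "1 \<le> i" "i < m" "m < n" "n \<le> N + 1"
  shows "qcomm (p * p) (Y m n) (Y i n)"
  using assms(2,3)
proof (induction "n - m" arbitrary: m)
  case (Suc d)
  show ?case
  proof (cases "n = Suc m")
    case True
    then show ?thesis using Suc.prems assms by (simp add: Y_gen F_last_Y)
  next
    case False
    \<comment> \<open>Now the last letter carries the factor, so letters are removed on the left,
      which \<open>Y_split\<close> permits.\<close>
    have "qcomm (1 * (p * p)) (br (F m) (Y (Suc m) n)) (Y i n)"
      using Suc.prems Suc.hyps False assms p0 by (intro qcomm_br_left F_comm_inner Suc.hyps) auto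
    moreover have "Y m n \<approx> br (Y m (Suc m)) (Y (Suc m) n)"
      using Suc.prems False assms by (intro Y_split) auto
    ultimately show ?thesis by (auto intro: qcomm_cong eqv_refl simp: Y_gen)
  qed
qed simp

lemma Y_nested:
  assumes "1 \<le> i" "i < m" "m < n" "n < j" "j \<le> N + 1"
  shows "qcomm 1 (Y m n) (Y i j)"
  by (rule comm_flip, rule comm_Y) (use assms in \<open>auto intro!: comm_flip[OF F_comm_inner]\<close>)

text \<open>With \<open>a\<close>, \<open>b\<close>, \<open>c\<close> the pieces
  \<open>(i, j)\<close>, \<open>(m, j)\<close>, \<open>(j, n)\<close>, both \<open>Y i n\<close> and
  \<open>Y m n\<close> are brackets with the same \<open>c\<close>. The relation is then a
  combination of two known ones: \<open>b\<close> commutes with \<open>Y i n\<close> (nested roots)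
  and commutes with \<open>a\<close> up to \<open>p * p\<close> (same column).\<close>

lemma Y_crossing:
  assumes "1 \<le> i" "i < m" "m < j" "j < n" "n \<le> N + 1"
  shows "Y m n * Y i j \<approx> Y i j * Y m n - sc (q * q - p * p) (Y i n * Y m j)"
proof -
  define a b c e where "a = Y i j" "b = Y m j" "c = Y j n" "e = br a c"
  note abce = this
  have e: "Y i n \<approx> e" and mn: "Y m n \<approx> br b c"
    unfolding abce using assms by (auto intro!: Y_split)
  have "qcomm 1 b e"
    using Y_nested[of i m j n] assms e by (auto simp: abce intro: qcomm_cong eqv_refl eqv_sym)
  moreover have "qcomm (p * p) b a"
    using Y_same_column[of i m j] assms by (simp add: abce)
  ultimately have B: "b * a - sc (p * p) (a * b) \<in> I" "b * e - e * b \<in> I"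
    by (simp_all add: qcomm_def eqv_def sc_one)
  have "br b c * a - (a * br b c - sc (q * q - p * p) (e * b)) =
      sc (q * (q * q)) ((b * a - sc (p * p) (a * b)) * c) - sc p (c * (b * a - sc (p * p) (a * b)))
       - sc (q * q) (b * e - e * b)"
    unfolding br_def abce(4) by (simp add: algebra_simps sc_expand pq)
  also have "\<dots> \<in> I" using B by (blast intro: I_intros)
  finally have "br b c * a \<approx> a * br b c - sc (q * q - p * p) (e * b)" by (simp add: eqv_def)
  moreover have "Y m n * Y i j \<approx> br b c * a" using mn by (auto simp: abce intro: eqv_mult eqv_refl)
  moreover have "a * br b c - sc (q * q - p * p) (e * b) \<approx> Y i j * Y m n - sc (q * q - p * p) (Y i n * Y m j)"
    using mn e by (auto simp: abce(1,2) intro!: eqv_diff eqv_sc eqv_mult eqv_refl intro: eqv_sym)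
  ultimately show ?thesis by (meson eqv_trans)
qed

lemma Y_adjacent:
  assumes "1 \<le> i" "i < j" "j < n" "n \<le> N + 1"
  shows "Y j n * Y i j \<approx> sc (q * q) (Y i j * Y j n) - sc q (Y i n)"
proof -
  have "sc q (Y i n - br (Y i j) (Y j n)) \<in> I" using Y_split[OF assms] by (simp add: eqv_def I_sc)
  thus ?thesis unfolding br_def eqv_def by (simp add: algebra_simps sc_expand pq)
qed

end

section \<open>Free algebras and their quotients\<close>

lemma poly_mapping_sum_singles:
  fixes p :: "'a \<Rightarrow>\<^sub>0 'b::comm_monoid_add"
  shows "p = (\<Sum>w\<in>Poly_Mapping.keys p. Poly_Mapping.single w (Poly_Mapping.lookup p w))"
  by (rule poly_mapping_eqI) (simp add: lookup_sum lookup_single when_def in_keys_iff)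

text \<open>Limiting the last case to the keys of \<open>p\<close> keeps the induction among words
  over the letters that \<open>p\<close> uses.\<close>

lemma poly_mapping_additive_induct:
  fixes p :: "'a \<Rightarrow>\<^sub>0 'b::comm_monoid_add"
  assumes "P 0" "\<And>p q. P p \<Longrightarrow> P q \<Longrightarrow> P (p + q)" "\<And>w c. w \<in> Poly_Mapping.keys p \<Longrightarrow> P (Poly_Mapping.single w c)"
  shows "P p"
proof -
  have "P (\<Sum>w\<in>W. Poly_Mapping.single w (Poly_Mapping.lookup p w))"
    if "finite W" "W \<subseteq> Poly_Mapping.keys p" for W
    using that by (induction rule: finite_induct) (simp_all add: assms)
  thus ?thesis using poly_mapping_sum_singles[of p] by (metis finite_keys order_refl)
qed

lemma scal_single: "scal c (Poly_Mapping.single w a) = Poly_Mapping.single w (c * a)"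
  by (simp add: scal_def mult_single)

interpretation free: K_algebra scal
proof
  fix c :: "'k::field" and x y :: "'g free_word \<Rightarrow>\<^sub>0 'k"
  have central: "x * Poly_Mapping.single 0 c = Poly_Mapping.single 0 c * x" for x :: "'g free_word \<Rightarrow>\<^sub>0 'k"
    by (rule poly_mapping_additive_induct[of _ x]) (simp_all add: distrib_left distrib_right mult_single mult.commute)
  show "x * scal c y = scal c (x * y)"
    unfolding scal_def by (simp add: central flip: mult.assoc)
qed (simp_all add: scal_def distrib_left distrib_right single_add mult_single flip: mult.assoc)

section \<open>Homomorphisms out of the free algebra\<close>

context K_algebra
begin

text \<open>The homomorphism provided by the universal property of the free algebra.\<close>

definition ev :: "('g \<Rightarrow> 'a) \<Rightarrow> ('g free_word \<Rightarrow>\<^sub>0 'k) \<Rightarrow> 'a" where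
  "ev f p = (\<Sum>w\<in>Poly_Mapping.keys p. sc (Poly_Mapping.lookup p w) (prod_list (map f (letters w))))"

lemma ev_superset:
  assumes "finite W" "Poly_Mapping.keys p \<subseteq> W"
  shows "ev f p = (\<Sum>w\<in>W. sc (Poly_Mapping.lookup p w) (prod_list (map f (letters w))))"
  unfolding ev_def using assms by (intro sum.mono_neutral_left) (auto simp: in_keys_iff)

lemma ev_zero: "ev f 0 = 0"
  by (simp add: ev_def)

lemma ev_add: "ev f (p + q) = ev f p + ev f q"
proof -
  let ?W = "Poly_Mapping.keys p \<union> Poly_Mapping.keys q"
  have "ev f (p + q) = (\<Sum>w\<in>?W. sc (Poly_Mapping.lookup (p + q) w) (prod_list (map f (letters w))))"
    by (intro ev_superset) (simp_all add: Poly_Mapping.keys_add)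
  also have "\<dots> = ev f p + ev f q"
    unfolding lookup_add sc_add_left sum.distrib
    by (intro arg_cong2[where f = "(+)"] ev_superset[symmetric]) auto
  finally show ?thesis .
qed

lemma ev_single: "ev f (Poly_Mapping.single w c) = sc c (prod_list (map f (letters w)))"
  by (subst ev_superset[of "{w}"]) simp_all

lemma ev_gen: "ev f (gen g) = f g"
  by (simp add: gen_def ev_single sc_one)

lemma ev_one: "ev f 1 = 1"
  unfolding single_one[symmetric] by (simp add: ev_single sc_one zero_free_word_def)

lemma ev_minus: "ev f (- p) = - ev f p"
  using ev_add[of f p "- p"] by (simp add: ev_zero eq_neg_iff_add_eq_0 add.commute)

lemma ev_diff: "ev f (p - q) = ev f p - ev f q"
  using ev_add[of f p "- q"] by (simp add: ev_minus)

lemma ev_mult: "ev f (p * q) = ev f p * ev f q"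
proof (rule poly_mapping_additive_induct[of _ p])
  fix w c
  show "ev f (Poly_Mapping.single w c * q) = ev f (Poly_Mapping.single w c) * ev f q"
    by (rule poly_mapping_additive_induct[of _ q])
      (simp_all add: ev_zero ev_add ev_single distrib_left distrib_right mult_single plus_free_word_def
        mult_sc_left mult_sc_right sc_sc)
qed (simp_all add: ev_zero ev_add distrib_right)

lemma ev_scal: "ev f (scal c p) = sc c (ev f p)"
  by (simp add: scal_def ev_mult ev_single zero_free_word_def mult_sc_left)

lemma ev_sum: "ev f (sum g A) = (\<Sum>a\<in>A. ev f (g a))"
  by (induction A rule: infinite_finite_induct) (simp_all add: ev_zero ev_add)

lemma ev_prod_list: "ev f (prod_list ps) = prod_list (map (ev f) ps)"
  by (induction ps) (simp_all add: ev_one ev_mult)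

end

lemma free_ev_gen:
  assumes "p \<in> carrier (free_algebra X)" "\<And>g. g \<in> X \<Longrightarrow> f g = gen g"
  shows "free.ev f p = p"
proof -
  have "prod_list (map f (letters w)) = Poly_Mapping.single w 1" if "set (letters w) \<subseteq> X" for w
  proof -
    have "set u \<subseteq> X \<Longrightarrow> prod_list (map f u) = Poly_Mapping.single (Word u) 1" for u
      by (induction u) (simp_all add: assms(2) gen_def mult_single plus_free_word_def flip: zero_free_word_def)
    thus ?thesis using that by (cases w) simp
  qed
  hence "free.ev f p = (\<Sum>w\<in>Poly_Mapping.keys p. Poly_Mapping.single w (Poly_Mapping.lookup p w))"
    unfolding free.ev_def using assms(1) by (intro sum.cong) (auto simp: free_algebra_def scal_single)
  thus ?thesis using poly_mapping_sum_singles[of p] by simp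
qed

context
  fixes X :: "'g set"
begin

abbreviation FA :: "('k::field, 'g free_word \<Rightarrow>\<^sub>0 'k) module" where "FA \<equiv> free_algebra X"

lemma FA_simps: "mult FA = (*)" "one FA = 1" "zero FA = 0" "add FA = (+)" "smult FA = scal"
  by (simp_all add: free_algebra_def)

lemma FA_zero: "0 \<in> carrier FA"
  by (simp add: free_algebra_def)

lemma FA_one: "1 \<in> carrier FA"
  by (simp add: free_algebra_def zero_free_word_def)

lemma FA_single: "set (letters w) \<subseteq> X \<Longrightarrow> Poly_Mapping.single w c \<in> carrier FA"
  by (simp add: free_algebra_def)

lemma FA_gen: "g \<in> X \<Longrightarrow> gen g \<in> carrier FA"
  by (simp add: gen_def FA_single)

lemma FA_add: "p \<in> carrier FA \<Longrightarrow> q \<in> carrier FA \<Longrightarrow> p + q \<in> carrier FA"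
  using Poly_Mapping.keys_add[of p q] by (auto simp: free_algebra_def)

lemma FA_mult: "p \<in> carrier FA \<Longrightarrow> q \<in> carrier FA \<Longrightarrow> p * q \<in> carrier FA"
  using Poly_Mapping.keys_mult[of p q] by (fastforce simp: free_algebra_def plus_free_word_def)

lemma FA_minus: "p \<in> carrier FA \<Longrightarrow> - p \<in> carrier FA"
  by (simp add: free_algebra_def)

lemma FA_diff: "p \<in> carrier FA \<Longrightarrow> q \<in> carrier FA \<Longrightarrow> p - q \<in> carrier FA"
  using FA_add[OF _ FA_minus, of p q] by simp

lemma FA_scal: "p \<in> carrier FA \<Longrightarrow> scal c p \<in> carrier FA"
  unfolding scal_def by (intro FA_mult FA_single) (simp add: zero_free_word_def)

lemma FA_power: "p \<in> carrier FA \<Longrightarrow> p ^ m \<in> carrier FA"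
  by (induction m) (auto intro: FA_one FA_mult)

lemma FA_sum: "(\<And>a. a \<in> A \<Longrightarrow> f a \<in> carrier FA) \<Longrightarrow> sum f A \<in> carrier FA"
  by (induction A rule: infinite_finite_induct) (auto intro: FA_zero FA_add)

lemma FA_prod_list: "(\<And>p. p \<in> set ps \<Longrightarrow> p \<in> carrier FA) \<Longrightarrow> prod_list ps \<in> carrier FA"
  by (induction ps) (auto intro: FA_one FA_mult)

lemmas FA_intros = FA_zero FA_one FA_gen FA_add FA_mult FA_minus FA_diff FA_scal FA_power FA_sum

lemma ring_FA: "ring (FA :: ('k::field, _) module)"
proof (rule ringI)
  show "abelian_group (FA :: ('k, _) module)"
  proof (rule abelian_groupI)
    fix x :: "'g free_word \<Rightarrow>\<^sub>0 'k" assume "x \<in> carrier FA"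
    thus "\<exists>y\<in>carrier FA. y \<oplus>\<^bsub>FA\<^esub> x = \<zero>\<^bsub>FA\<^esub>"
      by (intro bexI[of _ "- x"]) (auto simp: FA_simps intro: FA_minus)
  qed (auto simp: FA_simps ac_simps intro: FA_zero FA_add)
  show "monoid (FA :: ('k, _) module)"
    by (rule monoidI) (auto simp: FA_simps ac_simps intro: FA_one FA_mult)
qed (auto simp: FA_simps algebra_simps)

lemma FA_a_minus:
  assumes "x \<in> carrier FA" "y \<in> carrier (FA :: ('k::field, _) module)"
  shows "x \<ominus>\<^bsub>FA\<^esub> y = x - y"
proof -
  interpret ring "FA :: ('k, _) module" by (rule ring_FA)
  have "\<ominus>\<^bsub>FA\<^esub> y = - y"
    using assms(2) by (intro minus_equality) (auto simp: FA_simps intro: FA_minus)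
  thus ?thesis by (simp add: a_minus_def FA_simps)
qed

end

lemma free_ev_closed:
  assumes "\<And>g. f g \<in> carrier (free_algebra X)"
  shows "free.ev f p \<in> carrier (free_algebra X)"
  unfolding free.ev_def using assms by (intro FA_sum FA_scal FA_prod_list) auto

section \<open>Quotients of free algebras and their subalgebras\<close>

locale free_quotient =
  fixes X :: "'g set" and I :: "('g free_word \<Rightarrow>\<^sub>0 'k::field) set"
  assumes ideal_I: "ideal I (free_algebra X :: ('k, _) module)"
begin

abbreviation A :: "('k, 'g free_word \<Rightarrow>\<^sub>0 'k) module" where "A \<equiv> free_algebra X"

abbreviation Q where "Q \<equiv> quotient_algebra A I"

definition cls :: "('g free_word \<Rightarrow>\<^sub>0 'k) \<Rightarrow> ('g free_word \<Rightarrow>\<^sub>0 'k) set" where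
  "cls p = I +>\<^bsub>A\<^esub> p"

interpretation A: ring A by (rule ring_FA)
interpretation I: ideal I A by (rule ideal_I)

lemma cls_eq_iff: "p \<in> carrier A \<Longrightarrow> r \<in> carrier A \<Longrightarrow> cls p = cls r \<longleftrightarrow> p - r \<in> I"
  using A.quotient_eq_iff_same_a_r_cos[OF ideal_I, of p r] by (simp add: cls_def FA_a_minus)

lemma I_carrier: "I \<subseteq> carrier A"
  using I.a_subset by simp

lemma cls_self: "p \<in> carrier A \<Longrightarrow> p \<in> cls p"
  unfolding cls_def by (rule I.a_rcos_self)

lemma in_clsD:
  assumes "r \<in> cls p" "p \<in> carrier A" shows "r \<in> carrier A" "cls r = cls p"
proof -
  show r: "r \<in> carrier A" using assms I_carrier FA_add by (auto simp: cls_def a_r_coset_def' FA_simps)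
  have "r - p \<in> I" using assms by (auto simp: cls_def a_r_coset_def' FA_simps)
  thus "cls r = cls p" using cls_eq_iff r assms by simp
qed

lemma Q_simps:
  "carrier Q = cls ` carrier A" "one Q = cls 1" "zero Q = cls 0"
  "add Q = set_add A" "mult Q = rcoset_mult A I"
  "smult Q = (\<lambda>c X. \<Union>x\<in>X. I +>\<^bsub>A\<^esub> (scal c x))"
proof -
  have "I = cls 0" using I.a_subset by (auto simp: cls_def a_r_coset_def' FA_simps)
  thus "zero Q = cls 0"
    by (simp add: quotient_algebra_def ring.defs module.defs FactRing_def)
qed (auto simp: quotient_algebra_def ring.defs module.defs FactRing_def A_RCOSETS_def' cls_def FA_simps)

lemma Q_add: "p \<in> carrier A \<Longrightarrow> r \<in> carrier A \<Longrightarrow> cls p \<oplus>\<^bsub>Q\<^esub> cls r = cls (p + r)"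
  unfolding Q_simps cls_def using I.a_rcos_sum by (simp add: FA_simps)

lemma Q_mult: "p \<in> carrier A \<Longrightarrow> r \<in> carrier A \<Longrightarrow> cls p \<otimes>\<^bsub>Q\<^esub> cls r = cls (p * r)"
  unfolding Q_simps cls_def using I.rcoset_mult_add by (simp add: FA_simps)

lemma I_scal: "p \<in> I \<Longrightarrow> scal c p \<in> I"
  using I.I_l_closed[of p "Poly_Mapping.single 0 c"] FA_single[of 0 X c]
  by (simp add: scal_def FA_simps zero_free_word_def)

text \<open>All representatives of a class yield the same coset, so the union in
  \<open>quotient_algebra\<close> is a union of equal sets.\<close>

lemma Q_smult: "p \<in> carrier A \<Longrightarrow> c \<odot>\<^bsub>Q\<^esub> cls p = cls (scal c p)"
proof -
  assume p: "p \<in> carrier A"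
  have "cls (scal c r) = cls (scal c p)" if "r \<in> cls p" for r
  proof -
    have r: "r \<in> carrier A" "r - p \<in> I" using in_clsD[OF that p] p cls_eq_iff by auto
    have "scal c (r - p) \<in> I" using r by (intro I_scal)
    hence "scal c r - scal c p \<in> I" by (simp add: free.scale_right_diff_distrib)
    thus ?thesis using r p by (subst cls_eq_iff) (auto intro: FA_scal)
  qed
  thus ?thesis unfolding Q_simps cls_def[symmetric] using cls_self[OF p] by blast
qed

text \<open>Only the carrier changes, so the quotient itself is \<open>sub (carrier A)\<close> and
  one proof of the algebra axioms serves both it and the subalgebras.\<close>

definition sub :: "('g free_word \<Rightarrow>\<^sub>0 'k) set \<Rightarrow> ('k, ('g free_word \<Rightarrow>\<^sub>0 'k) set) module" where
  "sub S = Q\<lparr>carrier := cls ` S\<rparr>"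

lemma sub_simps: "carrier (sub S) = cls ` S" "one (sub S) = cls 1" "zero (sub S) = cls 0"
  "add (sub S) = add Q" "mult (sub S) = mult Q" "smult (sub S) = smult Q"
  by (simp_all add: sub_def Q_simps)

lemma sub_assoc_algebra:
  assumes "S = carrier (free_algebra Z)" "Z \<subseteq> X"
  shows "assoc_algebra class_ring (sub S)"
proof -
  have SA: "p \<in> carrier A" if "p \<in> S" for p using assms that by (auto simp: free_algebra_def)
  have S: "0 \<in> S" "1 \<in> S" "g \<in> Z \<Longrightarrow> gen g \<in> S" "p \<in> S \<Longrightarrow> r \<in> S \<Longrightarrow> p + r \<in> S"
    "p \<in> S \<Longrightarrow> r \<in> S \<Longrightarrow> p * r \<in> S" "p \<in> S \<Longrightarrow> - p \<in> S" "p \<in> S \<Longrightarrow> scal c p \<in> S" for g p r c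
    unfolding assms(1) by (intro FA_intros; assumption)+
  have ab: "abelian_group (sub S)"
  proof (rule abelian_groupI)
    fix x assume "x \<in> carrier (sub S)"
    then obtain p where p: "x = cls p" "p \<in> S" by (auto simp: sub_simps)
    show "\<exists>y\<in>carrier (sub S). y \<oplus>\<^bsub>sub S\<^esub> x = \<zero>\<^bsub>sub S\<^esub>"
      using p S(6) by (intro bexI[of _ "cls (- p)"]) (auto simp: sub_simps Q_add SA)
  qed (auto simp: sub_simps Q_add SA S FA_add ac_simps assms(1)[symmetric] intro!: imageI)
  have mon: "monoid (sub S)"
    by (rule monoidI) (auto simp: sub_simps Q_mult SA S FA_mult FA_one ac_simps intro!: imageI)
  have ring: "ring (sub S)"
    by (rule ringI[OF ab mon]) (auto simp: sub_simps Q_mult Q_add SA S FA_mult FA_add algebra_simps)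
  interpret ring "sub S" by (rule ring)
  have mod: "module class_ring (sub S)"
  proof (rule moduleI)
    show "cring (class_ring :: 'k ring)" by (rule class_cring.cring_axioms)
    show "abelian_group (sub S)" by (rule ab)
  qed (auto simp: sub_simps Q_smult Q_add SA S FA_scal FA_add free.sc_expand intro!: imageI)
  show ?thesis
  proof (intro assoc_algebra.intro vectorspace.intro assoc_algebra_axioms.intro)
    show "field (class_ring :: 'k ring)" by (rule class_field)
  qed (use mod ring in \<open>auto simp: sub_simps Q_smult Q_mult SA S FA_scal FA_mult free.sc_expand\<close>)
qed

text \<open>Replaces the intersection by an explicit carrier: elements of the subalgebra have
  representatives using letters of \<open>Z\<close> only. The image of the free algebra on
  \<open>Z\<close> is one of the intersected sets, and each of these contains all classes of words
  over \<open>Z\<close>.\<close>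

lemma subalgebra_generated_gens:
  assumes "Z \<subseteq> X"
  shows "subalgebra_generated class_ring Q (cls ` gen ` Z) = sub (carrier (free_algebra Z))"
proof -
  define S where "S = carrier (free_algebra Z :: ('k, _) module)"
  have SA: "p \<in> carrier A" if "p \<in> S" for p using assms that by (auto simp: S_def free_algebra_def)
  have S: "0 \<in> S" "1 \<in> S" "g \<in> Z \<Longrightarrow> gen g \<in> S" "p \<in> S \<Longrightarrow> r \<in> S \<Longrightarrow> p + r \<in> S"
    "p \<in> S \<Longrightarrow> r \<in> S \<Longrightarrow> p * r \<in> S" "p \<in> S \<Longrightarrow> - p \<in> S" "p \<in> S \<Longrightarrow> scal c p \<in> S" for g p r c
    unfolding S_def by (intro FA_intros; assumption)+
  interpret Q: assoc_algebra class_ring "sub (carrier A)" by (rule sub_assoc_algebra) auto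
  have QQ: "sub (carrier A) = Q" unfolding sub_def Q_simps(1)[symmetric] by simp
  let ?C = "{B. subring B Q \<and> (\<forall>c\<in>carrier class_ring. \<forall>x\<in>B. c \<odot>\<^bsub>Q\<^esub> x \<in> B) \<and> cls ` gen ` Z \<subseteq> B}"
  have 1: "cls ` S \<in> ?C"
  proof (intro CollectI conjI)
    show "subring (cls ` S) Q"
    proof (rule ring.subringI)
      show "ring Q" using Q.ring_axioms QQ by simp
      show "cls ` S \<subseteq> carrier Q" using SA by (auto simp: Q_simps)
      show "\<one>\<^bsub>Q\<^esub> \<in> cls ` S" using S by (auto simp: Q_simps)
      fix h1 h2 assume "h1 \<in> cls ` S" "h2 \<in> cls ` S"
      then obtain p r where h: "h1 = cls p" "h2 = cls r" "p \<in> S" "r \<in> S" by auto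
      show "h1 \<otimes>\<^bsub>Q\<^esub> h2 \<in> cls ` S" "h1 \<oplus>\<^bsub>Q\<^esub> h2 \<in> cls ` S"
        using h S by (auto simp: Q_mult Q_add SA)
      interpret Qr: ring Q using Q.ring_axioms QQ by simp
      have "\<ominus>\<^bsub>Q\<^esub> h1 = cls (- p)"
        using h by (intro Qr.minus_equality) (auto simp: Q_add SA FA_minus Q_simps(1,3))
      thus "\<ominus>\<^bsub>Q\<^esub> h1 \<in> cls ` S" using h S by auto
    qed
    show "\<forall>c\<in>carrier class_ring. \<forall>x\<in>cls ` S. c \<odot>\<^bsub>Q\<^esub> x \<in> cls ` S"
      using S by (auto simp: Q_smult SA)
    show "cls ` gen ` Z \<subseteq> cls ` S" using S by auto
  qed
  have 2: "cls ` S \<subseteq> B" if B: "B \<in> ?C" for B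
  proof
    fix y assume "y \<in> cls ` S"
    then obtain p where p: "y = cls p" "p \<in> S" by auto
    interpret B: subring B Q using B by simp
    have Bs: "c \<odot>\<^bsub>Q\<^esub> x \<in> B" if "x \<in> B" for c :: 'k and x using B that by simp
    have word: "cls (Poly_Mapping.single (Word u) 1) \<in> B" if "set u \<subseteq> Z" for u
      using that
    proof (induction u)
      case Nil
      show ?case using B.one_closed by (simp add: Q_simps flip: zero_free_word_def)
    next
      case (Cons g u)
      have "cls (gen g) \<otimes>\<^bsub>Q\<^esub> cls (Poly_Mapping.single (Word u) 1) \<in> B"
        using Cons B by (intro B.m_closed) auto
      moreover have "gen g \<in> carrier A" "Poly_Mapping.single (Word u) (1::'k) \<in> carrier A"
        using Cons.prems assms by (auto intro!: FA_gen FA_single)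
      ultimately show ?case
        by (simp add: Q_mult gen_def mult_single plus_free_word_def)
    qed
    have "cls p \<in> B \<and> p \<in> S"
    proof (rule poly_mapping_additive_induct[of "\<lambda>p. cls p \<in> B \<and> p \<in> S" p])
      have "0 \<odot>\<^bsub>Q\<^esub> cls 1 \<in> B" using Bs[OF B.one_closed] by (simp only: Q_simps(2))
      thus "cls 0 \<in> B \<and> 0 \<in> S" using S by (simp add: Q_smult FA_one)
    next
      fix p r assume "cls p \<in> B \<and> p \<in> S" "cls r \<in> B \<and> r \<in> S"
      thus "cls (p + r) \<in> B \<and> p + r \<in> S"
        using subringE(7)[OF B.subring_axioms, of "cls p" "cls r"] S by (auto simp: Q_add SA)
    next
      fix w :: "'g free_word" and c :: 'k assume "w \<in> Poly_Mapping.keys p"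
      hence w: "set (letters w) \<subseteq> Z" using p by (auto simp: S_def free_algebra_def)
      have "c \<odot>\<^bsub>Q\<^esub> cls (Poly_Mapping.single (Word (letters w)) 1) \<in> B" using w by (intro Bs word)
      moreover have "Poly_Mapping.single w (1::'k) \<in> carrier A" using w assms by (intro FA_single) auto
      ultimately show "cls (Poly_Mapping.single w c) \<in> B \<and> Poly_Mapping.single w c \<in> S"
        using w by (simp add: Q_smult scal_single S_def FA_single)
    qed
    thus "y \<in> B" using p by simp
  qed
  have "\<Inter>?C = cls ` S"
    by (rule antisym[OF Inter_lower[OF 1] Inter_greatest[OF 2]])
  thus ?thesis unfolding subalgebra_generated_def sub_def S_def by simp
qed

end

section \<open>Straightening\<close>

lemma concat_replicate_sorted:
  "sorted is \<Longrightarrow> sorted (concat (map (\<lambda>i. replicate (f i) i) is))"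
  by (induction "is") (auto simp: sorted_append sorted_replicate)

lemma count_concat_replicate:
  "distinct is \<Longrightarrow> count_list (concat (map (\<lambda>i. replicate (f i) i) is)) j = (if j \<in> set is then f j else 0)"
proof (induction "is")
  case (Cons a "is")
  have "count_list (replicate m a) j = (if j = a then m else 0)" for m
    by (induction m) auto
  thus ?case using Cons by auto
qed simp

text \<open>The correction \<open>f\<close> may contain words in any order; the strict drop of the
  weight alone drives the recursion.\<close>

locale straightening = K_algebra_ideal sc I
  for sc :: "'k::field \<Rightarrow> 'a::ring_1 \<Rightarrow> 'a" and I :: "'a set" +
  fixes n :: nat and x :: "nat \<Rightarrow> 'a" and wt :: "nat \<Rightarrow> nat"
  assumes rewrite: "i < j \<Longrightarrow> j < n \<Longrightarrow> \<exists>c f. c \<noteq> 0 \<and>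
    f \<in> span ((\<lambda>u. prod_list (map x u)) ` {u. set u \<subseteq> {..<n} \<and> sum_list (map wt u) < wt i + wt j}) \<and>
    x j * x i - (sc c (x i * x j) + f) \<in> I"
begin

definition X :: "nat list \<Rightarrow> 'a" where "X u = prod_list (map x u)"

definition wtw :: "nat list \<Rightarrow> nat" where "wtw u = sum_list (map wt u)"

definition word :: "nat list \<Rightarrow> nat list" where
  "word \<alpha> = concat (map (\<lambda>i. replicate (\<alpha> ! i) i) [0..<n])"

definition cnt :: "nat list \<Rightarrow> nat list" where
  "cnt w = map (count_list w) [0..<n]"

definition M :: "nat list \<Rightarrow> 'a" where "M \<alpha> = X (word \<alpha>)"

text \<open>A filtration by weight that admits ordered monomials only, so that membership already
  provides a normal form modulo \<open>I\<close>.\<close>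

definition Low :: "nat \<Rightarrow> 'a set" where
  "Low m = {r. \<exists>s\<in>span (M ` {\<alpha>. length \<alpha> = n \<and> wtw (word \<alpha>) < m}). r - s \<in> I}"

lemma X_append: "X (u @ v) = X u * X v"
  by (simp add: X_def)

lemma wtw_append: "wtw (u @ v) = wtw u + wtw v"
  by (simp add: wtw_def)

lemma set_word: "set (word \<alpha>) \<subseteq> {..<n}"
  by (auto simp: word_def)

lemma cnt_word: "length \<alpha> = n \<Longrightarrow> cnt (word \<alpha>) = \<alpha>"
  unfolding cnt_def word_def by (rule nth_equalityI) (simp_all add: count_concat_replicate)

lemma length_cnt: "length (cnt w) = n"
  by (simp add: cnt_def)

lemma word_cnt:
  assumes "set w \<subseteq> {..<n}" shows "word (cnt w) = sort w"
proof -
  have s: "sorted (word (cnt w))" unfolding word_def by (rule concat_replicate_sorted) simp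
  have "count_list w i = 0" if "i \<ge> n" for i
    using assms that by (intro count_notin) auto
  hence "count_list (word (cnt w)) i = count_list w i" for i
    by (auto simp: word_def count_concat_replicate cnt_def)
  hence "mset (word (cnt w)) = mset w"
    by (intro multiset_eqI) (simp add: count_mset)
  thus ?thesis using s by (metis properties_for_sort)
qed

lemma wtw_mset: "mset u = mset v \<Longrightarrow> wtw u = wtw v"
  unfolding wtw_def by (metis mset_map sum_mset_sum_list)

lemma wtw_word_cnt: "set w \<subseteq> {..<n} \<Longrightarrow> wtw (word (cnt w)) = wtw w"
  by (rule wtw_mset) (simp add: word_cnt)

lemma Low_add: "r \<in> Low m \<Longrightarrow> r' \<in> Low m \<Longrightarrow> r + r' \<in> Low m"
proof -
  assume "r \<in> Low m" "r' \<in> Low m"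
  then obtain s s' where s: "s \<in> span (M ` {\<alpha>. length \<alpha> = n \<and> wtw (word \<alpha>) < m})" "r - s \<in> I"
     "s' \<in> span (M ` {\<alpha>. length \<alpha> = n \<and> wtw (word \<alpha>) < m})" "r' - s' \<in> I" by (auto simp: Low_def)
  have "(r - s) + (r' - s') \<in> I" using s by (intro I_add)
  thus ?thesis unfolding Low_def using s by (auto intro!: bexI[OF _ span_add] simp: algebra_simps)
qed

lemma Low_sc: "r \<in> Low m \<Longrightarrow> sc c r \<in> Low m"
proof -
  assume "r \<in> Low m"
  then obtain s where s: "s \<in> span (M ` {\<alpha>. length \<alpha> = n \<and> wtw (word \<alpha>) < m})" "r - s \<in> I"
    by (auto simp: Low_def)
  have "sc c (r - s) \<in> I" using s by (intro I_sc)
  thus ?thesis unfolding Low_def using s by (auto intro!: bexI[OF _ span_scale] simp: scale_right_diff_distrib)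
qed

lemma Low_I: "r \<in> I \<Longrightarrow> r \<in> Low m"
  unfolding Low_def using span_zero by force

lemma Low_mono: "m \<le> m' \<Longrightarrow> Low m \<subseteq> Low m'"
proof -
  assume "m \<le> m'"
  hence "span (M ` {\<alpha>. length \<alpha> = n \<and> wtw (word \<alpha>) < m}) \<subseteq> span (M ` {\<alpha>. length \<alpha> = n \<and> wtw (word \<alpha>) < m'})"
    by (intro span_mono) auto
  thus ?thesis by (auto simp: Low_def)
qed

lemma Low_M: "length \<alpha> = n \<Longrightarrow> wtw (word \<alpha>) < m \<Longrightarrow> M \<alpha> \<in> Low m"
  unfolding Low_def by (auto intro!: bexI[OF _ span_base] simp: I_zero)

text \<open>Induction on the weight. A swap of two letters costs a nonzero scalar and words of
  smaller weight, which are ordered already by the induction hypothesis; within one weight,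
  insertion sort is a finite chain of swaps.\<close>

lemma straighten:
  assumes "set w \<subseteq> {..<n}"
  shows "\<exists>c. c \<noteq> 0 \<and> X w - sc c (M (cnt w)) \<in> Low (wtw w)"
  using assms
proof (induction "wtw w" arbitrary: w rule: less_induct)
  case less
  define m where "m = wtw w"
  have low: "X u \<in> Low m" if u: "set u \<subseteq> {..<n}" "wtw u < m" for u
  proof -
    obtain c where c: "X u - sc c (M (cnt u)) \<in> Low (wtw u)"
      using less.hyps[of u] u m_def by auto
    hence "X u - sc c (M (cnt u)) \<in> Low m" using Low_mono u by (meson less_imp_le subsetD)
    moreover have "M (cnt u) \<in> Low m" using u by (intro Low_M) (auto simp: length_cnt wtw_word_cnt)
    ultimately show ?thesis using Low_add[OF _ Low_sc, of "X u - sc c (M (cnt u))" m "M (cnt u)" c] by simp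
  qed
  \<comment> \<open>Equality up to a nonzero scalar and smaller weight. Transitivity lets the swaps
    of the sorting be chained.\<close>
  define sim where "sim u v \<longleftrightarrow> (\<exists>c. c \<noteq> 0 \<and> X u - sc c (X v) \<in> Low m)" for u v
  have refl: "sim u u" for u
    unfolding sim_def by (rule exI[of _ 1]) (simp add: Low_I I_zero sc_one)
  have trans: "sim u v'" if uv: "sim u v" "sim v v'" for u v v'
  proof -
    obtain c d where c: "c \<noteq> 0" "X u - sc c (X v) \<in> Low m" and d: "d \<noteq> 0" "X v - sc d (X v') \<in> Low m"
      using uv by (auto simp: sim_def)
    have "(X u - sc c (X v)) + sc c (X v - sc d (X v')) \<in> Low m" by (intro Low_add Low_sc c d)
    thus ?thesis unfolding sim_def using c d
      by (intro exI[of _ "c * d"]) (simp add: scale_right_diff_distrib sc_sc)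
  qed
  have swap: "sim (u @ j # i # v) (u @ i # j # v)"
    if uv: "set u \<subseteq> {..<n}" "set v \<subseteq> {..<n}" "i < j" "j < n" "wtw (u @ j # i # v) = m" for u v i j
  proof -
    obtain c f where c: "c \<noteq> 0" and f: "f \<in> span (X ` {u. set u \<subseteq> {..<n} \<and> wtw u < wt i + wt j})"
      and r: "x j * x i - (sc c (x i * x j) + f) \<in> I"
      using rewrite[OF uv(3,4)] unfolding X_def wtw_def by auto
    \<comment> \<open>Replacing \<open>j # i\<close> by a word of \<open>f\<close> lowers the weight
      of the whole word below \<open>m\<close>, so \<open>low\<close> applies.\<close>
    have "X u * f * X v \<in> Low m"
      using f
    proof (rule span_induct)
      show "subspace {f. X u * f * X v \<in> Low m}"
        by (rule subspaceI) (auto simp: Low_I I_zero distrib_left distrib_right mult_sc_left mult_sc_right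
            intro: Low_add Low_sc)
    next
      fix f assume "f \<in> X ` {u. set u \<subseteq> {..<n} \<and> wtw u < wt i + wt j}"
      then obtain w' where w': "f = X w'" "set w' \<subseteq> {..<n}" "wtw w' < wt i + wt j" by auto
      have "X (u @ w' @ v) \<in> Low m"
        using w' uv by (intro low) (auto simp: wtw_def)
      thus "X u * f * X v \<in> Low m" by (simp add: X_append w' mult.assoc)
    qed
    moreover have "X u * (x j * x i - (sc c (x i * x j) + f)) * X v \<in> Low m"
      by (intro Low_I I_left I_right r)
    ultimately have "X u * (x j * x i - (sc c (x i * x j) + f)) * X v + X u * f * X v \<in> Low m"
      by (intro Low_add)
    also have "X u * (x j * x i - (sc c (x i * x j) + f)) * X v + X u * f * X v =
        X (u @ j # i # v) - sc c (X (u @ i # j # v))"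
      by (simp add: X_def algebra_simps mult_sc_left mult_sc_right)
    finally show ?thesis using c by (auto simp: sim_def)
  qed
  have ins: "sim (u @ a # v) (u @ insort a v)"
    if "set u \<subseteq> {..<n}" "set v \<subseteq> {..<n}" "a < n" "wtw (u @ a # v) = m" for u v a
    using that
  proof (induction v arbitrary: u)
    case (Cons b v)
    show ?case
    proof (cases "a \<le> b")
      case False
      have "sim (u @ a # b # v) (u @ b # a # v)" using False Cons.prems by (intro swap) auto
      moreover have "sim ((u @ [b]) @ a # v) ((u @ [b]) @ insort a v)"
        using Cons.prems by (intro Cons.IH) (auto simp: wtw_def)
      ultimately show ?thesis using False trans by simp
    qed (simp add: refl)
  qed (simp add: refl)
  have srt: "sim (u @ v) (u @ sort v)"
    if "set u \<subseteq> {..<n}" "set v \<subseteq> {..<n}" "wtw (u @ v) = m" for u v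
    using that
  proof (induction v arbitrary: u)
    case (Cons b v)
    have "sim ((u @ [b]) @ v) ((u @ [b]) @ sort v)" using Cons.prems by (intro Cons.IH) auto
    moreover have "wtw (sort v) = wtw v" by (intro wtw_mset) simp
    hence "sim (u @ b # sort v) (u @ insort b (sort v))"
      using Cons.prems by (intro ins) (auto simp: wtw_def)
    ultimately show ?case using trans by simp
  qed (simp add: refl)
  show ?case using srt[of "[]" w] less.prems
    by (simp add: sim_def M_def word_cnt m_def)
qed

lemma X_Low: "set w \<subseteq> {..<n} \<Longrightarrow> wtw w < m \<Longrightarrow> X w \<in> Low m"
proof -
  assume w: "set w \<subseteq> {..<n}" "wtw w < m"
  obtain c where "X w - sc c (M (cnt w)) \<in> Low (wtw w)" using straighten[OF w(1)] by auto
  hence "X w - sc c (M (cnt w)) \<in> Low m" using Low_mono w by (meson less_imp_le subsetD)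
  moreover have "sc c (M (cnt w)) \<in> Low m" using w by (intro Low_sc Low_M) (auto simp: length_cnt wtw_word_cnt)
  ultimately show ?thesis using Low_add by force
qed

lemma cnt_append3:
  assumes "length \<alpha> = n" "length \<beta> = n" "length \<gamma> = n"
  shows "cnt (word \<alpha> @ word \<beta> @ word \<gamma>) = map2 (+) \<alpha> (map2 (+) \<beta> \<gamma>)"
  using assms by (intro nth_equalityI)
    (simp_all add: cnt_def word_def count_concat_replicate)

end

section \<open>Solvability from a straightening law\<close>

text \<open>\<open>lenlex\<close> is well-founded and total on all lists, so no length condition is
  needed for these two properties; on lists of one length it is lexicographic and hence invariant
  under adding exponents.\<close>

definition exp_less :: "(nat list \<Rightarrow> nat) \<Rightarrow> nat list \<Rightarrow> nat list \<Rightarrow> bool" where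
  "exp_less W \<alpha> \<beta> \<longleftrightarrow> W \<alpha> < W \<beta> \<or> W \<alpha> = W \<beta> \<and> (\<alpha>, \<beta>) \<in> lenlex less_than"

lemma exp_less_wf: "wf {(\<alpha>, \<beta>). exp_less W \<alpha> \<beta>}"
proof (rule wf_subset)
  show "wf (inv_image (less_than <*lex*> lenlex less_than) (\<lambda>\<alpha>. (W \<alpha>, \<alpha>)))"
    by (intro wf_inv_image wf_lex_prod wf_less_than wf_lenlex)
qed (auto simp: exp_less_def)

lemma exp_less_trans: "exp_less W \<alpha> \<beta> \<Longrightarrow> exp_less W \<beta> \<gamma> \<Longrightarrow> exp_less W \<alpha> \<gamma>"
  using lenlex_trans[OF _ _ trans_less_than] by (auto simp: exp_less_def)

lemma exp_less_irrefl: "\<not> exp_less W \<alpha> \<alpha>"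
  using lenlex_irreflexive[of less_than] by (auto simp: exp_less_def)

lemma exp_less_total: "\<alpha> = \<beta> \<or> exp_less W \<alpha> \<beta> \<or> exp_less W \<beta> \<alpha>"
proof -
  have "\<alpha> = \<beta> \<or> (\<alpha>, \<beta>) \<in> lenlex less_than \<or> (\<beta>, \<alpha>) \<in> lenlex less_than"
    using total_lenlex[OF total_less_than] unfolding total_on_def by blast
  thus ?thesis by (cases "W \<alpha>" "W \<beta>" rule: linorder_cases) (simp_all add: exp_less_def)
qed

lemma lex_add:
  assumes "length \<alpha> = length \<gamma>" "length \<beta> = length \<gamma>" "(\<alpha>, \<beta>) \<in> lex less_than"
  shows "(map2 (+) \<alpha> \<gamma>, map2 (+) \<beta> \<gamma>) \<in> lex less_than"
proof -
  have "length \<alpha> = length \<beta>" using assms by simp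
  thus ?thesis using assms(2,3)
    by (induction \<alpha> \<beta> \<gamma> rule: list_induct3) (auto simp: Cons_in_lex)
qed

lemma exp_max:
  assumes "finite T" "T \<noteq> {}"
  shows "\<exists>\<alpha>\<in>T. \<forall>\<beta>\<in>T. \<beta> = \<alpha> \<or> exp_less W \<beta> \<alpha>"
  using assms
proof (induction rule: finite_ne_induct)
  case (insert \<alpha> T)
  then obtain \<beta> where b: "\<beta> \<in> T" "\<forall>\<gamma>\<in>T. \<gamma> = \<beta> \<or> exp_less W \<gamma> \<beta>" by auto
  show ?case
  proof (cases "exp_less W \<alpha> \<beta>")
    case True
    thus ?thesis using b by auto
  next
    case False
    hence ba: "\<beta> = \<alpha> \<or> exp_less W \<beta> \<alpha>" using exp_less_total[of \<alpha> \<beta> W] by blast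
    have "\<gamma> = \<alpha> \<or> exp_less W \<gamma> \<alpha>" if "\<gamma> \<in> insert \<alpha> T" for \<gamma>
      using that b(2) ba exp_less_trans[of W \<gamma> \<beta> \<alpha>] by fastforce
    thus ?thesis by blast
  qed
qed simp

text \<open>\<open>I\<close> is an ideal of the record algebra and defines the quotient;
  \<open>I'\<close> is an ideal of the whole type, where straightening takes place. They agree on
  the carrier. The assumption \<open>indep\<close> is the part of the PBW theorem that straightening
  cannot give.\<close>

locale pbw_quotient =
  free_quotient G I + straightening "scal :: 'k \<Rightarrow> ('g free_word \<Rightarrow>\<^sub>0 'k) \<Rightarrow> ('g free_word \<Rightarrow>\<^sub>0 'k)" I' n x wt
  for G :: "'g set" and I :: "('g free_word \<Rightarrow>\<^sub>0 'k::field) set" and I' n x wt +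
  fixes Z :: "'g set"
  assumes ZX: "Z \<subseteq> G"
    and I'_iff: "p \<in> carrier (free_algebra G) \<Longrightarrow> p \<in> I' \<longleftrightarrow> p \<in> I"
    and x_closed: "i < n \<Longrightarrow> x i \<in> carrier (free_algebra Z)"
    and wt_pos: "i < n \<Longrightarrow> 0 < wt i"
    and gens: "g \<in> Z \<Longrightarrow> \<exists>i<n. gen g = x i"
    and indep: "\<lbrakk>finite T; T \<subseteq> {\<alpha>. length \<alpha> = n}; (\<Sum>\<alpha>\<in>T. scal (c \<alpha>) (M \<alpha>)) \<in> I'; \<alpha> \<in> T\<rbrakk> \<Longrightarrow> c \<alpha> = 0"
begin

abbreviation S :: "('g free_word \<Rightarrow>\<^sub>0 'k) set" where "S \<equiv> carrier (free_algebra Z)"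

abbreviation P :: "nat list set" where "P \<equiv> {\<alpha>. length \<alpha> = n}"

definition b :: "nat list \<Rightarrow> ('g free_word \<Rightarrow>\<^sub>0 'k) set" where "b \<alpha> = cls (M \<alpha>)"

definition W :: "nat list \<Rightarrow> nat" where "W \<alpha> = wtw (word \<alpha>)"

definition val :: "(nat list \<Rightarrow> 'k) \<Rightarrow> nat list set \<Rightarrow> ('g free_word \<Rightarrow>\<^sub>0 'k)" where
  "val c T = (\<Sum>\<alpha>\<in>T. scal (c \<alpha>) (M \<alpha>))"

lemma SA: "p \<in> S \<Longrightarrow> p \<in> carrier A"
  using ZX by (auto simp: free_algebra_def)

lemma X_S: "set u \<subseteq> {..<n} \<Longrightarrow> X u \<in> S"
  unfolding X_def by (intro FA_prod_list) (auto intro: x_closed)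

lemma M_S: "M \<alpha> \<in> S"
  unfolding M_def by (intro X_S set_word)

lemma val_S: "val c T \<in> S"
  unfolding val_def by (intro FA_sum FA_scal M_S)

lemma b_closed: "b \<alpha> \<in> carrier (sub S)"
  using M_S by (auto simp: b_def sub_simps)

sublocale V: assoc_algebra class_ring "sub S"
  by (rule sub_assoc_algebra[OF refl ZX])

lemma cls_eqI: "p \<in> S \<Longrightarrow> r \<in> S \<Longrightarrow> p - r \<in> I' \<Longrightarrow> cls p = cls r"
  using I'_iff[OF FA_diff] by (subst cls_eq_iff) (auto intro: SA)

lemma cls_eqD: "p \<in> S \<Longrightarrow> r \<in> S \<Longrightarrow> cls p = cls r \<Longrightarrow> p - r \<in> I'"
  using I'_iff[OF FA_diff, of p r] cls_eq_iff[of p r] by (auto intro: SA)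

text \<open>This uniqueness makes the definite description in \<open>basis_support\<close>
  meaningful. Extending both coefficient families by zero to the union reduces it to
  \<open>indep\<close>.\<close>

lemma val_unique:
  assumes T: "finite T" "T \<subseteq> P" "\<And>\<alpha>. \<alpha> \<in> T \<Longrightarrow> c \<alpha> \<noteq> 0"
    and T': "finite T'" "T' \<subseteq> P" "\<And>\<alpha>. \<alpha> \<in> T' \<Longrightarrow> c' \<alpha> \<noteq> 0"
    and eq: "cls (val c T) = cls (val c' T')"
  shows "T = T'"
proof -
  define e where "e \<alpha> = (if \<alpha> \<in> T then c \<alpha> else 0)" for \<alpha>
  define e' where "e' \<alpha> = (if \<alpha> \<in> T' then c' \<alpha> else 0)" for \<alpha>
  have v: "val c T = val e (T \<union> T')" "val c' T' = val e' (T \<union> T')"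
    unfolding val_def e_def e'_def using T(1) T'(1)
    by (intro sum.mono_neutral_cong_left; auto)+
  have "val c T - val c' T' \<in> I'" using eq by (intro cls_eqD val_S)
  hence "(\<Sum>\<alpha>\<in>T \<union> T'. scal (e \<alpha> - e' \<alpha>) (M \<alpha>)) \<in> I'"
    unfolding v by (simp add: val_def free.scale_left_diff_distrib sum_subtractf)
  hence e: "e \<alpha> - e' \<alpha> = 0" if "\<alpha> \<in> T \<union> T'" for \<alpha>
    using indep[of "T \<union> T'" "\<lambda>\<alpha>. e \<alpha> - e' \<alpha>" \<alpha>] T T' that by auto
  show "T = T'"
  proof (rule Set.set_eqI)
    fix \<alpha> show "\<alpha> \<in> T \<longleftrightarrow> \<alpha> \<in> T'"
      using e[of \<alpha>] T(3)[of \<alpha>] T'(3)[of \<alpha>]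
      by (cases "\<alpha> \<in> T"; cases "\<alpha> \<in> T'"; simp add: e_def e'_def)
  qed
qed

lemma b_inj: "inj_on b P"
proof (rule inj_onI)
  fix \<alpha> \<beta> assume "\<alpha> \<in> P" "\<beta> \<in> P" "b \<alpha> = b \<beta>"
  thus "\<alpha> = \<beta>"
    using val_unique[of "{\<alpha>}" "\<lambda>_. 1" "{\<beta>}" "\<lambda>_. 1"] by (auto simp: val_def b_def free.sc_one)
qed

lemma lincomb_val:
  assumes "finite T" "T \<subseteq> P"
  shows "V.lincomb a (b ` T) = cls (val (\<lambda>\<alpha>. a (b \<alpha>)) T)"
  using assms
proof (induction rule: finite_induct)
  case empty
  show ?case by (simp add: V.lincomb_def val_def sub_simps)
next
  case (insert \<alpha> T)
  have nin: "b \<alpha> \<notin> b ` T" using inj_on_image_mem_iff[OF b_inj, of \<alpha> T] insert by simp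
  have sm: "a v \<odot>\<^bsub>sub S\<^esub> v \<in> carrier (sub S)" if "v \<in> b ` P" for v
    using that b_closed by (auto intro!: V.smult_closed)
  have "V.lincomb a (b ` insert \<alpha> T) = a (b \<alpha>) \<odot>\<^bsub>sub S\<^esub> b \<alpha> \<oplus>\<^bsub>sub S\<^esub> V.lincomb a (b ` T)"
    unfolding V.lincomb_def image_insert using insert.hyps nin insert.prems sm
    by (intro V.finsum_insert) auto
  also have "\<dots> = cls (val (\<lambda>\<alpha>. a (b \<alpha>)) (insert \<alpha> T))"
    using insert M_S val_S
    by (simp add: b_def sub_simps Q_smult SA Q_add FA_scal) (simp add: val_def)
  finally show ?case .
qed

lemma normal_form:
  assumes "p \<in> S" "p \<in> Low m"
  shows "\<exists>T c. finite T \<and> T \<subseteq> P \<and> (\<forall>\<alpha>\<in>T. c \<alpha> \<noteq> 0 \<and> W \<alpha> < m) \<and> cls p = cls (val c T)"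
proof -
  obtain s where s: "s \<in> span (M ` {\<alpha>. length \<alpha> = n \<and> W \<alpha> < m})" "p - s \<in> I'"
    using assms(2) by (auto simp: Low_def W_def)
  have "\<exists>T c. finite T \<and> T \<subseteq> {\<alpha>. length \<alpha> = n \<and> W \<alpha> < m} \<and> s = val c T"
    using s(1)
  proof (induction rule: span_induct_alt)
    case base
    show ?case by (rule exI[of _ "{}"]) (simp add: val_def)
  next
    case (step k r y)
    then obtain \<alpha> T c where *: "r = M \<alpha>" "length \<alpha> = n" "W \<alpha> < m"
      "finite T" "T \<subseteq> {\<alpha>. length \<alpha> = n \<and> W \<alpha> < m}" "y = val c T" by auto
    define c' where "c' \<beta> = (if \<beta> \<in> T then c \<beta> else 0) + (if \<beta> = \<alpha> then k else 0)" for \<beta>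
    have 1: "val c T = (\<Sum>\<beta>\<in>insert \<alpha> T. scal (if \<beta> \<in> T then c \<beta> else 0) (M \<beta>))"
      unfolding val_def using * by (intro sum.mono_neutral_cong_left) auto
    have 2: "scal k (M \<alpha>) = (\<Sum>\<beta>\<in>insert \<alpha> T. scal (if \<beta> = \<alpha> then k else 0) (M \<beta>))"
      using * by (subst sum.mono_neutral_cong_right[where S = "{\<alpha>}" and h = "\<lambda>\<beta>. scal k (M \<beta>)"]) auto
    have "scal k r + y = scal k (M \<alpha>) + val c T" using * by simp
    also note arg_cong2[OF 2 1, of "(+)"]
    also have "(\<Sum>\<beta>\<in>insert \<alpha> T. scal (if \<beta> = \<alpha> then k else 0) (M \<beta>)) +
        (\<Sum>\<beta>\<in>insert \<alpha> T. scal (if \<beta> \<in> T then c \<beta> else 0) (M \<beta>)) = val c' (insert \<alpha> T)"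
      unfolding val_def c'_def by (simp only: free.sc_add_left sum.distrib add.commute)
    finally have "scal k r + y = val c' (insert \<alpha> T)" .
    thus ?case using * by (intro exI[of _ "insert \<alpha> T"] exI[of _ c']) auto
  qed
  then obtain T c where T: "finite T" "T \<subseteq> {\<alpha>. length \<alpha> = n \<and> W \<alpha> < m}" "s = val c T" by blast
  \<comment> \<open>Zero coefficients are discarded, because a support must carry nonzero
    ones.\<close>
  define T' where "T' = {\<alpha> \<in> T. c \<alpha> \<noteq> 0}"
  have "val c T = val c T'"
    unfolding val_def T'_def using T(1) by (intro sum.mono_neutral_right) auto
  hence "cls p = cls (val c T')" using s T by (intro cls_eqI assms(1) val_S) simp
  thus ?thesis using T by (intro exI[of _ T'] exI[of _ c]) (auto simp: T'_def)
qed

text \<open>Spanning: every letter of \<open>Z\<close> is one of the \<open>x i\<close>, so each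
  word over \<open>Z\<close> is a product \<open>X v\<close>, which straightens.\<close>

lemma S_Low:
  assumes "p \<in> S" shows "\<exists>m. p \<in> Low m"
proof -
  have mono: "r \<in> Low m \<Longrightarrow> r \<in> Low (max m m')" "r \<in> Low m' \<Longrightarrow> r \<in> Low (max m m')" for r m m'
    using Low_mono[of m "max m m'"] Low_mono[of m' "max m m'"] by auto
  have word: "\<exists>v. set v \<subseteq> {..<n} \<and> Poly_Mapping.single (Word u) 1 = X v" if "set u \<subseteq> Z" for u :: "'g list"
    using that
  proof (induction u)
    case Nil
    show ?case by (rule exI[of _ "[]"]) (simp add: X_def flip: zero_free_word_def)
  next
    case (Cons g u)
    then obtain v i where v: "set v \<subseteq> {..<n}" "Poly_Mapping.single (Word u) 1 = X v" "i < n" "gen g = x i"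
      using gens by fastforce
    have "Poly_Mapping.single (Word (g # u)) (1::'k) = gen g * Poly_Mapping.single (Word u) 1"
      by (simp add: gen_def mult_single plus_free_word_def)
    thus ?case using v by (intro exI[of _ "i # v"]) (simp add: X_def)
  qed
  show ?thesis
  proof (rule poly_mapping_additive_induct[of "\<lambda>p. \<exists>m. p \<in> Low m" p])
    show "\<exists>m. 0 \<in> Low m" using Low_I I_zero by blast
    show "\<exists>m. p + r \<in> Low m" if "\<exists>m. p \<in> Low m" "\<exists>m. r \<in> Low m" for p r
      using that mono Low_add by meson
    fix w :: "'g free_word" and c :: 'k assume "w \<in> Poly_Mapping.keys p"
    hence "set (letters w) \<subseteq> Z" using assms by (auto simp: free_algebra_def)
    then obtain v where v: "set v \<subseteq> {..<n}" "Poly_Mapping.single (Word (letters w)) 1 = X v"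
      using word by blast
    have "Poly_Mapping.single w c = scal c (X v)" using v(2) by (simp add: scal_single flip: v(2))
    moreover have "scal c (X v) \<in> Low (Suc (wtw v))" using v by (intro Low_sc X_Low) auto
    ultimately show "\<exists>m. Poly_Mapping.single w c \<in> Low m" by metis
  qed
qed

abbreviation "as \<equiv> map (\<lambda>i. cls (x i)) [0..<n]"

section \<open>The PBW basis\<close>

lemma pbw_monomial_eq:
  assumes "length \<alpha> = n" shows "pbw_monomial (sub S) as \<alpha> = b \<alpha>"
proof -
  have pw: "cls (x i) [^]\<^bsub>sub S\<^esub> e = cls (x i ^ e)" if "i < n" for i and e :: nat
  proof (induction e)
    case 0
    show ?case by (simp add: sub_simps)
  next
    case (Suc e)
    thus ?case using x_closed[OF that]
      by (simp add: sub_simps Q_mult SA FA_power power_commutes)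
  qed
  have X_rep: "X (replicate e i) = x i ^ e" for e i
    by (induction e) (simp_all add: X_def)
  have "foldr (\<otimes>\<^bsub>sub S\<^esub>) (map (\<lambda>i. cls (x i) [^]\<^bsub>sub S\<^esub> (\<alpha> ! i)) is) \<one>\<^bsub>sub S\<^esub> =
      cls (X (concat (map (\<lambda>i. replicate (\<alpha> ! i) i) is)))" if "set is \<subseteq> {..<n}" for "is"
    using that
  proof (induction "is")
    case Nil
    show ?case by (simp add: sub_simps X_def)
  next
    case (Cons i "is")
    moreover have "X (concat (map (\<lambda>i. replicate (\<alpha> ! i) i) is)) \<in> S"
      using Cons.prems by (intro X_S) auto
    ultimately show ?case using x_closed[of i]
      by (simp add: X_append X_rep pw sub_simps Q_mult SA FA_power)
  qed
  moreover have "map2 (\<lambda>a e. a [^]\<^bsub>sub S\<^esub> e) as \<alpha> = map (\<lambda>i. cls (x i) [^]\<^bsub>sub S\<^esub> (\<alpha> ! i)) [0..<n]"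
    using assms by (intro nth_equalityI) auto
  ultimately show ?thesis
    unfolding pbw_monomial_def b_def M_def word_def by (simp add: subset_iff)
qed

lemma pbw_monomials_eq: "pbw_monomials (sub S) as = b ` P"
  unfolding pbw_monomials_def by (intro image_cong) (auto simp: pbw_monomial_eq)

lemma has_pbw: "has_pbw_basis class_ring (sub S) as"
  unfolding has_pbw_basis_def
proof
  show "inj_on (pbw_monomial (sub S) as) {\<alpha>. length \<alpha> = length as}"
    using b_inj by (subst inj_on_cong[of _ _ b]) (auto simp: pbw_monomial_eq)
  show "V.basis (pbw_monomials (sub S) as)"
    unfolding V.basis_def pbw_monomials_eq
  proof (intro conjI)
    show "\<not> V.lin_dep (b ` P)"
    proof
      assume "V.lin_dep (b ` P)"
      then obtain B' a v where B': "finite B'" "B' \<subseteq> b ` P" "V.lincomb a B' = \<zero>\<^bsub>sub S\<^esub>" "v \<in> B'" "a v \<noteq> 0"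
        unfolding V.lin_dep_def by auto
      then obtain T where T: "T \<subseteq> P" "B' = b ` T" by (metis subset_imageE)
      have fin: "finite T" using B'(1) T b_inj by (metis finite_imageD inj_on_subset)
      obtain \<alpha> where \<alpha>: "\<alpha> \<in> T" "v = b \<alpha>" using B' T by auto
      have "cls (val (\<lambda>\<alpha>. a (b \<alpha>)) T) = cls 0" using B'(3) lincomb_val[OF fin T(1), of a] T by (simp add: sub_simps)
      hence "val (\<lambda>\<alpha>. a (b \<alpha>)) T - 0 \<in> I'" by (intro cls_eqD val_S FA_zero)
      hence "a (b \<alpha>) = 0" using indep[OF fin T(1), of "\<lambda>\<alpha>. a (b \<alpha>)" \<alpha>] \<alpha> by (simp add: val_def)
      thus False using B' \<alpha> by simp
    qed
    show "V.gen_set (b ` P)"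
    proof
      show "V.span (b ` P) \<subseteq> carrier (sub S)" using b_closed by (intro V.span_is_subset2) auto
      show "carrier (sub S) \<subseteq> V.span (b ` P)"
      proof
        fix f assume "f \<in> carrier (sub S)"
        then obtain p where p: "p \<in> S" "f = cls p" by (auto simp: sub_simps)
        obtain m where "p \<in> Low m" using S_Low[OF p(1)] by blast
        from normal_form[OF p(1) this] obtain T c where T: "finite T" "T \<subseteq> P" "cls p = cls (val c T)" by blast
        define a where "a v = c (inv_into P b v)" for v
        have "val (\<lambda>\<alpha>. a (b \<alpha>)) T = val c T"
          unfolding val_def a_def by (intro sum.cong refl) (simp add: inv_into_f_f[OF b_inj subsetD[OF T(2)]])
        hence "f = V.lincomb a (b ` T)" using lincomb_val[OF T(1,2)] p T by simp
        thus "f \<in> V.span (b ` P)"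
          unfolding V.span_def mem_Collect_eq using T
          by (intro exI[of _ a] exI[of _ "b ` T"] conjI) auto
      qed
    qed
    show "b ` P \<subseteq> carrier (sub S)" using b_closed by auto
  qed
qed

section \<open>The monomial ordering\<close>

definition r :: "('g free_word \<Rightarrow>\<^sub>0 'k) set rel" where
  "r = {(b \<alpha>, b \<beta>) | \<alpha> \<beta>. \<alpha> \<in> P \<and> \<beta> \<in> P \<and> (\<alpha> = \<beta> \<or> exp_less W \<alpha> \<beta>)}"

lemma r_iff: "\<alpha> \<in> P \<Longrightarrow> \<beta> \<in> P \<Longrightarrow> (b \<alpha>, b \<beta>) \<in> r \<longleftrightarrow> \<alpha> = \<beta> \<or> exp_less W \<alpha> \<beta>"
proof
  assume P: "\<alpha> \<in> P" "\<beta> \<in> P" and "(b \<alpha>, b \<beta>) \<in> r"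
  then obtain \<gamma> \<delta> where *: "b \<alpha> = b \<gamma>" "b \<beta> = b \<delta>" "\<gamma> \<in> P" "\<delta> \<in> P" "\<gamma> = \<delta> \<or> exp_less W \<gamma> \<delta>"
    unfolding r_def by blast
  have "\<alpha> = \<gamma>" "\<beta> = \<delta>" using inj_onD[OF b_inj *(1) P(1) *(3)] inj_onD[OF b_inj *(2) P(2) *(4)] .
  thus "\<alpha> = \<beta> \<or> exp_less W \<alpha> \<beta>" using *(5) by simp
next
  assume "\<alpha> \<in> P" "\<beta> \<in> P" "\<alpha> = \<beta> \<or> exp_less W \<alpha> \<beta>"
  thus "(b \<alpha>, b \<beta>) \<in> r" unfolding r_def by blast
qed

lemma r_Id_iff: "\<alpha> \<in> P \<Longrightarrow> \<beta> \<in> P \<Longrightarrow> (b \<alpha>, b \<beta>) \<in> r - Id \<longleftrightarrow> exp_less W \<alpha> \<beta>"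
proof -
  assume P: "\<alpha> \<in> P" "\<beta> \<in> P"
  have "b \<alpha> = b \<beta> \<longleftrightarrow> \<alpha> = \<beta>" using inj_onD[OF b_inj _ P] by blast
  thus ?thesis using r_iff[OF P] exp_less_irrefl[of W \<alpha>] by (simp only: Diff_iff pair_in_Id_conv) blast
qed

lemma r_well_order: "well_order_on (b ` P) r"
  unfolding well_order_on_def linear_order_on_def partial_order_on_def preorder_on_def
proof (intro conjI)
  show "r \<subseteq> b ` P \<times> b ` P" by (auto simp: r_def)
  show "refl_on (b ` P) r" by (auto simp: refl_on_def r_def)
  show "trans r"
  proof (rule transI)
    fix u v w assume "(u, v) \<in> r" "(v, w) \<in> r"
    then obtain \<alpha> \<beta> \<gamma> where "u = b \<alpha>" "v = b \<beta>" "w = b \<gamma>" "\<alpha> \<in> P" "\<beta> \<in> P" "\<gamma> \<in> P"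
      unfolding r_def by blast
    thus "(u, w) \<in> r" using \<open>(u, v) \<in> r\<close> \<open>(v, w) \<in> r\<close> exp_less_trans[of W] by (auto simp: r_iff)
  qed
  show "antisym r"
  proof (rule antisymI)
    fix u v assume "(u, v) \<in> r" "(v, u) \<in> r"
    then obtain \<alpha> \<beta> where "u = b \<alpha>" "v = b \<beta>" "\<alpha> \<in> P" "\<beta> \<in> P" unfolding r_def by blast
    thus "u = v" using \<open>(u, v) \<in> r\<close> \<open>(v, u) \<in> r\<close> exp_less_trans[of W] exp_less_irrefl[of W]
      by (auto simp: r_iff)
  qed
  show "total_on (b ` P) r"
    using exp_less_total[of _ _ W] by (auto simp: total_on_def r_iff)
  have "r - Id \<subseteq> inv_image {(\<alpha>, \<beta>). exp_less W \<alpha> \<beta>} (inv_into P b)"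
  proof
    fix z assume z: "z \<in> r - Id"
    then obtain \<alpha> \<beta> where "z = (b \<alpha>, b \<beta>)" "\<alpha> \<in> P" "\<beta> \<in> P" unfolding r_def by blast
    thus "z \<in> inv_image {(\<alpha>, \<beta>). exp_less W \<alpha> \<beta>} (inv_into P b)"
      using z r_Id_iff[of \<alpha> \<beta>] inv_into_f_f[OF b_inj, of \<alpha>] inv_into_f_f[OF b_inj, of \<beta>] by simp
  qed
  thus "wf (r - Id)" by (rule wf_subset[rotated]) (intro wf_inv_image exp_less_wf)
qed

lemma basis_support_eq:
  assumes T: "finite T" "T \<subseteq> P" "\<And>\<alpha>. \<alpha> \<in> T \<Longrightarrow> c \<alpha> \<noteq> 0" and f: "f = cls (val c T)"
  shows "basis_support class_ring (sub S) (b ` P) f = b ` T"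
  unfolding basis_support_def
proof (rule the_equality)
  define a where "a v = c (inv_into P b v)" for v
  have a: "a (b \<alpha>) = c \<alpha>" if "\<alpha> \<in> T" for \<alpha>
    unfolding a_def by (simp add: inv_into_f_f[OF b_inj subsetD[OF T(2) that]])
  have "val (\<lambda>\<alpha>. a (b \<alpha>)) T = val c T"
    unfolding val_def using a by (intro sum.cong) auto
  hence "f = V.lincomb a (b ` T)" using lincomb_val[OF T(1,2)] f by simp
  moreover have "a \<in> b ` T \<rightarrow> carrier class_ring - {\<zero>\<^bsub>class_ring\<^esub>}" using a T(3) by auto
  ultimately show "finite (b ` T) \<and> b ` T \<subseteq> b ` P \<and>
      (\<exists>c\<in>b ` T \<rightarrow> carrier class_ring - {\<zero>\<^bsub>class_ring\<^esub>}. f = V.lincomb c (b ` T))"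
    using T by blast
next
  fix B' assume "finite B' \<and> B' \<subseteq> b ` P \<and>
    (\<exists>c\<in>B' \<rightarrow> carrier class_ring - {\<zero>\<^bsub>class_ring\<^esub>}. f = V.lincomb c B')"
  then obtain a where "finite B'" "B' \<subseteq> b ` P" "a \<in> B' \<rightarrow> carrier class_ring - {\<zero>\<^bsub>class_ring\<^esub>}"
    "f = V.lincomb a B'" by blast
  hence a: "finite B'" "B' \<subseteq> b ` P" "\<forall>v\<in>B'. a v \<noteq> 0" "f = V.lincomb a B'" by auto
  then obtain T' where T': "T' \<subseteq> P" "B' = b ` T'" by (metis subset_imageE)
  have fin: "finite T'" using a(1) T' b_inj by (metis finite_imageD inj_on_subset)
  have "T' = T"
    using a T' T f by (intro val_unique[OF fin T'(1) _ T, of "\<lambda>\<alpha>. a (b \<alpha>)"])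
      (auto simp flip: lincomb_val[OF fin T'(1)])
  thus "B' = b ` T" using T' by simp
qed

abbreviation "LMr \<equiv> LM class_ring (sub S) (b ` P) r"

lemma LM_eq:
  assumes T: "finite T" "T \<subseteq> P" "\<And>\<alpha>. \<alpha> \<in> T \<Longrightarrow> c \<alpha> \<noteq> 0" and f: "f = cls (val c T)"
    and \<alpha>: "\<alpha> \<in> T" "\<And>\<beta>. \<beta> \<in> T \<Longrightarrow> \<beta> = \<alpha> \<or> exp_less W \<beta> \<alpha>"
  shows "LMr f = b \<alpha>" "f \<noteq> \<zero>\<^bsub>sub S\<^esub>"
proof -
  show nz: "f \<noteq> \<zero>\<^bsub>sub S\<^esub>"
  proof
    assume "f = \<zero>\<^bsub>sub S\<^esub>"
    hence "cls (val c T) = cls (val c {})" using f by (simp add: sub_simps val_def)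
    hence "T = {}" using T by (intro val_unique[of T c "{}" c]) auto
    thus False using \<alpha> by simp
  qed
  have supp: "basis_support class_ring (sub S) (b ` P) f = b ` T"
    using T f by (rule basis_support_eq)
  have "(THE v. v \<in> b ` T \<and> (\<forall>b'\<in>b ` T. (b', v) \<in> r)) = b \<alpha>"
  proof (rule the_equality)
    have "(b \<beta>, b \<alpha>) \<in> r" if "\<beta> \<in> T" for \<beta>
      using that \<alpha>(2)[OF that] \<alpha>(1) T(2) by (subst r_iff) auto
    thus *: "b \<alpha> \<in> b ` T \<and> (\<forall>b'\<in>b ` T. (b', b \<alpha>) \<in> r)" using \<alpha> by auto
    fix v assume v: "v \<in> b ` T \<and> (\<forall>b'\<in>b ` T. (b', v) \<in> r)"
    have "antisym r" using r_well_order
      by (simp add: well_order_on_def linear_order_on_def partial_order_on_def)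
    moreover have "(v, b \<alpha>) \<in> r" using * v by blast
    moreover have "(b \<alpha>, v) \<in> r" using * v by blast
    ultimately show "v = b \<alpha>" by (rule antisymD)
  qed
  thus "LMr f = b \<alpha>" using nz supp by (simp add: LM_def)
qed

text \<open>The normal form of the remainder involves only exponents of weight below
  \<open>W \<alpha>\<close>; it cannot touch the coefficient \<open>c\<close> of
  \<open>M \<alpha>\<close>, and \<open>\<alpha>\<close> dominates it already by weight.\<close>

lemma LM_leading:
  assumes \<alpha>: "\<alpha> \<in> P" and p: "p \<in> S" "p - scal c (M \<alpha>) \<in> Low (W \<alpha>)" and c: "c \<noteq> 0"
  shows "LMr (cls p) = b \<alpha>" "cls p \<noteq> \<zero>\<^bsub>sub S\<^esub>"
proof -
  have "p - scal c (M \<alpha>) \<in> S" using p M_S by (intro FA_diff FA_scal)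
  from normal_form[OF this p(2)] obtain T d where T: "finite T" "T \<subseteq> P" "\<forall>\<beta>\<in>T. d \<beta> \<noteq> 0 \<and> W \<beta> < W \<alpha>"
    "cls (p - scal c (M \<alpha>)) = cls (val d T)" by blast
  have nin: "\<alpha> \<notin> T" using T(3) by auto
  define e where "e = d(\<alpha> := c)"
  have "val e (insert \<alpha> T) = scal c (M \<alpha>) + val d T"
    unfolding val_def using nin T(1) by (auto simp: e_def intro!: sum.cong)
  moreover have "p - scal c (M \<alpha>) - val d T \<in> I'"
    using T(4) p M_S val_S by (intro cls_eqD FA_diff FA_scal)
  ultimately have "p - val e (insert \<alpha> T) \<in> I'" by (simp add: algebra_simps)
  hence "cls p = cls (val e (insert \<alpha> T))" using p val_S by (intro cls_eqI)
  moreover have "e \<beta> \<noteq> 0" if "\<beta> \<in> insert \<alpha> T" for \<beta> using that T(3) c by (auto simp: e_def)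
  moreover have "\<beta> = \<alpha> \<or> exp_less W \<beta> \<alpha>" if "\<beta> \<in> insert \<alpha> T" for \<beta>
    using that T(3) by (auto simp: exp_less_def)
  moreover have "finite (insert \<alpha> T)" "insert \<alpha> T \<subseteq> P" using T \<alpha> by auto
  ultimately show "LMr (cls p) = b \<alpha>" "cls p \<noteq> \<zero>\<^bsub>sub S\<^esub>"
    using LM_eq[of "insert \<alpha> T" e "cls p" \<alpha>] by blast+
qed

abbreviation plus :: "nat list \<Rightarrow> nat list \<Rightarrow> nat list" (infixl "\<oplus>\<^sub>e" 65) where
  "\<alpha> \<oplus>\<^sub>e \<beta> \<equiv> map2 (+) \<alpha> \<beta>"

lemma W_add3:
  assumes "\<alpha> \<in> P" "\<beta> \<in> P" "\<gamma> \<in> P"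
  shows "W (\<alpha> \<oplus>\<^sub>e (\<beta> \<oplus>\<^sub>e \<gamma>)) = W \<alpha> + W \<beta> + W \<gamma>"
proof -
  have "set (word \<alpha> @ word \<beta> @ word \<gamma>) \<subseteq> {..<n}" using set_word by auto
  from wtw_word_cnt[OF this] show ?thesis
    using cnt_append3[of \<alpha> \<beta> \<gamma>] assms by (simp add: W_def wtw_append)
qed

text \<open>The straightened product keeps a nonzero leading coefficient, so the axioms of a
  monomial ordering become statements about adding exponents.\<close>

lemma LM_mult3:
  assumes "\<alpha> \<in> P" "\<beta> \<in> P" "\<gamma> \<in> P"
  shows "LMr (b \<alpha> \<otimes>\<^bsub>sub S\<^esub> b \<beta> \<otimes>\<^bsub>sub S\<^esub> b \<gamma>) = b (\<alpha> \<oplus>\<^sub>e (\<beta> \<oplus>\<^sub>e \<gamma>))"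
proof -
  let ?u = "word \<alpha> @ word \<beta> @ word \<gamma>"
  have u: "set ?u \<subseteq> {..<n}" using set_word by auto
  have cnt: "cnt ?u = \<alpha> \<oplus>\<^sub>e (\<beta> \<oplus>\<^sub>e \<gamma>)" using cnt_append3 assms by simp
  obtain c where c: "c \<noteq> 0" "X ?u - scal c (M (cnt ?u)) \<in> Low (wtw ?u)" using straighten[OF u] by blast
  have "b \<alpha> \<otimes>\<^bsub>sub S\<^esub> b \<beta> \<otimes>\<^bsub>sub S\<^esub> b \<gamma> = cls (X ?u)"
    using M_S by (simp add: b_def sub_simps Q_mult SA FA_mult X_append mult.assoc flip: M_def)
  moreover have "LMr (cls (X ?u)) = b (cnt ?u)"
    using c X_S[OF u] wtw_word_cnt[OF u] by (intro LM_leading(1)[of _ _ c]) (simp_all add: W_def length_cnt)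
  ultimately show ?thesis using cnt by simp
qed

lemma W_eq_0: "\<alpha> \<in> P \<Longrightarrow> W \<alpha> = 0 \<Longrightarrow> \<alpha> = replicate n 0"
proof -
  assume \<alpha>: "\<alpha> \<in> P" "W \<alpha> = 0"
  have "word \<alpha> = []"
  proof (rule ccontr)
    assume "word \<alpha> \<noteq> []"
    then obtain i where i: "i \<in> set (word \<alpha>)" by (cases "word \<alpha>") auto
    hence "wt i = 0" using \<alpha>(2) by (auto simp: W_def wtw_def)
    moreover have "i < n" using i set_word by auto
    ultimately show False using wt_pos by fastforce
  qed
  moreover have "cnt [] = replicate n 0" unfolding cnt_def by (rule nth_equalityI) simp_all
  ultimately have "cnt (word \<alpha>) = replicate n 0" by simp
  thus ?thesis using cnt_word \<alpha> by simp
qed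

lemma exp_less_add:
  assumes "\<alpha> \<in> P" "\<beta> \<in> P" "\<gamma> \<in> P" "\<eta> \<in> P" "exp_less W \<alpha> \<beta>"
  shows "exp_less W (\<gamma> \<oplus>\<^sub>e (\<alpha> \<oplus>\<^sub>e \<eta>)) (\<gamma> \<oplus>\<^sub>e (\<beta> \<oplus>\<^sub>e \<eta>))"
proof -
  have comm: "\<gamma> \<oplus>\<^sub>e (\<delta> \<oplus>\<^sub>e \<eta>) = \<delta> \<oplus>\<^sub>e (\<gamma> \<oplus>\<^sub>e \<eta>)" if "\<delta> \<in> P" for \<delta>
    using that assms by (intro nth_equalityI) auto
  have "(\<alpha>, \<beta>) \<in> lenlex less_than \<Longrightarrow>
      (\<alpha> \<oplus>\<^sub>e (\<gamma> \<oplus>\<^sub>e \<eta>), \<beta> \<oplus>\<^sub>e (\<gamma> \<oplus>\<^sub>e \<eta>)) \<in> lenlex less_than"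
    using lex_add[of \<alpha> "\<gamma> \<oplus>\<^sub>e \<eta>" \<beta>] assms by (auto simp: lenlex_def)
  thus ?thesis using assms(5) W_add3 assms(1-4) comm by (auto simp: exp_less_def)
qed

lemma r_monomial_ordering: "monomial_ordering class_ring (sub S) (b ` P) r"
  unfolding monomial_ordering_def
proof (intro conjI ballI impI)
  show "well_order_on (b ` P) r" by (rule r_well_order)
next
  fix g a v h assume in_B: "g \<in> b ` P" "a \<in> b ` P" "v \<in> b ` P" "h \<in> b ` P"
    and *: "g \<noteq> \<one>\<^bsub>sub S\<^esub> \<and> v \<noteq> g \<and> g = LMr (a \<otimes>\<^bsub>sub S\<^esub> v \<otimes>\<^bsub>sub S\<^esub> h)"
  obtain \<alpha> \<beta> \<gamma> where P: "\<alpha> \<in> P" "\<beta> \<in> P" "\<gamma> \<in> P" "a = b \<alpha>" "v = b \<beta>" "h = b \<gamma>" using in_B by blast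
  have g: "g = b (\<alpha> \<oplus>\<^sub>e (\<beta> \<oplus>\<^sub>e \<gamma>))" using * P LM_mult3 by simp
  have inP: "\<alpha> \<oplus>\<^sub>e (\<beta> \<oplus>\<^sub>e \<gamma>) \<in> P" using P by simp
  have "exp_less W \<beta> (\<alpha> \<oplus>\<^sub>e (\<beta> \<oplus>\<^sub>e \<gamma>))"
  \<comment> \<open>If both outer factors have weight 0 they are trivial and \<open>v = g\<close>,
    which is excluded; otherwise the weight of \<open>g\<close> strictly exceeds that of
    \<open>v\<close>.\<close>
  proof (cases "W \<alpha> + W \<gamma> = 0")
    case True
    hence "\<alpha> = replicate n 0" "\<gamma> = replicate n 0" using W_eq_0[OF P(1)] W_eq_0[OF P(3)] by simp_all
    hence "\<alpha> \<oplus>\<^sub>e (\<beta> \<oplus>\<^sub>e \<gamma>) = \<beta>" using P by (intro nth_equalityI) auto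
    thus ?thesis using * g P by simp
  next
    case False
    thus ?thesis using W_add3[OF P(1-3)] by (simp add: exp_less_def)
  qed
  thus "(v, g) \<in> r - Id" unfolding g P(5) using r_Id_iff[OF P(2) inP] by simp
next
  fix g a v h assume in_B: "g \<in> b ` P" "a \<in> b ` P" "v \<in> b ` P" "h \<in> b ` P"
    and *: "(a, v) \<in> r - Id \<and> LMr (g \<otimes>\<^bsub>sub S\<^esub> a \<otimes>\<^bsub>sub S\<^esub> h) \<noteq> \<zero>\<^bsub>sub S\<^esub> \<and>
        LMr (g \<otimes>\<^bsub>sub S\<^esub> v \<otimes>\<^bsub>sub S\<^esub> h) \<notin> {\<zero>\<^bsub>sub S\<^esub>, \<one>\<^bsub>sub S\<^esub>}"
  obtain \<alpha> \<beta> \<gamma> \<eta> where P: "\<alpha> \<in> P" "\<beta> \<in> P" "\<gamma> \<in> P" "\<eta> \<in> P" "a = b \<alpha>" "v = b \<beta>" "g = b \<gamma>" "h = b \<eta>"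
    using in_B by blast
  have "exp_less W \<alpha> \<beta>" using * P r_Id_iff by auto
  hence "exp_less W (\<gamma> \<oplus>\<^sub>e (\<alpha> \<oplus>\<^sub>e \<eta>)) (\<gamma> \<oplus>\<^sub>e (\<beta> \<oplus>\<^sub>e \<eta>))" by (intro exp_less_add P)
  thus "(LMr (g \<otimes>\<^bsub>sub S\<^esub> a \<otimes>\<^bsub>sub S\<^esub> h), LMr (g \<otimes>\<^bsub>sub S\<^esub> v \<otimes>\<^bsub>sub S\<^esub> h)) \<in> r - Id"
    unfolding P LM_mult3[OF P(3,1,4)] LM_mult3[OF P(3,2,4)] using P by (subst r_Id_iff) auto
qed

lemma commutation:
  assumes ij: "i < j" "j < n"
  shows "\<exists>c\<in>carrier class_ring - {\<zero>\<^bsub>class_ring\<^esub>}. \<exists>f\<in>carrier (sub S).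
    as ! j \<otimes>\<^bsub>sub S\<^esub> as ! i = c \<odot>\<^bsub>sub S\<^esub> (as ! i \<otimes>\<^bsub>sub S\<^esub> as ! j) \<oplus>\<^bsub>sub S\<^esub> f \<and>
    (f \<noteq> \<zero>\<^bsub>sub S\<^esub> \<longrightarrow> (LMr f, as ! i \<otimes>\<^bsub>sub S\<^esub> as ! j) \<in> r - Id)"
proof -
  let ?m = "wt i + wt j" and ?\<alpha> = "cnt [i, j]"
  obtain c f where c: "c \<noteq> 0" and f: "f \<in> span (X ` {u. set u \<subseteq> {..<n} \<and> wtw u < ?m})"
    and eq: "x j * x i - (scal c (x i * x j) + f) \<in> I'"
    using rewrite[OF ij] unfolding X_def wtw_def by auto
  have "subspace S" by (rule subspaceI) (auto intro: FA_zero FA_add FA_scal)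
  hence "span (X ` {u. set u \<subseteq> {..<n} \<and> wtw u < ?m}) \<subseteq> S"
    by (intro span_minimal) (auto intro: X_S)
  hence fS: "f \<in> S" using f by blast
  \<comment> \<open>\<open>f\<close> is given by words in any order; its leading monomial is visible
    only after straightening, which keeps all weights below \<open>?m\<close>.\<close>
  have "subspace (Low ?m)" by (rule subspaceI) (auto intro: Low_I I_zero Low_add Low_sc)
  hence "span (X ` {u. set u \<subseteq> {..<n} \<and> wtw u < ?m}) \<subseteq> Low ?m"
    by (intro span_minimal) (auto intro: X_Low)
  hence "f \<in> Low ?m" using f by blast
  from normal_form[OF fS this] obtain T d where T: "finite T" "T \<subseteq> P"
    "\<forall>\<alpha>\<in>T. d \<alpha> \<noteq> 0 \<and> W \<alpha> < ?m" "cls f = cls (val d T)" by blast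
  have xS: "x i \<in> S" "x j \<in> S" using ij by (auto intro: x_closed)
  have "sort [i, j] = [i, j]" using ij by simp
  hence \<alpha>: "x i * x j = M ?\<alpha>" "W ?\<alpha> = ?m"
    using ij by (simp_all add: M_def W_def word_cnt X_def wtw_def)
  have asij: "as ! i = cls (x i)" "as ! j = cls (x j)" using ij by simp_all
  have "as ! j \<otimes>\<^bsub>sub S\<^esub> as ! i = c \<odot>\<^bsub>sub S\<^esub> (as ! i \<otimes>\<^bsub>sub S\<^esub> as ! j) \<oplus>\<^bsub>sub S\<^esub> cls f"
    unfolding asij using xS fS
    by (simp add: sub_simps Q_mult Q_smult Q_add SA FA_mult FA_scal)
      (intro cls_eqI eq FA_mult FA_add FA_scal)
  moreover have "(LMr (cls f), as ! i \<otimes>\<^bsub>sub S\<^esub> as ! j) \<in> r - Id" if "cls f \<noteq> \<zero>\<^bsub>sub S\<^esub>"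
  proof -
    have "T \<noteq> {}"
    proof
      assume "T = {}"
      hence "cls f = cls 0" using T(4) by (simp add: val_def)
      thus False using that by (simp add: sub_simps(3))
    qed
    then obtain \<beta> where \<beta>: "\<beta> \<in> T" "\<forall>\<gamma>\<in>T. \<gamma> = \<beta> \<or> exp_less W \<gamma> \<beta>" using exp_max[OF T(1)] by blast
    have "LMr (cls f) = b \<beta>"
      by (rule LM_eq(1)[OF T(1,2) _ T(4) \<beta>(1)]) (use T(3) \<beta>(2) in blast)+
    moreover have "as ! i \<otimes>\<^bsub>sub S\<^esub> as ! j = b ?\<alpha>"
      unfolding asij b_def using xS by (simp add: sub_simps Q_mult SA \<alpha>)
    moreover have "exp_less W \<beta> ?\<alpha>" using T(3) \<beta> \<alpha>(2) by (simp add: exp_less_def)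
    moreover have "\<beta> \<in> P" "?\<alpha> \<in> P" using \<beta> T(2) by (auto simp: length_cnt)
    ultimately show ?thesis by (simp only: r_Id_iff)
  qed
  moreover have "cls f \<in> carrier (sub S)" using fS by (simp add: sub_simps)
  moreover have "c \<in> carrier class_ring - {\<zero>\<^bsub>class_ring\<^esub>}" using c by simp
  ultimately show ?thesis by meson
qed

theorem solvable: "solvable_polynomial_algebra class_ring (sub S) as"
  unfolding solvable_polynomial_algebra_def
proof (intro conjI exI[of _ r] allI impI)
  show "assoc_algebra class_ring (sub S)" by (rule V.assoc_algebra_axioms)
  show "set as \<subseteq> carrier (sub S)" by (auto simp: sub_simps intro!: imageI x_closed)
  show "has_pbw_basis class_ring (sub S) as" by (rule has_pbw)
  show "monomial_ordering class_ring (sub S) (pbw_monomials (sub S) as) r"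
    unfolding pbw_monomials_eq by (rule r_monomial_ordering)
next
  fix i j assume ij: "i < j \<and> j < length as"
  hence "i < j" "j < n" by simp_all
  from commutation[OF this]
  show "\<exists>c\<in>carrier class_ring - {\<zero>\<^bsub>class_ring\<^esub>}. \<exists>f\<in>carrier (sub S).
    as ! j \<otimes>\<^bsub>sub S\<^esub> as ! i = c \<odot>\<^bsub>sub S\<^esub> (as ! i \<otimes>\<^bsub>sub S\<^esub> as ! j) \<oplus>\<^bsub>sub S\<^esub> f \<and>
    (f \<noteq> \<zero>\<^bsub>sub S\<^esub> \<longrightarrow>
      (LM class_ring (sub S) (pbw_monomials (sub S) as) r f, as ! i \<otimes>\<^bsub>sub S\<^esub> as ! j) \<in> r - Id)"
    unfolding pbw_monomials_eq .
qed

end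

section \<open>The oscillator representation\<close>

text \<open>As a type, the operators form an instance of \<open>ring_1\<close>, so everything proved
  for \<open>K_algebra\<close> applies to them. They act on functions with arbitrary support, which
  spares finiteness conditions.\<close>

typedef (overloaded) ('i, 'k::field) lin_op =
  "{f :: ('i \<Rightarrow> 'k) \<Rightarrow> 'i \<Rightarrow> 'k. \<forall>c \<phi> \<psi>. f (\<lambda>a. c * \<phi> a + \<psi> a) = (\<lambda>a. c * f \<phi> a + f \<psi> a)}"
  by (rule exI[of _ "\<lambda>\<phi>. \<phi>"]) simp

setup_lifting type_definition_lin_op

instantiation lin_op :: (type, field) ring_1
begin

lift_definition zero_lin_op :: "('a, 'b) lin_op" is "\<lambda>\<phi> a. 0" by simp
lift_definition one_lin_op :: "('a, 'b) lin_op" is "\<lambda>\<phi>. \<phi>" by simp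
lift_definition plus_lin_op :: "('a, 'b) lin_op \<Rightarrow> ('a, 'b) lin_op \<Rightarrow> ('a, 'b) lin_op"
  is "\<lambda>f g \<phi> a. f \<phi> a + g \<phi> a" by (simp add: algebra_simps)
lift_definition minus_lin_op :: "('a, 'b) lin_op \<Rightarrow> ('a, 'b) lin_op \<Rightarrow> ('a, 'b) lin_op"
  is "\<lambda>f g \<phi> a. f \<phi> a - g \<phi> a" by (simp add: algebra_simps)
lift_definition uminus_lin_op :: "('a, 'b) lin_op \<Rightarrow> ('a, 'b) lin_op"
  is "\<lambda>f \<phi> a. - f \<phi> a" by (simp add: algebra_simps)
lift_definition times_lin_op :: "('a, 'b) lin_op \<Rightarrow> ('a, 'b) lin_op \<Rightarrow> ('a, 'b) lin_op"
  is "\<lambda>f g \<phi>. f (g \<phi>)" by simp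

instance
proof
  show "0 \<noteq> (1 :: ('a, 'b) lin_op)"
    by transfer (auto simp: fun_eq_iff intro!: exI[of _ "\<lambda>_. 1"])
  fix x y z :: "('a, 'b) lin_op"
  show "x * (y + z) = x * y + x * z"
  proof transfer
    fix x y z :: "('a \<Rightarrow> 'b) \<Rightarrow> 'a \<Rightarrow> 'b"
    assume "\<forall>c \<phi> \<psi>. x (\<lambda>a. c * \<phi> a + \<psi> a) = (\<lambda>a. c * x \<phi> a + x \<psi> a)"
    from spec[OF this, of 1] show "(\<lambda>\<phi>. x (\<lambda>a. y \<phi> a + z \<phi> a)) = (\<lambda>\<phi> a. x (y \<phi>) a + x (z \<phi>) a)"
      by simp
  qed
qed (transfer; simp add: algebra_simps)+

end

lift_definition op_sc :: "'k::field \<Rightarrow> ('i, 'k) lin_op \<Rightarrow> ('i, 'k) lin_op"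
  is "\<lambda>c f \<phi> a. c * f \<phi> a" by (simp add: algebra_simps)

interpretation op: K_algebra op_sc
proof
  fix c :: "'k::field" and x y :: "('i, 'k) lin_op"
  show "x * op_sc c y = op_sc c (x * y)"
  proof transfer
    fix c :: 'k and x y :: "('i \<Rightarrow> 'k) \<Rightarrow> 'i \<Rightarrow> 'k"
    assume x: "\<forall>c \<phi> \<psi>. x (\<lambda>a. c * \<phi> a + \<psi> a) = (\<lambda>a. c * x \<phi> a + x \<psi> a)"
    have "x (\<lambda>a. 0) = (\<lambda>a. 0)"
      using x[rule_format, of "-1" "\<lambda>a. 0" "\<lambda>a. 0"] by (simp add: fun_eq_iff)
    then show "(\<lambda>\<phi>. x (\<lambda>a. c * y \<phi> a)) = (\<lambda>\<phi> a. c * x (y \<phi>) a)"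
      using x[rule_format, of c _ "\<lambda>a. 0"] by simp
  qed
qed (transfer; simp add: algebra_simps)+

text \<open>Sends the basis vector at \<open>b\<close> to \<open>c b\<close> times the basis vector
  at \<open>b + s\<close>; for coefficient functions this turns into the substitution of
  \<open>a - s\<close>.\<close>

lift_definition weighted_shift :: "('i::ab_group_add \<Rightarrow> 'k::field) \<Rightarrow> 'i \<Rightarrow> ('i, 'k) lin_op"
  is "\<lambda>c s \<phi> a. c (a - s) * \<phi> (a - s)" by (simp add: algebra_simps)

lemma weighted_shift_mult: "weighted_shift c s * weighted_shift d s' = weighted_shift (\<lambda>a. d a * c (a + s')) (s + s')"
  by transfer (simp add: fun_eq_iff algebra_simps diff_diff_eq)

lemma weighted_shift_add: "weighted_shift c s + weighted_shift d s = weighted_shift (\<lambda>a. c a + d a) s"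
  by transfer (simp add: fun_eq_iff algebra_simps)

lemma weighted_shift_diff: "weighted_shift c s - weighted_shift d s = weighted_shift (\<lambda>a. c a - d a) s"
  by transfer (simp add: fun_eq_iff algebra_simps)

lemma weighted_shift_sc: "op_sc c (weighted_shift d s) = weighted_shift (\<lambda>a. c * d a) s"
  by transfer (simp add: fun_eq_iff algebra_simps)

lemma weighted_shift_zero: "weighted_shift (\<lambda>a. 0) s = 0"
  by transfer simp

lemma weighted_shift_one: "weighted_shift (\<lambda>a. 1) 0 = 1"
  by transfer simp

lemma qserre_weighted_shift:
  "op.qserre Q (weighted_shift c s) (weighted_shift d t) = weighted_shift (\<lambda>a. d a * (c (a + t) * c (a + t + s)) -
     (Q + inverse Q) * (c a * (d (a + s) * c (a + s + t))) + c a * c (a + s) * d (a + s + s)) (s + s + t)"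
proof -
  have e: "s + t + s = s + s + t" "t + s + s = s + s + t" by (simp_all add: algebra_simps)
  show ?thesis
    by (simp only: op.qserre_def weighted_shift_mult weighted_shift_sc weighted_shift_diff weighted_shift_add e) (simp add: algebra_simps)
qed

definition basis_fun :: "'i \<Rightarrow> 'i \<Rightarrow> 'k::field" where
  "basis_fun b a = (if a = b then 1 else 0)"

lift_definition lin_app :: "('i, 'k::field) lin_op \<Rightarrow> ('i \<Rightarrow> 'k) \<Rightarrow> 'i \<Rightarrow> 'k" is "\<lambda>f. f" .

lemma lin_app_weighted_shift: "lin_app (weighted_shift c s) (basis_fun b) = (\<lambda>a. c b * basis_fun (b + s) a)"
  by transfer (auto simp: fun_eq_iff basis_fun_def)

text \<open>The quantum integer [m] for the square of \<open>q\<close>.\<close>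

definition qint :: "'k::field \<Rightarrow> int \<Rightarrow> 'k" where
  "qint q m = (q powi (2 * m) - q powi (- (2 * m))) / (q\<^sup>2 - q powi (-2))"

text \<open>Row \<open>r\<close> is the \<open>q\<close>-oscillator representation on Laurent monomials, \<open>F\<^sub>l = x\<^bsub>l+1\<^esub> D\<^sub>l\<close> and
  \<open>E\<^sub>l = x\<^sub>l D\<^bsub>l+1\<^esub>\<close>. Only the product of \<open>D\<close> and \<open>x\<close> is prescribed; for the variable \<open>x\<^sub>r\<close> the
  \<open>q\<close>-integer is moved from \<open>D\<close> to \<open>x\<close>, so that \<open>F\<^sub>r\<close> has coefficients that do not vanish
  even if \<open>q\<close> is a root of unity.\<close>

definition lowering :: "'k::field \<Rightarrow> nat \<Rightarrow> nat \<Rightarrow> int \<Rightarrow> 'k" where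
  "lowering q r i m = (if i = r then 1 else qint q m)"

definition raising :: "'k::field \<Rightarrow> nat \<Rightarrow> nat \<Rightarrow> int \<Rightarrow> 'k" where
  "raising q r i m = (if i = r then qint q (m + 1) else 1)"

lemma lowering_raising: "lowering q r i m * raising q r i (m - 1) = qint q m"
  by (simp add: lowering_def raising_def)

text \<open>Exponents of the variables, indexed by row and variable. They are integers since
  \<open>F r\<close> in row \<open>r\<close> makes the exponent of its variable \<open>r\<close>
  negative when applied to the vacuum.\<close>

type_synonym idx = "(nat \<times> nat) \<Rightarrow>\<^sub>0 int"

definition unit_entry :: "nat \<Rightarrow> nat \<Rightarrow> idx" where
  "unit_entry r i = Poly_Mapping.single (r, i) 1"

abbreviation entry :: "idx \<Rightarrow> nat \<Rightarrow> nat \<Rightarrow> int" where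
  "entry a r i \<equiv> Poly_Mapping.lookup a (r, i)"

lemma lookup_unit_entry: "entry (unit_entry r i) r' i' = (if r = r' \<and> i = i' then 1 else 0)"
  by (simp add: unit_entry_def lookup_single when_def)

definition rowF :: "'k::field \<Rightarrow> nat \<Rightarrow> nat \<Rightarrow> (idx, 'k) lin_op" where
  "rowF q r l = weighted_shift (\<lambda>a. lowering q r l (entry a r l) * raising q r (l + 1) (entry a r (l + 1)))
     (unit_entry r (l + 1) - unit_entry r l)"

definition rowE :: "'k::field \<Rightarrow> nat \<Rightarrow> nat \<Rightarrow> (idx, 'k) lin_op" where
  "rowE q r l = weighted_shift (\<lambda>a. lowering q r (l + 1) (entry a r (l + 1)) * raising q r l (entry a r l))
     (unit_entry r l - unit_entry r (l + 1))"

definition rowK :: "'k::field \<Rightarrow> nat \<Rightarrow> nat \<Rightarrow> (idx, 'k) lin_op" where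
  "rowK q r l = weighted_shift (\<lambda>a. q powi (entry a r l - entry a r (l + 1))) 0"

definition rowK' :: "'k::field \<Rightarrow> nat \<Rightarrow> nat \<Rightarrow> (idx, 'k) lin_op" where
  "rowK' q r l = weighted_shift (\<lambda>a. q powi (entry a r (l + 1) - entry a r l)) 0"

lemmas row_defs = rowF_def rowE_def rowK_def rowK'_def

section \<open>The relations in a single row\<close>

context
  fixes q :: "'k::field"
  assumes q: "q \<noteq> 0" and q4: "q ^ 4 \<noteq> 1"
begin

lemma q2_diff: "q\<^sup>2 - q powi (-2) \<noteq> 0"
proof
  assume "q\<^sup>2 - q powi (-2) = 0"
  hence "q\<^sup>2 * q\<^sup>2 = 1" using q by (simp add: power_int_minus field_simps)
  thus False using q4 by (simp flip: power_add)
qed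

text \<open>The three-term recurrence of quantum integers; in a single row it is the whole content
  of the Serre relations.\<close>

lemma qint_rec: "qint q m - (q\<^sup>2 + inverse (q\<^sup>2)) * qint q (m + 1) + qint q (m + 2) = 0"
proof -
  have e: "q powi (2 * (m + 1)) = q powi (2 * m) * q\<^sup>2" "q powi (2 * (m + 2)) = q powi (2 * m) * q\<^sup>2 * q\<^sup>2"
    using q by (simp_all add: power_int_add distrib_left power_numeral_reduce power2_eq_square)
  show ?thesis using q q2_diff unfolding qint_def e power_int_minus
    by (simp add: divide_simps, simp add: algebra_simps power2_eq_square power4_eq_xxxx)
qed

text \<open>Both sides equal [a - b]; the right one is written as in the relation between
  \<open>E\<close> and \<open>F\<close>, with \<open>a\<close> and \<open>b\<close> the exponents of
  two neighbouring variables.\<close>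

lemma qint_cross:
  "qint q a * qint q (b + 1) - qint q b * qint q (a + 1) =
   1 / (q\<^sup>2 - q powi (-2)) * (q powi (a - b) * q powi (a - b) - q powi (b - a) * q powi (b - a))"
proof -
  define d where "d = q\<^sup>2 - q powi (-2)"
  define x where "x = q powi a"
  define y where "y = q powi b"
  have nz: "d \<noteq> 0" "x \<noteq> 0" "y \<noteq> 0" using q q2_diff by (simp_all add: d_def x_def y_def)
  have e: "q powi (2 * a) = x * x" "q powi (2 * b) = y * y" "q powi (2 * (a + 1)) = x * x * q\<^sup>2"
    "q powi (2 * (b + 1)) = y * y * q\<^sup>2" "q powi (a - b) = x / y" "q powi (b - a) = y / x"
    using q by (simp_all add: x_def y_def power_int_add power_int_diff power2_eq_square distrib_left power_int_mult mult.commute)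
  have *: "(x * x - inverse (x * x)) * (y * y * q\<^sup>2 - inverse (y * y * q\<^sup>2)) -
      (y * y - inverse (y * y)) * (x * x * q\<^sup>2 - inverse (x * x * q\<^sup>2)) =
      d * ((x / y) * (x / y) - (y / x) * (y / x))"
    using q nz(2,3) by (simp add: d_def power_int_minus divide_simps, simp add: algebra_simps power2_eq_square power4_eq_xxxx)
  show ?thesis
    using nz(1) * unfolding qint_def e power_int_minus d_def[unfolded power_int_minus, symmetric]
    by (simp add: divide_simps)
qed

lemma rowK_rel:
  "rowK q r i * rowK q r j = rowK q r j * rowK q r i"
  "rowK q r i * rowK' q r i = 1" "rowK' q r i * rowK q r i = 1"
  using q by (simp_all add: row_defs weighted_shift_mult mult.commute flip: weighted_shift_one power_int_add)

lemma rowKF: "rowK q r i * rowF q r j = op_sc (q powi (- cartan i j)) (rowF q r j * rowK q r i)"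
  "rowK' q r i * rowF q r j = op_sc (q powi (cartan i j)) (rowF q r j * rowK' q r i)"
  using q by (auto simp add: row_defs weighted_shift_mult weighted_shift_sc lookup_unit_entry lookup_add lookup_minus cartan_def
      power_int_add power_int_diff power_int_minus field_simps power2_eq_square intro!: arg_cong2[where f=weighted_shift] ext)

lemma rowKE: "rowE q r j * rowK q r i = op_sc (q powi (- cartan i j)) (rowK q r i * rowE q r j)"
  "rowE q r j * rowK' q r i = op_sc (q powi (cartan i j)) (rowK' q r i * rowE q r j)"
  using q by (auto simp add: row_defs weighted_shift_mult weighted_shift_sc lookup_unit_entry lookup_add lookup_minus cartan_def
      power_int_add power_int_diff power_int_minus field_simps power2_eq_square intro!: arg_cong2[where f=weighted_shift] ext)

lemma lowering_raising_Suc: "lowering q r i (m + 1) * raising q r i m = qint q (m + 1)"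
  using lowering_raising[of q r i "m + 1"] by simp

lemma rowEF: "rowE q r i * rowF q r j - rowF q r j * rowE q r i =
   (if i = j then op_sc (1 / (q\<^sup>2 - q powi (-2))) (rowK q r i * rowK q r i - rowK' q r i * rowK' q r i) else 0)"
proof (cases "i = j")
  case True
  \<comment> \<open>In each product one variable is lowered and then raised, the other raised and
    then lowered. Pairing these gives quantum integers, however they are distributed between
    \<open>lowering\<close> and \<open>raising\<close>.\<close>
  have 1: "lowering q r j A * raising q r (Suc j) B * (lowering q r (Suc j) (B + 1) * raising q r j (A - 1)) -
     lowering q r (Suc j) B * raising q r j A * (lowering q r j (A + 1) * raising q r (Suc j) (B - 1)) =
     qint q A * qint q (B + 1) - qint q B * qint q (A + 1)" for A B
    unfolding lowering_raising_Suc[of r j A, symmetric] lowering_raising_Suc[of r "Suc j" B, symmetric]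
      lowering_raising[of q r j A, symmetric] lowering_raising[of q r "Suc j" B, symmetric]
    by (simp only: ac_simps)
  show ?thesis using True 1
    by (simp add: row_defs weighted_shift_mult weighted_shift_diff weighted_shift_sc lookup_unit_entry lookup_add lookup_minus qint_cross)
next
  case False
  consider "j = Suc i" | "i = Suc j" | "i \<noteq> j" "j \<noteq> Suc i" "i \<noteq> Suc j" using False by blast
  thus ?thesis
    by cases (use False in \<open>simp_all add: row_defs weighted_shift_mult lookup_unit_entry lookup_add lookup_minus algebra_simps\<close>)
qed

lemma rowF_far: "cartan i j = 0 \<Longrightarrow> rowF q r i * rowF q r j = rowF q r j * rowF q r i"
  "cartan i j = 0 \<Longrightarrow> rowE q r i * rowE q r j = rowE q r j * rowE q r i"
   by (auto simp add: row_defs weighted_shift_mult weighted_shift_sc lookup_unit_entry lookup_add lookup_minus cartan_def algebra_simps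
       split: if_splits)

text \<open>\<open>A\<close> collects the factors of the two outer variables, common to all three
  terms. What remains concerns the variable shared by the two generators: raised twice and lowered
  once, or the reverse.\<close>

lemma serre_coeff:
  "A * (lowering q r i m * raising q r i (m - 1) * raising q r i m) - (q\<^sup>2 + inverse (q\<^sup>2)) * (A * (raising q r i m * lowering q r i (m + 1) * raising q r i m)) +
    A * (raising q r i m * raising q r i (m + 1) * lowering q r i (m + 2)) = 0"
  "A * (raising q r i m * lowering q r i (m + 1) * lowering q r i m) - (q\<^sup>2 + inverse (q\<^sup>2)) * (A * (lowering q r i m * raising q r i (m - 1) * lowering q r i m)) +
    A * (lowering q r i m * lowering q r i (m - 1) * raising q r i (m - 2)) = 0"
proof -
  have 1: "lowering q r i (m + 2) * raising q r i (m + 1) = qint q (m + 2)" and 2: "lowering q r i (m - 1) * raising q r i (m - 2) = qint q (m - 1)"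
    using lowering_raising[of q r i "m + 2"] lowering_raising[of q r i "m - 1"] by (simp_all add: algebra_simps)
  have "A * (lowering q r i m * raising q r i (m - 1) * raising q r i m) - (q\<^sup>2 + inverse (q\<^sup>2)) * (A * (raising q r i m * lowering q r i (m + 1) * raising q r i m)) +
    A * (raising q r i m * raising q r i (m + 1) * lowering q r i (m + 2)) = A * raising q r i m * (qint q m - (q\<^sup>2 + inverse (q\<^sup>2)) * qint q (m + 1) + qint q (m + 2))"
    unfolding 1[symmetric] lowering_raising_Suc[of r i m, symmetric] lowering_raising[of q r i m, symmetric] by (simp add: algebra_simps)
  thus "A * (lowering q r i m * raising q r i (m - 1) * raising q r i m) - (q\<^sup>2 + inverse (q\<^sup>2)) * (A * (raising q r i m * lowering q r i (m + 1) * raising q r i m)) +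
    A * (raising q r i m * raising q r i (m + 1) * lowering q r i (m + 2)) = 0" by (simp add: qint_rec)
  have "A * (raising q r i m * lowering q r i (m + 1) * lowering q r i m) - (q\<^sup>2 + inverse (q\<^sup>2)) * (A * (lowering q r i m * raising q r i (m - 1) * lowering q r i m)) +
    A * (lowering q r i m * lowering q r i (m - 1) * raising q r i (m - 2)) = A * lowering q r i m * (qint q (m - 1) - (q\<^sup>2 + inverse (q\<^sup>2)) * qint q m + qint q (m + 1))"
    unfolding 2[symmetric] lowering_raising_Suc[of r i m, symmetric] lowering_raising[of q r i m, symmetric] by (simp add: algebra_simps)
  thus "A * (raising q r i m * lowering q r i (m + 1) * lowering q r i m) - (q\<^sup>2 + inverse (q\<^sup>2)) * (A * (lowering q r i m * raising q r i (m - 1) * lowering q r i m)) +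
    A * (lowering q r i m * lowering q r i (m - 1) * raising q r i (m - 2)) = 0" using qint_rec[of "m - 1"] by (simp only: diff_add_cancel) (simp add: add.commute)
qed

lemma row_serre:
  assumes "cartan i j = -1"
  shows "op.qserre (q\<^sup>2) (rowF q r i) (rowF q r j) = 0" "op.qserre (q\<^sup>2) (rowE q r i) (rowE q r j) = 0"
proof -
  have wz: "weighted_shift c s = 0" if "\<And>a. c a = 0" for c :: "idx \<Rightarrow> 'k" and s
  proof -
    have "c = (\<lambda>a. 0)" using that by blast
    thus ?thesis by (simp add: weighted_shift_zero)
  qed
  consider "j = Suc i" | "i = Suc j" using assms by (auto simp: cartan_def split: if_splits)
  hence "op.qserre (q\<^sup>2) (rowF q r i) (rowF q r j) = 0 \<and> op.qserre (q\<^sup>2) (rowE q r i) (rowE q r j) = 0"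
  proof cases
    case 1
    show ?thesis unfolding 1 rowF_def rowE_def qserre_weighted_shift
    proof (intro conjI wz, goal_cases)
      case (1 a)
      show ?case 
        using serre_coeff(1)[of "lowering q r i (entry a r i) * lowering q r i (entry a r i - 1) * raising q r (Suc (Suc i)) (entry a r (Suc (Suc i)))" r "Suc i" "entry a r (Suc i)"]
        by (simp add: lookup_unit_entry lookup_add lookup_minus ac_simps)
    next
      case (2 a)
      show ?case 
        using serre_coeff(2)[of "raising q r i (entry a r i) * raising q r i (entry a r i + 1) * lowering q r (Suc (Suc i)) (entry a r (Suc (Suc i)))" r "Suc i" "entry a r (Suc i)"]
        by (simp add: lookup_unit_entry lookup_add lookup_minus ac_simps)
    qed
  next
    case 2
    show ?thesis unfolding 2 rowF_def rowE_def qserre_weighted_shift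
    proof (intro conjI wz, goal_cases)
      case (1 a)
      show ?case 
        using serre_coeff(2)[of "lowering q r j (entry a r j) * raising q r (Suc (Suc j)) (entry a r (Suc (Suc j))) * raising q r (Suc (Suc j)) (entry a r (Suc (Suc j)) + 1)" r "Suc j" "entry a r (Suc j)"]
        by (simp add: lookup_unit_entry lookup_add lookup_minus ac_simps)
    next
      case (2 a)
      show ?case 
        using serre_coeff(1)[of "raising q r j (entry a r j) * lowering q r (Suc (Suc j)) (entry a r (Suc (Suc j))) * lowering q r (Suc (Suc j)) (entry a r (Suc (Suc j)) - 1)" r "Suc j" "entry a r (Suc j)"]
        by (simp add: lookup_unit_entry lookup_add lookup_minus ac_simps)
    qed
  qed
  thus "op.qserre (q\<^sup>2) (rowF q r i) (rowF q r j) = 0" "op.qserre (q\<^sup>2) (rowE q r i) (rowE q r j) = 0" by auto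
qed

lemma row_uq_rep: "op.uq_rep q N (rowE q r) (rowF q r) (rowK q r) (rowK' q r)"
  unfolding op.uq_rep_def
  by (intro ballI conjI impI) (rule rowK_rel rowKF rowKE rowEF rowF_far row_serre; assumption)+

end

text \<open>The tensor product of the rows \<open>m, \<dots>, 1\<close>, in this order, along the comultiplication of
  \<open>uq_rep_comult\<close>.\<close>

primrec repK :: "'k::field \<Rightarrow> nat \<Rightarrow> nat \<Rightarrow> (idx, 'k) lin_op" where
  "repK q 0 i = 1"
| "repK q (Suc m) i = rowK q (Suc m) i * repK q m i"

primrec repK' :: "'k::field \<Rightarrow> nat \<Rightarrow> nat \<Rightarrow> (idx, 'k) lin_op" where
  "repK' q 0 i = 1"
| "repK' q (Suc m) i = rowK' q (Suc m) i * repK' q m i"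

primrec repE :: "'k::field \<Rightarrow> nat \<Rightarrow> nat \<Rightarrow> (idx, 'k) lin_op" where
  "repE q 0 i = 0"
| "repE q (Suc m) i = rowE q (Suc m) i * repK q m i + rowK' q (Suc m) i * repE q m i"

primrec repF :: "'k::field \<Rightarrow> nat \<Rightarrow> nat \<Rightarrow> (idx, 'k) lin_op" where
  "repF q 0 i = 0"
| "repF q (Suc m) i = rowF q (Suc m) i * repK q m i + rowK' q (Suc m) i * repF q m i"

lemma row_commute:
  assumes "r \<noteq> r'" "x \<in> {rowE q r i, rowF q r i, rowK q r i, rowK' q r i}"
    "y \<in> {rowE q r' j, rowF q r' j, rowK q r' j, rowK' q r' j}"
  shows "x * y = y * x"
  using assms by (auto simp: row_defs weighted_shift_mult lookup_unit_entry lookup_add lookup_minus algebra_simps)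

lemma rep_commute:
  assumes x: "\<And>r j y. \<lbrakk>r \<le> m; y \<in> {rowE q r j, rowF q r j, rowK q r j, rowK' q r j}\<rbrakk> \<Longrightarrow> x * y = y * x"
    and y: "y \<in> {repE q m j, repF q m j, repK q m j, repK' q m j}"
  shows "x * y = y * x"
  using assms
proof (induction m arbitrary: y)
  case (Suc m)
  have "x * z = z * x" if "z \<in> {repE q m j, repF q m j, repK q m j, repK' q m j}" for z
    by (rule Suc.IH[OF Suc.prems(1) that]) (erule le_SucI)
  hence IH: "x * repE q m j = repE q m j * x" "x * repF q m j = repF q m j * x"
    "x * repK q m j = repK q m j * x" "x * repK' q m j = repK' q m j * x"
    by blast+
  have "x * z = z * x" if "z \<in> {rowE q (Suc m) j, rowF q (Suc m) j, rowK q (Suc m) j, rowK' q (Suc m) j}" for z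
    by (rule Suc.prems(1)[OF order_refl that])
  hence P: "x * rowE q (Suc m) j = rowE q (Suc m) j * x" "x * rowF q (Suc m) j = rowF q (Suc m) j * x"
    "x * rowK q (Suc m) j = rowK q (Suc m) j * x" "x * rowK' q (Suc m) j = rowK' q (Suc m) j * x"
    by blast+
  have *: "x * (u * v) = u * v * x" if "x * u = u * x" "x * v = v * x" for u v
    using that by (metis mult.assoc)
  show ?case using Suc.prems(2) *[OF P(1) IH(3)] *[OF P(4) IH(1)] *[OF P(2) IH(3)] *[OF P(4) IH(2)]
      *[OF P(3) IH(3)] *[OF P(4) IH(4)]
    by (elim insertE emptyE; simp only: repE.simps repF.simps repK.simps repK'.simps distrib_left distrib_right)
qed auto

lemma rep_uq_rep:
  assumes "q \<noteq> 0" "q ^ 4 \<noteq> 1"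
  shows "op.uq_rep q N (repE q m) (repF q m) (repK q m) (repK' q m)"
proof (induction m)
  case 0
  show ?case by (auto simp: op.uq_rep_def op.qserre_def)
next
  case (Suc m)
  have "op.uq_rep q N (\<lambda>i. rowE q (Suc m) i * repK q m i + rowK' q (Suc m) i * repE q m i)
     (\<lambda>i. rowF q (Suc m) i * repK q m i + rowK' q (Suc m) i * repF q m i)
     (\<lambda>i. rowK q (Suc m) i * repK q m i) (\<lambda>i. rowK' q (Suc m) i * repK' q m i)"
  proof (rule op.uq_rep_comult[OF assms(1) row_uq_rep[OF assms] Suc.IH])
    fix i j x y
    assume "x \<in> {rowE q (Suc m) i, rowF q (Suc m) i, rowK q (Suc m) i, rowK' q (Suc m) i}"
      and y: "y \<in> {repE q m j, repF q m j, repK q m j, repK' q m j}"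
    then show "x * y = y * x"
      by (intro rep_commute[OF _ y]) (rule row_commute[of "Suc m"]; auto)
  qed
  thus ?case by (simp only: op.uq_rep_def repE.simps repF.simps repK.simps repK'.simps)
qed

text \<open>The summand of the iterated coproduct in which row \<open>r\<close> carries
  \<open>F l\<close>: the rows \<open>s > r\<close> stand to its left and contribute
  \<open>K' l\<close>, the rows \<open>s < r\<close> contribute \<open>K l\<close>.\<close>

definition repF_coeff :: "'k::field \<Rightarrow> nat \<Rightarrow> nat \<Rightarrow> nat \<Rightarrow> idx \<Rightarrow> 'k" where
  "repF_coeff q m l r a =
     q powi (\<Sum>s\<in>{r<..m}. entry a s (l + 1) - entry a s l) *
     (lowering q r l (entry a r l) * raising q r (l + 1) (entry a r (l + 1))) *
     q powi (\<Sum>s\<in>{1..<r}. entry a s l - entry a s (l + 1))"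

lemma repK_eq:
  assumes "q \<noteq> 0"
  shows "repK q m l = weighted_shift (\<lambda>a. q powi (\<Sum>s\<in>{1..m}. entry a s l - entry a s (l + 1))) 0"
proof (induction m)
  case 0
  show ?case by (simp add: weighted_shift_one)
next
  case (Suc m)
  show ?case using assms
    by (simp add: Suc.IH rowK_def weighted_shift_mult power_int_add)
qed

lemma repF_eq:
  assumes "q \<noteq> 0"
  shows "repF q m l = (\<Sum>r\<in>{1..m}. weighted_shift (repF_coeff q m l r) (unit_entry r (l + 1) - unit_entry r l))"
proof (induction m)
  case 0
  show ?case by simp
next
  case (Suc m)
  have 1: "rowF q (Suc m) l * repK q m l =
      weighted_shift (repF_coeff q (Suc m) l (Suc m)) (unit_entry (Suc m) (l + 1) - unit_entry (Suc m) l)"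
    unfolding repK_eq[OF assms] rowF_def weighted_shift_mult
    by (intro arg_cong2[where f = weighted_shift] ext) (simp_all add: repF_coeff_def atLeastLessThanSuc_atLeastAtMost)
  have 2: "rowK' q (Suc m) l * weighted_shift (repF_coeff q m l r) (unit_entry r (l + 1) - unit_entry r l) =
      weighted_shift (repF_coeff q (Suc m) l r) (unit_entry r (l + 1) - unit_entry r l)" if "r \<in> {1..m}" for r
  proof -
    have I: "{r<..Suc m} = insert (Suc m) {r<..m}" using that by auto
    show ?thesis unfolding rowK'_def weighted_shift_mult using that assms
      by (intro arg_cong2[where f = weighted_shift] ext)
        (simp_all add: repF_coeff_def I lookup_add lookup_minus lookup_unit_entry power_int_add)
  qed
  show ?case
    unfolding repF.simps 1 unfolding Suc.IH sum_distrib_left using 2 by (simp add: add.commute)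
qed

section \<open>Operators applied to basis vectors\<close>

lemma lin_app_add: "lin_app (x + y) \<phi> = (\<lambda>a. lin_app x \<phi> a + lin_app y \<phi> a)"
  by transfer simp

lemma lin_app_diff: "lin_app (x - y) \<phi> = (\<lambda>a. lin_app x \<phi> a - lin_app y \<phi> a)"
  by transfer simp

lemma lin_app_sc: "lin_app (op_sc c x) \<phi> = (\<lambda>a. c * lin_app x \<phi> a)"
  by transfer simp

lemma lin_app_mult: "lin_app (x * y) \<phi> = lin_app x (lin_app y \<phi>)"
  by transfer simp

lemma lin_app_one: "lin_app 1 \<phi> = \<phi>"
  by transfer simp

lemma lin_app_zero: "lin_app 0 \<phi> = (\<lambda>a. 0)"
  by transfer simp

lemma lin_app_linear: "lin_app x (\<lambda>a. c * \<phi> a + \<psi> a) = (\<lambda>a. c * lin_app x \<phi> a + lin_app x \<psi> a)"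
  by transfer blast

lemma lin_app_scale: "lin_app x (\<lambda>a. c * \<phi> a) = (\<lambda>a. c * lin_app x \<phi> a)"
proof -
  have "lin_app x (\<lambda>a. 0) = (\<lambda>a. 0)"
    using lin_app_linear[of x "-1" "\<lambda>a. 0" "\<lambda>a. 0"] by (simp add: fun_eq_iff)
  thus ?thesis using lin_app_linear[of x c \<phi> "\<lambda>a. 0"] by simp
qed

lemma lin_app_sum: "finite R \<Longrightarrow> lin_app (\<Sum>r\<in>R. x r) \<phi> = (\<lambda>a. \<Sum>r\<in>R. lin_app (x r) \<phi> a)"
  by (induction rule: finite_induct) (simp_all add: lin_app_zero lin_app_add)

lemma lin_app_sum_right: "finite R \<Longrightarrow> lin_app x (\<lambda>a. \<Sum>r\<in>R. c r * \<phi> r a) = (\<lambda>a. \<Sum>r\<in>R. c r * lin_app x (\<phi> r) a)"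
proof (induction rule: finite_induct)
  case empty
  show ?case using lin_app_scale[of x 0 "\<lambda>a. 0"] by simp
qed (simp add: lin_app_linear)

lemma lin_app_repF:
  assumes "q \<noteq> 0"
  shows "lin_app (repF q m l) (basis_fun b) =
    (\<lambda>a. \<Sum>r\<in>{1..m}. repF_coeff q m l r b * basis_fun (b + (unit_entry r (l + 1) - unit_entry r l)) a)"
  unfolding repF_eq[OF assms] by (simp add: lin_app_sum lin_app_weighted_shift)

text \<open>Starting from the vacuum \<open>basis_fun 0\<close>, the root vectors of the rows \<open>\<ge> k\<close> only reach
  vectors \<open>basis_fun b\<close> with \<open>from_row k b\<close>.\<close>

definition from_row :: "nat \<Rightarrow> idx \<Rightarrow> bool" where
  "from_row k b \<longleftrightarrow> (\<forall>s i. s < k \<or> i < s \<longrightarrow> entry b s i = 0)"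

text \<open>On \<open>from_row k\<close> the root vector \<open>(k, l)\<close> acts as a mere creation operator in row \<open>k\<close>: the
  contributions of the rows \<open>> k\<close> cancel in the \<open>q\<close>-commutator because those rows stand to the
  left of row \<open>k\<close> in the tensor product.\<close>

definition root_coeff :: "'k::field \<Rightarrow> nat \<Rightarrow> nat \<Rightarrow> nat \<Rightarrow> idx \<Rightarrow> 'k" where
  "root_coeff q N k l b = (- inverse q) ^ (l - k - 1) *
     (q powi (- 2 * (\<Sum>i\<in>{k<..<l}. entry b k i)) * q powi (\<Sum>s\<in>{k<..N}. entry b s l))"

text \<open>The source of nonvanishing coefficients: this combination of consecutive quantum
  integers is a power of \<open>q\<close> up to sign, even where the integers themselves
  vanish.\<close>

lemma qint_shift:
  assumes q: "q \<noteq> 0" and q4: "q ^ 4 \<noteq> 1"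
  shows "q * qint q m - inverse q * qint q (m + 1) = - inverse q * q powi (- 2 * m)"
proof -
  define d where "d = q\<^sup>2 - q powi (-2)"
  define x where "x = q powi (2 * m)"
  have nz: "d \<noteq> 0" "x \<noteq> 0" using q q2_diff[OF q q4] by (simp_all add: d_def x_def)
  have e: "q powi (2 * (m + 1)) = x * q\<^sup>2" "q powi (- (2 * m)) = inverse x" "q powi (- 2 * m) = inverse x"
      "q powi (- (2 * (m + 1))) = inverse x * inverse (q\<^sup>2)"
    using q by (simp_all add: x_def power_int_add distrib_left power_int_minus power_int_diff divide_inverse)
  have "(q * (x - inverse x) - inverse q * (x * q\<^sup>2 - inverse x * inverse (q\<^sup>2))) = (- inverse q * inverse x) * d"
    using q nz(2) by (simp add: d_def power_int_minus divide_simps, simp add: algebra_simps power2_eq_square power4_eq_xxxx)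
  hence "(q * (x - inverse x) - inverse q * (x * q\<^sup>2 - inverse x * inverse (q\<^sup>2))) / d = - inverse q * inverse x"
    using nz(1) by simp
  thus ?thesis unfolding qint_def e d_def[symmetric] x_def[symmetric] by (simp add: diff_divide_distrib right_diff_distrib)
qed

lemma qint_0: "qint q 0 = 0"
  by (simp add: qint_def)

lemma repF_coeff_eq_0:
  assumes "entry b r l = 0" "l \<noteq> r"
  shows "repF_coeff q m l r b = 0"
  using assms by (simp add: repF_coeff_def lowering_def qint_0)

text \<open>Induction on \<open>l\<close>, expanding \<open>F l\<close> over all rows on either side
  of the shorter root vector. The terms of rows other than \<open>k\<close> cancel in the
  commutator; row \<open>k\<close> survives through \<open>qint_shift\<close>.\<close>

lemma lin_app_root_vec:
  assumes q: "q \<noteq> 0" and q4: "q ^ 4 \<noteq> 1" and k: "1 \<le> k" and l: "k < l" "l \<le> N + 1"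
    and b: "from_row k b"
  shows "lin_app (op.root_vec q (repF q N) k l) (basis_fun b) =
    (\<lambda>a. root_coeff q N k l b * basis_fun (b + (unit_entry k l - unit_entry k k)) a)"
  using l b
proof (induction l arbitrary: b)
  case 0
  then show ?case by simp
next
  case (Suc l)
  have kN: "k \<le> N" "k \<in> {1..N}" using Suc.prems k by auto
  have b0: "entry b s i = 0" if "s < k \<or> i < s" for s i
    using Suc.prems that by (auto simp: from_row_def)
  have before: "(\<Sum>s\<in>{1..<k}. entry b s i - entry b s j) = 0" for i j
    using b0 by (intro sum.neutral) simp
  show ?case
  proof (cases "l = k")
    case True
    have "lin_app (repF q N k) (basis_fun b) = (\<lambda>a. repF_coeff q N k k b * basis_fun (b + (unit_entry k (k + 1) - unit_entry k k)) a)"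
    proof (unfold lin_app_repF[OF q], rule ext)
      fix a
      \<comment> \<open>Row \<open>r < k\<close> is empty, and for \<open>r > k\<close> the variable
        \<open>k\<close> lies before the diagonal; either way the coefficient contains the quantum
        integer of 0.\<close>
      have "repF_coeff q N k r b = 0" if "r \<noteq> k" for r
        using that b0[of r k] by (intro repF_coeff_eq_0) (cases "r < k"; simp)+
      hence "(\<Sum>r\<in>{1..N}. repF_coeff q N k r b * basis_fun (b + (unit_entry r (k + 1) - unit_entry r k)) a) =
          (\<Sum>r\<in>{k}. repF_coeff q N k r b * basis_fun (b + (unit_entry r (k + 1) - unit_entry r k)) a)"
        using kN by (intro sum.mono_neutral_right) auto
      thus "(\<Sum>r\<in>{1..N}. repF_coeff q N k r b * basis_fun (b + (unit_entry r (k + 1) - unit_entry r k)) a) =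
          repF_coeff q N k k b * basis_fun (b + (unit_entry k (k + 1) - unit_entry k k)) a" by simp
    qed
    moreover have "repF_coeff q N k k b = root_coeff q N k (Suc k) b"
      using before[of k "Suc k"] b0
      by (auto simp: repF_coeff_def root_coeff_def lowering_def raising_def intro!: arg_cong[where f = "\<lambda>x. q powi x"] sum.cong)
    ultimately show ?thesis using True by simp
  next
    case False
    hence kl: "k < l" using Suc.prems by simp
    have IH: "lin_app (op.root_vec q (repF q N) k l) (basis_fun c) =
        (\<lambda>a. root_coeff q N k l c * basis_fun (c + (unit_entry k l - unit_entry k k)) a)" if "from_row k c" for c
      using Suc.IH[OF kl _ that] Suc.prems by simp
    let ?Y = "op.root_vec q (repF q N) k l" and ?F = "repF q N l"
    let ?g = "root_coeff q N k l" and ?C = "repF_coeff q N l"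
    let ?t = "unit_entry k l - unit_entry k k :: idx" and ?s = "\<lambda>r. unit_entry r (l + 1) - unit_entry r l :: idx"
    have YF: "lin_app ?Y (lin_app ?F (basis_fun b)) =
        (\<lambda>a. \<Sum>r\<in>{1..N}. ?C r b * (?g (b + ?s r) * basis_fun (b + ?s r + ?t) a))"
    proof -
      \<comment> \<open>The induction hypothesis needs \<open>from_row k\<close> for the shifted
        index; where this might fail the coefficient \<open>?C r b\<close> is zero.\<close>
      have "?C r b * lin_app ?Y (basis_fun (b + ?s r)) a = ?C r b * (?g (b + ?s r) * basis_fun (b + ?s r + ?t) a)" for r a
      proof (cases "?C r b = 0")
        case False
        hence "r \<le> l \<and> k \<le> r"
          using repF_coeff_eq_0[of b r l q N] b0[of r l] kl by force
        hence "from_row k (b + ?s r)"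
          using b0 by (auto simp: from_row_def lookup_add lookup_minus lookup_unit_entry)
        thus ?thesis by (simp add: IH)
      qed simp
      thus ?thesis unfolding lin_app_repF[OF q] lin_app_sum_right[OF finite_atLeastAtMost] by (intro ext sum.cong refl)
    qed
    have FY: "lin_app ?F (lin_app ?Y (basis_fun b)) =
        (\<lambda>a. \<Sum>r\<in>{1..N}. ?g b * (?C r (b + ?t) * basis_fun (b + ?t + ?s r) a))"
      unfolding IH[OF Suc.prems(3)] lin_app_scale lin_app_repF[OF q] by (simp add: sum_distrib_left)
    \<comment> \<open>For \<open>k < r \<le> l\<close>, \<open>F l\<close> in row \<open>r\<close>
      lowers entry \<open>(r, l)\<close>, which costs \<open>?g\<close> a factor
      \<open>inverse q\<close>. Creation in row \<open>k\<close> raises entry \<open>(k, l)\<close>,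
      seen by \<open>K l\<close> to the right of row \<open>r\<close>, which gives
      \<open>?C r\<close> a factor \<open>q\<close>. These compensate the two coefficients of the
      commutator.\<close>
    have other: "q * (?C r b * ?g (b + ?s r)) = inverse q * (?g b * ?C r (b + ?t))"
      if r: "r \<in> {1..N}" "r \<noteq> k" for r
    proof (cases "r < k \<or> l < r")
      case True
      hence "?C r b = 0" "?C r (b + ?t) = 0"
        using kl b0[of r l] r by (auto intro!: repF_coeff_eq_0 simp: lookup_add lookup_minus lookup_unit_entry)
      thus ?thesis by simp
    next
      case False
      hence rk: "k < r" "r \<le> l" using r by auto
      have "(\<Sum>s\<in>{k<..N}. entry (b + ?s r) s l) = (\<Sum>s\<in>{k<..N}. entry b s l) - (\<Sum>s\<in>{k<..N}. if r = s then 1 else 0)"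
        unfolding sum_subtractf[symmetric] by (intro sum.cong) (auto simp: lookup_add lookup_minus lookup_unit_entry)
      also have "\<dots> = (\<Sum>s\<in>{k<..N}. entry b s l) - 1" using r rk by simp
      finally have g: "?g (b + ?s r) = ?g b * inverse q"
        using q rk by (simp add: root_coeff_def lookup_add lookup_minus lookup_unit_entry power_int_diff divide_inverse)
      have "(\<Sum>s\<in>{1..<r}. entry (b + ?t) s l - entry (b + ?t) s (l + 1)) =
          (\<Sum>s\<in>{1..<r}. entry b s l - entry b s (l + 1)) + (\<Sum>s\<in>{1..<r}. if k = s then 1 else 0)"
        unfolding sum.distrib[symmetric] using kl by (intro sum.cong) (auto simp: lookup_add lookup_minus lookup_unit_entry)
      also have "\<dots> = (\<Sum>s\<in>{1..<r}. entry b s l - entry b s (l + 1)) + 1" using rk k by simp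
      finally have C: "?C r (b + ?t) = ?C r b * q"
        using q rk kl
        by (simp add: repF_coeff_def lookup_add lookup_minus lookup_unit_entry power_int_add)
      show ?thesis unfolding g C using q by (simp add: field_simps)
    qed
    \<comment> \<open>Creation in row \<open>k\<close> shifts the quantum integer in
      \<open>?C k\<close> by one, while \<open>?g\<close> sees row \<open>k\<close> only strictly
      between \<open>k\<close> and \<open>l\<close>, where \<open>F l\<close> changes
      nothing.\<close>
    have own: "q * (?C k b * ?g (b + ?s k)) - inverse q * (?g b * ?C k (b + ?t)) = root_coeff q N k (Suc l) b"
    proof -
      define Q where "Q = q powi (\<Sum>s\<in>{k<..N}. entry b s (l + 1) - entry b s l)"
      have C: "?C k b = Q * qint q (entry b k l)"
        unfolding repF_coeff_def before Q_def using kl by (simp add: lowering_def raising_def)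
      have "(\<Sum>s\<in>{1..<k}. entry (b + ?t) s l - entry (b + ?t) s (l + 1)) = 0"
        using b0 by (intro sum.neutral) (auto simp: lookup_add lookup_minus lookup_unit_entry)
      hence C': "?C k (b + ?t) = Q * qint q (entry b k l + 1)"
        unfolding repF_coeff_def Q_def using kl by (simp add: lowering_def raising_def lookup_add lookup_minus lookup_unit_entry)
      have g: "?g (b + ?s k) = ?g b"
        by (simp add: root_coeff_def lookup_add lookup_minus lookup_unit_entry)
      have "q * (?C k b * ?g (b + ?s k)) - inverse q * (?g b * ?C k (b + ?t)) =
          ?g b * Q * (q * qint q (entry b k l) - inverse q * qint q (entry b k l + 1))"
        unfolding C C' g by (simp add: algebra_simps)
      also have "\<dots> = ?g b * Q * (- inverse q * q powi (- 2 * entry b k l))"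
        by (simp only: qint_shift[OF q q4])
      \<comment> \<open>\<open>Q\<close> exchanges column \<open>l\<close> for \<open>l + 1\<close>
        in the rows beyond \<open>k\<close>; the new power of \<open>q\<close> extends the sum over
        row \<open>k\<close> by column \<open>l\<close>.\<close>
      also have "\<dots> = root_coeff q N k (Suc l) b"
      proof -
        have I: "{k<..<Suc l} = insert l {k<..<l}" using kl by auto
        have 1: "q powi (\<Sum>s\<in>{k<..N}. entry b s (Suc l)) = q powi (\<Sum>s\<in>{k<..N}. entry b s l) * Q"
          unfolding Q_def using q by (simp add: sum_subtractf flip: power_int_add)
        have 2: "Suc l - k - 1 = Suc (l - k - 1)" using kl by simp
        have "- 2 * (\<Sum>i\<in>{k<..<Suc l}. entry b k i) = - 2 * (\<Sum>i\<in>{k<..<l}. entry b k i) + - 2 * entry b k l"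
          unfolding I by simp
        hence 3: "q powi (- 2 * (\<Sum>i\<in>{k<..<Suc l}. entry b k i)) =
            q powi (- 2 * (\<Sum>i\<in>{k<..<l}. entry b k i)) * q powi (- 2 * entry b k l)"
          using q power_int_add[of q] by metis
        show ?thesis unfolding root_coeff_def 1 2 3 power_Suc
          by (simp only: mult.assoc mult.commute mult.left_commute)
      qed
      finally show ?thesis .
    qed
    show ?thesis
    proof
      fix a
      have "lin_app (op.root_vec q (repF q N) k (Suc l)) (basis_fun b) a =
          q * (\<Sum>r\<in>{1..N}. ?C r b * (?g (b + ?s r) * basis_fun (b + ?s r + ?t) a)) -
          inverse q * (\<Sum>r\<in>{1..N}. ?g b * (?C r (b + ?t) * basis_fun (b + ?t + ?s r) a))"
        using kl by (simp add: lin_app_diff lin_app_sc lin_app_mult YF FY)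
      also have "\<dots> = (\<Sum>r\<in>{1..N}. (q * (?C r b * ?g (b + ?s r)) - inverse q * (?g b * ?C r (b + ?t))) *
          basis_fun (b + ?t + ?s r) a)"
      proof -
        have e: "b + ?s r + ?t = b + ?t + ?s r" for r by (simp only: ac_simps)
        show ?thesis unfolding sum_distrib_left sum_subtractf[symmetric] e
          by (intro sum.cong) (simp_all only: left_diff_distrib mult.assoc)
      qed
      also have "\<dots> = (\<Sum>r\<in>{k}. (q * (?C r b * ?g (b + ?s r)) - inverse q * (?g b * ?C r (b + ?t))) *
          basis_fun (b + ?t + ?s r) a)"
        using kN other by (intro sum.mono_neutral_right) auto
      also have "\<dots> = root_coeff q N k (Suc l) b * basis_fun (b + (unit_entry k (Suc l) - unit_entry k k)) a"
      proof -
        have "b + ?t + ?s k = b + (unit_entry k (Suc l) - unit_entry k k)" by simp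
        moreover have "(\<Sum>r\<in>{k}. f r) = f k" for f :: "nat \<Rightarrow> 'a" by simp
        ultimately show ?thesis by (simp only: own)
      qed
      finally show "lin_app (op.root_vec q (repF q N) k (Suc l)) (basis_fun b) a =
        root_coeff q N k (Suc l) b * basis_fun (b + (unit_entry k (Suc l) - unit_entry k k)) a" .
    qed
  qed
qed

definition idx_of :: "(nat \<times> nat) list \<Rightarrow> idx" where
  "idx_of ps = sum_list (map (\<lambda>(k, l). unit_entry k l - unit_entry k k) ps)"

text \<open>The negative contributions sit on the diagonal, so above it the index records
  multiplicities and determines the exponents.\<close>

lemma entry_idx_of: "k < l \<Longrightarrow> \<forall>(i, j)\<in>set ps. i < j \<Longrightarrow> entry (idx_of ps) k l = int (count_list ps (k, l))"
  by (induction ps) (auto simp: idx_of_def lookup_add lookup_minus lookup_unit_entry split: if_splits)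

lemma entry_idx_of_0: "\<forall>(i, j)\<in>set ps. i < j \<and> k \<le> i \<Longrightarrow> from_row k (idx_of ps)"
  by (induction ps) (auto simp: idx_of_def lookup_add lookup_minus lookup_unit_entry from_row_def)

text \<open>The rightmost factor acts first. As rows increase along the list, a factor of row
  \<open>k\<close> meets an index with entries in rows \<open>\<ge> k\<close> only, which is the
  situation of \<open>lin_app_root_vec\<close>.\<close>

theorem root_vec_vacuum:
  assumes q: "q \<noteq> 0" and q4: "q ^ 4 \<noteq> 1"
    and ps: "sorted (map fst ps)" "set ps \<subseteq> Lambda N"
  shows "\<exists>c. c \<noteq> 0 \<and> lin_app (prod_list (map (\<lambda>(k, l). op.root_vec q (repF q N) k l) ps)) (basis_fun 0) =
    (\<lambda>a. c * basis_fun (idx_of ps) a)"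
  using ps
proof (induction ps)
  case Nil
  show ?case by (intro exI[of _ 1]) (simp add: lin_app_one idx_of_def)
next
  case (Cons p ps)
  obtain k l where p: "p = (k, l)" by force
  obtain c where c: "c \<noteq> 0" "lin_app (prod_list (map (\<lambda>(k, l). op.root_vec q (repF q N) k l) ps)) (basis_fun 0) =
    (\<lambda>a. c * basis_fun (idx_of ps) a)" using Cons by auto
  have kl: "1 \<le> k" "k < l" "l \<le> N + 1" using Cons.prems p by (auto simp: Lambda_def)
  have "from_row k (idx_of ps)"
    using Cons.prems p by (intro entry_idx_of_0) (fastforce simp: Lambda_def)
  hence "lin_app (prod_list (map (\<lambda>(k, l). op.root_vec q (repF q N) k l) (p # ps))) (basis_fun 0) =
     (\<lambda>a. c * root_coeff q N k l (idx_of ps) * basis_fun (idx_of (p # ps)) a)"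
    using lin_app_root_vec[OF q q4 kl] by (simp add: p lin_app_mult c lin_app_scale idx_of_def ac_simps)
  moreover have "root_coeff q N k l (idx_of ps) \<noteq> 0" using q by (simp add: root_coeff_def)
  ultimately show ?case using c(1) by (intro exI[of _ "c * root_coeff q N k l (idx_of ps)"]) simp
qed

section \<open>The negative part\<close>

definition lex_pair_less :: "nat \<times> nat \<Rightarrow> nat \<times> nat \<Rightarrow> bool" where
  "lex_pair_less a b \<longleftrightarrow> fst a < fst b \<or> fst a = fst b \<and> snd a < snd b"

lemma sorted_wrt_concat_map:
  assumes "sorted_wrt (<) is" "\<And>i. i \<in> set is \<Longrightarrow> sorted_wrt P (f i)"
    "\<And>i j a b. \<lbrakk>i \<in> set is; j \<in> set is; i < j; a \<in> set (f i); b \<in> set (f j)\<rbrakk> \<Longrightarrow> P a b"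
  shows "sorted_wrt P (concat (map f is))"
  using assms
proof (induction "is")
  case (Cons k ks)
  have "sorted_wrt P (concat (map f ks))" 
  proof (rule Cons.IH)
    show "sorted_wrt (<) ks" using Cons.prems(1) by simp
    show "sorted_wrt P (f i)" if "i \<in> set ks" for i using Cons.prems(2) that by simp
    show "P a c" if "i \<in> set ks" "j \<in> set ks" "i < j" "a \<in> set (f i)" "c \<in> set (f j)" for i j a c
      using Cons.prems(3) that by (meson list.set_intros(2))
  qed
  moreover have "P a c" if "a \<in> set (f k)" "c \<in> set (concat (map f ks))" for a c
  proof -
    obtain i where "i \<in> set ks" "c \<in> set (f i)" using \<open>c \<in> _\<close> by auto
    thus ?thesis using Cons.prems(1) Cons.prems(3)[of k i a c] \<open>a \<in> _\<close> by simp
  qed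
  ultimately show ?case using Cons.prems(2) by (simp add: sorted_wrt_append)
qed simp

lemma Lambda_list_sorted: "sorted_wrt lex_pair_less (Lambda_list N)"
  unfolding Lambda_list_def
  by (rule sorted_wrt_concat_map) (auto simp: lex_pair_less_def sorted_wrt_map simp del: upt_Suc)

lemma set_Lambda_list: "set (Lambda_list N) = Lambda N"
proof -
  have "set (Lambda_list N) = (\<Union>i\<in>{1..<N + 1}. Pair i ` {i + 1..<N + 2})"
    by (simp add: Lambda_list_def del: upt_Suc)
  thus ?thesis by (auto simp: Lambda_def image_iff)
qed

lemma Lambda_list_distinct: "distinct (Lambda_list N)"
proof -
  have "Lambda_list N ! i \<noteq> Lambda_list N ! j" if "i < j" "j < length (Lambda_list N)" for i j
    using sorted_wrt_nth_less[OF Lambda_list_sorted that] by (auto simp: lex_pair_less_def)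
  thus ?thesis unfolding distinct_conv_nth by (metis linorder_neqE_nat)
qed

section \<open>The defining relations in the free algebra\<close>

lemma qbinom_2_1:
  assumes "t \<noteq> 0" "t\<^sup>2 \<noteq> 1" shows "qbinom t 2 1 = t + inverse t"
proof -
  have "t - inverse t \<noteq> 0" using assms by (auto simp: field_simps power2_eq_square)
  thus ?thesis using assms by (simp add: qbinom_def power_int_minus divide_simps)
      (simp add: algebra_simps power2_eq_square power4_eq_xxxx)
qed

lemma serre_adjacent:
  assumes "q \<noteq> 0" "q ^ 4 \<noteq> 1" "cartan i j = -1"
  shows "serre q X i j = free.qserre (q\<^sup>2) (gen (X i)) (gen (X j))"
proof -
  have "(q\<^sup>2)\<^sup>2 \<noteq> 1" using assms(2) by (simp flip: power_mult)
  hence "qbinom (q\<^sup>2) 2 1 = q\<^sup>2 + inverse (q\<^sup>2)" using assms(1) by (intro qbinom_2_1) simp_all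
  hence b: "qbinom (q\<^sup>2) (Suc (Suc 0)) (Suc 0) = q\<^sup>2 + inverse (q\<^sup>2)"
    by (simp only: numeral_2_eq_2 One_nat_def)
  have b': "qbinom t m 0 = 1" "qbinom t m m = 1" for t :: 'a and m by (simp_all add: qbinom_def)
  have "nat (1 - cartan i j) = Suc (Suc 0)" using assms(3) by simp
  thus ?thesis
    by (simp add: serre_def free.qserre_def b b' free.sc_one mult.assoc
        free.sc_add_left free.scale_left_diff_distrib free.scale_minus_left)
qed

lemma serre_far:
  assumes "cartan i j = 0"
  shows "serre q X i j = gen (X i) * gen (X j) - gen (X j) * gen (X i)"
proof -
  have b': "qbinom t m 0 = 1" "qbinom t m m = 1" for t :: 'a and m by (simp_all add: qbinom_def)
  show ?thesis using assms
    by (simp add: serre_def b' free.sc_one free.scale_minus_left)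
qed

lemma cartan_cases: "i \<noteq> j \<Longrightarrow> cartan i j = -1 \<or> cartan i j = 0"
  by (auto simp: cartan_def)

lemma Uq_gens_mem: "i \<in> {1..N} \<Longrightarrow> GE i \<in> Uq_gens N" "i \<in> {1..N} \<Longrightarrow> GK i \<in> Uq_gens N"
    "i \<in> {1..N} \<Longrightarrow> GK' i \<in> Uq_gens N" "i \<in> {1..N} \<Longrightarrow> GF i \<in> Uq_gens N"
  unfolding Uq_gens_def by blast+

lemma Uq_relations_closed: "Uq_relations q N \<subseteq> carrier (free_algebra (Uq_gens N))"
proof -
  have serre: "serre q X i j \<in> carrier (free_algebra (Uq_gens N))"
    if "X i \<in> Uq_gens N" "X j \<in> Uq_gens N" for X i j
    unfolding serre_def Let_def using that by (intro FA_intros)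
  show ?thesis
    unfolding Uq_relations_def
    by (intro UN_least Un_least) (auto intro!: FA_diff FA_mult FA_scal FA_gen FA_one FA_zero FA_power serre Uq_gens_mem)
qed

lemma Uq_ideal_ideal: "ideal (Uq_ideal q N) (free_algebra (Uq_gens N))"
  unfolding Uq_ideal_def by (rule ring.genideal_ideal[OF ring_FA Uq_relations_closed])

lemma Uq_relations_ideal: "Uq_relations q N \<subseteq> Uq_ideal q N"
  unfolding Uq_ideal_def by (rule ring.genideal_self[OF ring_FA Uq_relations_closed])

context K_algebra
begin

lemma ev_qserre: "ev f (free.qserre t x y) = qserre t (ev f x) (ev f y)"
  by (simp add: qserre_def free.qserre_def ev_add ev_diff ev_mult ev_scal)

lemma ev_root_vec: "ev f (free.root_vec q x i j) = root_vec q (\<lambda>k. ev f (x k)) i j"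
  by (induction j) (simp_all add: ev_zero ev_diff ev_mult ev_scal)

lemma ev_Uq_relations:
  assumes q: "q \<noteq> 0" "q ^ 4 \<noteq> 1" and r: "uq_rep q N E F K K'" and p: "p \<in> Uq_relations q N"
  shows "ev (case_Uq_gen E K K' F) p = 0"
proof -
  obtain i j where ij: "i \<in> {1..N}" "j \<in> {1..N}" and "p \<in>
     {gen (GK i) * gen (GK j) - gen (GK j) * gen (GK i),
      gen (GK i) * gen (GK' i) - 1,
      gen (GK' i) * gen (GK i) - 1,
      gen (GE j) * gen (GK i) - scal (q powi (- cartan i j)) (gen (GK i) * gen (GE j)),
      gen (GE j) * gen (GK' i) - scal (q powi cartan i j) (gen (GK' i) * gen (GE j)),
      gen (GK i) * gen (GF j) - scal (q powi (- cartan i j)) (gen (GF j) * gen (GK i)),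
      gen (GK' i) * gen (GF j) - scal (q powi cartan i j) (gen (GF j) * gen (GK' i)),
      gen (GE i) * gen (GF j) - gen (GF j) * gen (GE i)
        - (if i = j then scal (1 / (q\<^sup>2 - q powi (-2))) (gen (GK i) ^ 2 - gen (GK' i) ^ 2) else 0)}
     \<union> (if i \<noteq> j then {serre q GE i j, serre q GF i j} else {})"
    using p unfolding Uq_relations_def by blast
  moreover have "K i * K j = K j * K i \<and> K i * K' i = 1 \<and> K' i * K i = 1 \<and>
     E j * K i = sc (q powi (- cartan i j)) (K i * E j) \<and>
     E j * K' i = sc (q powi cartan i j) (K' i * E j) \<and>
     K i * F j = sc (q powi (- cartan i j)) (F j * K i) \<and>
     K' i * F j = sc (q powi cartan i j) (F j * K' i) \<and>
     E i * F j - F j * E i =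
       (if i = j then sc (1 / (q\<^sup>2 - q powi (-2))) (K i * K i - K' i * K' i) else 0)"
    and S: "cartan i j = -1 \<longrightarrow> qserre (q\<^sup>2) (E i) (E j) = 0 \<and> qserre (q\<^sup>2) (F i) (F j) = 0"
     "cartan i j = 0 \<longrightarrow> E i * E j = E j * E i \<and> F i * F j = F j * F i"
    using r ij unfolding uq_rep_def by blast+
  moreover have "ev (case_Uq_gen E K K' F) (serre q GE i j) = 0 \<and> ev (case_Uq_gen E K K' F) (serre q GF i j) = 0"
    if "i \<noteq> j"
    using cartan_cases[OF that] S
    by (auto simp: serre_adjacent[OF q] serre_far ev_qserre ev_diff ev_mult ev_gen)
  ultimately show ?thesis
    by (auto simp: ev_diff ev_mult ev_gen ev_scal ev_one ev_zero power2_eq_square split: if_splits)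
qed

text \<open>The elements of the carrier killed by the evaluation form an ideal containing the
  relations, so \<open>Uq_ideal\<close> lies in it by minimality.\<close>

lemma ev_Uq_ideal:
  assumes q: "q \<noteq> 0" "q ^ 4 \<noteq> 1" and r: "uq_rep q N E F K K'" and p: "p \<in> Uq_ideal q N"
  shows "ev (case_Uq_gen E K K' F) p = 0"
proof -
  let ?A = "free_algebra (Uq_gens N) :: ('k, 'k Uq_free) module"
  let ?Ker = "{p \<in> carrier ?A. ev (case_Uq_gen E K K' F) p = 0}"
  interpret A: ring ?A by (rule ring_FA)
  have "ideal ?Ker ?A"
  proof (rule idealI[OF ring_FA])
    have "\<ominus>\<^bsub>?A\<^esub> x = - x" if "x \<in> carrier ?A" for x
      using that by (intro A.minus_equality) (auto simp: FA_simps intro: FA_minus)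
    thus "subgroup ?Ker (add_monoid ?A)"
      by (intro A.add.subgroupI) (auto simp: FA_simps ev_zero ev_add ev_minus FA_zero FA_add FA_minus)
  qed (auto simp: FA_simps ev_mult FA_mult)
  moreover have "Uq_relations q N \<subseteq> ?Ker"
    using ev_Uq_relations[OF q r] Uq_relations_closed by blast
  ultimately have "Uq_ideal q N \<subseteq> ?Ker"
    unfolding Uq_ideal_def by (rule A.genideal_minimal)
  thus ?thesis using p by auto
qed

end

text \<open>Killing the foreign letters turns the ideal into one of the whole free algebra type.\<close>

definition retract :: "nat \<Rightarrow> 'k::field Uq_free \<Rightarrow> 'k Uq_free" where
  "retract N = free.ev (\<lambda>g. if g \<in> Uq_gens N then gen g else 0)"

definition Uq_ideal' :: "'k::field \<Rightarrow> nat \<Rightarrow> 'k Uq_free set" where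
  "Uq_ideal' q N = {p. retract N p \<in> Uq_ideal q N}"

lemma retract_closed: "retract N p \<in> carrier (free_algebra (Uq_gens N))"
  unfolding retract_def by (rule free_ev_closed) (simp add: FA_gen FA_zero)

lemma retract_id: "p \<in> carrier (free_algebra (Uq_gens N)) \<Longrightarrow> retract N p = p"
  unfolding retract_def by (rule free_ev_gen[where X = "Uq_gens N"]) simp_all

lemma Uq_ideal'_iff: "p \<in> carrier (free_algebra (Uq_gens N)) \<Longrightarrow> p \<in> Uq_ideal' q N \<longleftrightarrow> p \<in> Uq_ideal q N"
  by (simp add: Uq_ideal'_def retract_id)

lemma Uq_ideal'_ideal: "K_algebra_ideal scal (Uq_ideal' q N)"
proof -
  interpret ideal "Uq_ideal q N" "free_algebra (Uq_gens N)" by (rule Uq_ideal_ideal)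
  show ?thesis
  proof unfold_locales
    fix x y :: "'a Uq_free"
    show "x \<in> Uq_ideal' q N \<Longrightarrow> y \<in> Uq_ideal' q N \<Longrightarrow> x + y \<in> Uq_ideal' q N"
      using additive_subgroup.a_closed[OF ideal.axioms(1)[OF Uq_ideal_ideal[of q N]], of "retract N x" "retract N y"]
      by (auto simp: Uq_ideal'_def retract_def free.ev_add FA_simps)
    show "y \<in> Uq_ideal' q N \<Longrightarrow> x * y \<in> Uq_ideal' q N"
      using I_l_closed[OF _ retract_closed, of "retract N y" x]
      by (auto simp: Uq_ideal'_def FA_simps retract_def free.ev_mult)
    show "x \<in> Uq_ideal' q N \<Longrightarrow> x * y \<in> Uq_ideal' q N"
      using I_r_closed[OF _ retract_closed, of "retract N x" y]
      by (auto simp: Uq_ideal'_def FA_simps retract_def free.ev_mult)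
    show "0 \<in> Uq_ideal' q N"
      using additive_subgroup.zero_closed[OF ideal.axioms(1)[OF Uq_ideal_ideal[of q N]]]
      by (simp add: Uq_ideal'_def retract_def free.ev_zero FA_simps)
  qed
qed

lemma power_4_neq_1: "q ^ 8 \<noteq> 1 \<Longrightarrow> q ^ 4 \<noteq> (1 :: 'a::comm_ring_1)"
proof
  assume "q ^ 8 \<noteq> 1" "q ^ 4 = 1"
  hence "(q ^ 4) ^ 2 = 1" by simp
  thus False using \<open>q ^ 8 \<noteq> 1\<close> by (simp flip: power_mult)
qed

lemma Uq_serre_generators:
  assumes q: "q \<noteq> 0" "q ^ 8 \<noteq> 1"
  shows "serre_generators scal (Uq_ideal' q N) q N (\<lambda>i. gen (GF i))"
proof -
  interpret K_algebra_ideal scal "Uq_ideal' q N" by (rule Uq_ideal'_ideal)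
  have q4: "q ^ 4 \<noteq> 1" using q(2) by (rule power_4_neq_1)
  have *: "serre q GF i j \<in> Uq_ideal' q N" if "i \<in> {1..N}" "j \<in> {1..N}" "i \<noteq> j" for i j
  proof -
    have "serre q GF i j \<in> Uq_relations q N" using that unfolding Uq_relations_def by force
    thus ?thesis using Uq_relations_closed Uq_relations_ideal Uq_ideal'_iff by blast
  qed
  show ?thesis
  proof unfold_locales
    fix i j assume ij: "i \<in> {1..N}" "j \<in> {1..N}"
    show "cartan i j = -1 \<Longrightarrow> free.qserre (q\<^sup>2) (gen (GF i)) (gen (GF j)) \<in> Uq_ideal' q N"
      using *[OF ij] serre_adjacent[OF q(1) q4, of i j GF] by (cases "i = j") (auto simp: cartan_def[of i i] cartan_def[of j j])
    show "cartan i j = 0 \<Longrightarrow> gen (GF i) * gen (GF j) - gen (GF j) * gen (GF i) \<in> Uq_ideal' q N"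
      using *[OF ij] serre_far[of i j q GF] by (cases "i = j") (auto simp: cartan_def[of i i] cartan_def[of j j])
  qed (use q in auto)
qed

lemma count_list_map_inj: "inj_on f (insert i (set u)) \<Longrightarrow> count_list (map f u) (f i) = count_list u i"
  by (induction u) (auto simp: inj_on_def)

text \<open>Strict concavity makes the corrections in the commutation relations smaller than the leading
  products.\<close>

definition root_weight :: "nat \<Rightarrow> nat \<Rightarrow> nat" where
  "root_weight N l = l * (2 * N + 2 - l)"

text \<open>The linear part of \<open>root_weight\<close> is additive and the quadratic part leaves
  the gap \<open>2 * s * t\<close>. Writing \<open>N\<close> as a sum makes the truncated
  subtractions exact.\<close>

lemma root_weight_add:
  assumes "0 < s" "0 < t" "s + t \<le> N"
  shows "root_weight N (s + t) < root_weight N s + root_weight N t"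
proof -
  obtain v where N: "N = s + t + v" using assms(3) le_Suc_ex by blast
  have "2 * N + 2 - (s + t) = s + t + 2 * v + 2" "2 * N + 2 - s = s + 2 * t + 2 * v + 2"
    "2 * N + 2 - t = 2 * s + t + 2 * v + 2" using N by simp_all
  moreover have "0 < s * t" using assms by simp
  ultimately show ?thesis unfolding root_weight_def by (simp add: algebra_simps)
qed

text \<open>The gap is \<open>2 * s * u\<close>. For crossing roots \<open>(i, j)\<close> and
  \<open>(m, n)\<close> the parameters are \<open>m - i\<close>, \<open>j - m\<close> and
  \<open>n - j\<close>.\<close>

lemma root_weight_cross:
  assumes "0 < s" "0 < t" "0 < u" "s + t + u \<le> N"
  shows "root_weight N (s + t + u) + root_weight N t < root_weight N (s + t) + root_weight N (t + u)"
proof -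
  obtain v where N: "N = s + t + u + v" using assms(4) le_Suc_ex by blast
  have "2 * N + 2 - (s + t + u) = s + t + u + 2 * v + 2" "2 * N + 2 - t = 2 * s + t + 2 * u + 2 * v + 2"
    "2 * N + 2 - (s + t) = s + t + 2 * u + 2 * v + 2" "2 * N + 2 - (t + u) = 2 * s + t + u + 2 * v + 2"
    using N by simp_all
  moreover have "0 < s * u" using assms by simp
  ultimately show ?thesis unfolding root_weight_def by (simp add: algebra_simps)
qed

section \<open>Assembling the solvable structure\<close>

context
  fixes q :: "'k::field" and N :: nat
  assumes q: "q \<noteq> 0" and q8: "q ^ 8 \<noteq> 1"
begin

interpretation J: serre_generators scal "Uq_ideal' q N" q N "\<lambda>i. gen (GF i)"
  by (rule Uq_serre_generators[OF q q8])

definition pair_of :: "nat \<Rightarrow> nat \<times> nat" where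
  "pair_of k = Lambda_list N ! k"

definition root_vec_at :: "nat \<Rightarrow> 'k Uq_free" where
  "root_vec_at k = (case pair_of k of (i, j) \<Rightarrow> J.Y i j)"

definition letter_weight :: "nat \<Rightarrow> nat" where
  "letter_weight k = (case pair_of k of (i, j) \<Rightarrow> root_weight N (j - i))"

abbreviation "nr \<equiv> length (Lambda_list N)"

lemma pair_of_Lambda: "k < nr \<Longrightarrow> pair_of k \<in> Lambda N"
  unfolding pair_of_def set_Lambda_list[symmetric] by simp

lemma ex_index: "(i, j) \<in> Lambda N \<Longrightarrow> \<exists>k<nr. pair_of k = (i, j)"
  unfolding pair_of_def set_Lambda_list[symmetric] in_set_conv_nth .

lemma straightening_root_vec_at: "straightening scal (Uq_ideal' q N) nr root_vec_at letter_weight"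
proof unfold_locales
  fix k l assume kl: "k < l" "l < nr"
  obtain i j m n where ij: "pair_of k = (i, j)" and mn: "pair_of l = (m, n)" by force
  have bounds: "1 \<le> i" "i < j" "j \<le> N + 1" "1 \<le> m" "m < n" "n \<le> N + 1"
    using pair_of_Lambda[of k] pair_of_Lambda[of l] kl ij mn by (auto simp: Lambda_def)
  have less: "i < m \<or> i = m \<and> j < n"
    using sorted_wrt_nth_less[OF Lambda_list_sorted kl] ij mn by (simp add: pair_of_def lex_pair_less_def)
  let ?B = "(\<lambda>u. prod_list (map root_vec_at u)) ` {u. set u \<subseteq> {..<nr} \<and> sum_list (map letter_weight u) < letter_weight k + letter_weight l}"
  have root_vec_at: "root_vec_at k = J.Y i j" "root_vec_at l = J.Y m n" and w: "letter_weight k = root_weight N (j - i)" "letter_weight l = root_weight N (n - m)"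
    by (simp_all add: root_vec_at_def letter_weight_def ij mn)
  have q0: "J.p * J.p \<noteq> 0" "q * q \<noteq> 0" using q J.p0 by simp_all
  have qc: "\<exists>c f. c \<noteq> 0 \<and> f \<in> free.span ?B \<and> root_vec_at l * root_vec_at k - (scal c (root_vec_at k * root_vec_at l) + f) \<in> Uq_ideal' q N" if "c \<noteq> 0" "J.qcomm c (J.Y m n) (J.Y i j)" for c
    using that free.span_zero[of ?B] unfolding J.qcomm_def J.eqv_def root_vec_at
    by (intro exI[of _ c] exI[of _ 0]) simp
  \<comment> \<open>Jimbo's cases for lexicographically increasing pairs: same row, disjoint,
    adjacent, nested, same column, crossing. Only the adjacent and crossing cases have a correction,
    controlled by \<open>root_weight_add\<close> and \<open>root_weight_cross\<close>.\<close>
  consider "i = m" "j < n" | "i < m" "j < m" | "i < m" "j = m" | "i < m" "m < j" "n < j"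
    | "i < m" "m < j" "n = j" | "i < m" "m < j" "j < n"
    using less by linarith
  thus "\<exists>c f. c \<noteq> 0 \<and> f \<in> free.span ?B \<and> root_vec_at l * root_vec_at k - (scal c (root_vec_at k * root_vec_at l) + f) \<in> Uq_ideal' q N"
  proof cases
    case 1
    show ?thesis using J.Y_same_row[of i j n] 1 bounds by (intro qc[OF q0(1)]) simp
  next
    case 2
    show ?thesis using J.Y_comm_Y[of i j m n] 2 bounds by (intro qc[OF one_neq_zero]) simp
  next
    case 3
    obtain h where h: "h < nr" "pair_of h = (i, n)" using ex_index[of i n] 3 bounds by (auto simp: Lambda_def)
    have "root_weight N ((j - i) + (n - j)) < root_weight N (j - i) + root_weight N (n - j)"
      using 3 bounds by (intro root_weight_add) auto
    hence "letter_weight h < letter_weight k + letter_weight l" using 3 bounds h by (simp add: w) (simp add: letter_weight_def)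
    hence "prod_list (map root_vec_at [h]) \<in> ?B" using h by (intro imageI) simp
    hence "J.Y i n \<in> free.span ?B" using h by (intro free.span_base) (simp add: root_vec_at_def)
    hence f: "- scal q (J.Y i n) \<in> free.span ?B" by (intro free.span_neg free.span_scale)
    have "J.Y j n * J.Y i j - (scal (q * q) (J.Y i j * J.Y j n) + - scal q (J.Y i n)) \<in> Uq_ideal' q N"
      using J.Y_adjacent[of i j n] 3 bounds by (simp add: J.eqv_def)
    thus ?thesis using f q0(2) 3 unfolding root_vec_at by blast
  next
    case 4
    show ?thesis using J.Y_nested[of i m n j] 4 bounds by (intro qc[OF one_neq_zero]) simp
  next
    case 5
    show ?thesis using J.Y_same_column[of i m j] 5 bounds by (intro qc[OF q0(1)]) simp
  next
    case 6
    obtain h g where h: "h < nr" "pair_of h = (i, n)" "g < nr" "pair_of g = (m, j)"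
      using ex_index[of i n] ex_index[of m j] 6 bounds by (auto simp: Lambda_def)
    have "root_weight N ((m - i) + (j - m) + (n - j)) + root_weight N (j - m) <
        root_weight N ((m - i) + (j - m)) + root_weight N ((j - m) + (n - j))"
      using 6 bounds by (intro root_weight_cross) auto
    hence "letter_weight h + letter_weight g < letter_weight k + letter_weight l" using 6 bounds h by (simp add: w) (simp add: letter_weight_def)
    hence "prod_list (map root_vec_at [h, g]) \<in> ?B" using h by (intro imageI) simp
    hence "J.Y i n * J.Y m j \<in> free.span ?B" using h by (intro free.span_base) (simp add: root_vec_at_def)
    hence f: "- scal (q * q - J.p * J.p) (J.Y i n * J.Y m j) \<in> free.span ?B"
      by (intro free.span_neg free.span_scale)
    have *: "J.Y m n * J.Y i j - (scal 1 (J.Y i j * J.Y m n) + - scal (q * q - J.p * J.p) (J.Y i n * J.Y m j)) \<in> Uq_ideal' q N"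
      using J.Y_crossing[of i m j n] 6 bounds by (simp add: J.eqv_def free.sc_one)
    show ?thesis unfolding root_vec_at by (rule exI, rule exI, rule conjI[OF one_neq_zero conjI[OF f *]])
  qed
qed

interpretation St: straightening scal "Uq_ideal' q N" nr root_vec_at letter_weight
  by (rule straightening_root_vec_at)

definition Fs :: "Uq_gen set" where "Fs = GF ` {1..N}"

lemma Fs_gens: "Fs \<subseteq> Uq_gens N"
  unfolding Fs_def using Uq_gens_mem(4) by blast

lemma gen_Fs: "1 \<le> i \<Longrightarrow> i \<le> N \<Longrightarrow> gen (GF i) \<in> carrier (free_algebra Fs)"
  by (rule FA_gen) (simp add: Fs_def)

lemma Y_closed: "1 \<le> i \<Longrightarrow> i < j \<Longrightarrow> j \<le> N + 1 \<Longrightarrow> J.Y i j \<in> carrier (free_algebra Fs)"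
proof (induction j)
  case (Suc j)
  show ?case
  proof (cases "j \<le> i")
    case True
    thus ?thesis using Suc.prems gen_Fs[of i] by (cases "i \<le> N") (auto simp: free.root_vec.simps)
  next
    case False
    thus ?thesis using Suc gen_Fs[of j] by (auto simp: free.root_vec.simps intro!: FA_diff FA_scal FA_mult)
  qed
qed (simp add: FA_zero)

lemma root_vec_at_closed: "k < nr \<Longrightarrow> root_vec_at k \<in> carrier (free_algebra Fs)"
  using pair_of_Lambda[of k] Y_closed unfolding root_vec_at_def Lambda_def by (auto split: prod.splits)

lemma root_vec_at_indep:
  assumes T: "finite T" "T \<subseteq> {\<alpha>. length \<alpha> = nr}"
    and zero: "(\<Sum>\<alpha>\<in>T. scal (c \<alpha>) (St.M \<alpha>)) \<in> Uq_ideal' q N" and \<alpha>: "\<alpha> \<in> T"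
  shows "c \<alpha> = 0"
proof -
  have q4: "q ^ 4 \<noteq> 1" using q8 by (rule power_4_neq_1)
  let ?f = "case_Uq_gen (repE q N) (repK q N) (repK' q N) (repF q N)"
  let ?ps = "\<lambda>\<alpha>. map pair_of (St.word \<alpha>)"
  have "St.M \<alpha> \<in> carrier (free_algebra (Uq_gens N))" for \<alpha>
    unfolding St.M_def St.X_def
  proof (rule FA_prod_list)
    fix p assume "p \<in> set (map root_vec_at (St.word \<alpha>))"
    then obtain k where "p = root_vec_at k" "k < nr" using St.set_word by auto
    thus "p \<in> carrier (free_algebra (Uq_gens N))"
      using root_vec_at_closed Fs_gens by (fastforce simp: free_algebra_def)
  qed
  hence "(\<Sum>\<alpha>\<in>T. scal (c \<alpha>) (St.M \<alpha>)) \<in> Uq_ideal q N"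
    using zero by (subst (asm) Uq_ideal'_iff) (intro FA_sum FA_scal)
  hence "op.ev ?f (\<Sum>\<alpha>\<in>T. scal (c \<alpha>) (St.M \<alpha>)) = 0"
    by (rule op.ev_Uq_ideal[OF q q4 rep_uq_rep[OF q q4]])
  hence sum0: "(\<Sum>\<alpha>\<in>T. op_sc (c \<alpha>) (op.ev ?f (St.M \<alpha>))) = 0"
    by (simp add: op.ev_sum op.ev_scal)
  have evM: "op.ev ?f (St.M \<alpha>) = prod_list (map (\<lambda>(k, l). op.root_vec q (repF q N) k l) (?ps \<alpha>))" for \<alpha>
    unfolding St.M_def St.X_def op.ev_prod_list map_map
    by (intro arg_cong[where f = prod_list] map_cong)
      (auto simp: root_vec_at_def op.ev_root_vec op.ev_gen split: prod.splits)
  have "\<exists>d. d \<noteq> 0 \<and> lin_app (op.ev ?f (St.M \<alpha>)) (basis_fun 0) = (\<lambda>a. d * basis_fun (idx_of (?ps \<alpha>)) a)" for \<alpha>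
    unfolding evM
  proof (rule root_vec_vacuum[OF q q4])
    have "sorted (St.word \<alpha>)" unfolding St.word_def by (rule concat_replicate_sorted) simp
    moreover have "fst (pair_of k) \<le> fst (pair_of l)" if "k \<le> l" "l < nr" for k l
      using sorted_wrt_nth_less[OF Lambda_list_sorted[of N], of k l] that
      by (cases "k = l") (auto simp: pair_of_def lex_pair_less_def)
    ultimately show "sorted (map fst (?ps \<alpha>))"
      using St.set_word[of \<alpha>] by (auto simp: sorted_wrt_map intro!: sorted_wrt_mono_rel[of "St.word \<alpha>" "(\<le>)"])
    show "set (?ps \<alpha>) \<subseteq> Lambda N" using St.set_word[of \<alpha>] pair_of_Lambda by auto
  qed
  then obtain d where d: "\<And>\<alpha>. d \<alpha> \<noteq> 0"
    "\<And>\<alpha>. lin_app (op.ev ?f (St.M \<alpha>)) (basis_fun 0) = (\<lambda>a. d \<alpha> * basis_fun (idx_of (?ps \<alpha>)) a)" by metis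
  \<comment> \<open>The entry at each root returns the corresponding exponent, so distinct exponents
    reach distinct basis vectors.\<close>
  have inj: "idx_of (?ps \<beta>) = idx_of (?ps \<gamma>) \<longleftrightarrow> \<beta> = \<gamma>" if "\<beta> \<in> T" "\<gamma> \<in> T" for \<beta> \<gamma>
  proof
    have len: "length \<beta> = nr" "length \<gamma> = nr" using that T by auto
    assume eq: "idx_of (?ps \<beta>) = idx_of (?ps \<gamma>)"
    show "\<beta> = \<gamma>"
    proof (rule nth_equalityI)
      fix i assume i: "i < length \<beta>"
      hence i': "i < nr" using len by simp
      obtain k l where kl: "pair_of i = (k, l)" by force
      have "k < l" using pair_of_Lambda[OF i'] kl by (simp add: Lambda_def)
      have "entry (idx_of (?ps \<delta>)) k l = int (\<delta> ! i)" for \<delta>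
      proof -
        have "\<forall>(s, t)\<in>set (?ps \<delta>). s < t"
          using St.set_word[of \<delta>] pair_of_Lambda by (fastforce simp: Lambda_def)
        hence "entry (idx_of (?ps \<delta>)) k l = int (count_list (?ps \<delta>) (pair_of i))"
          using \<open>k < l\<close> kl entry_idx_of by simp
        also have "count_list (?ps \<delta>) (pair_of i) = count_list (St.word \<delta>) i"
        proof (rule count_list_map_inj)
          have "inj_on pair_of {..<nr}"
            using Lambda_list_distinct by (auto simp: inj_on_def pair_of_def nth_eq_iff_index_eq)
          thus "inj_on pair_of (insert i (set (St.word \<delta>)))"
            using St.set_word[of \<delta>] i' by (elim inj_on_subset) auto
        qed
        also have "\<dots> = \<delta> ! i" using i' by (simp add: St.word_def count_concat_replicate)
        finally show ?thesis .
      qed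
      thus "\<beta> ! i = \<gamma> ! i" using eq by (metis of_nat_eq_iff)
    qed (use len in simp)
  qed simp
  \<comment> \<open>The relation is applied to the vacuum and evaluated at the index reached by
    \<open>\<alpha>\<close>, which isolates \<open>c \<alpha> * d \<alpha>\<close>.\<close>
  have "0 = lin_app (\<Sum>\<alpha>\<in>T. op_sc (c \<alpha>) (op.ev ?f (St.M \<alpha>))) (basis_fun 0) (idx_of (?ps \<alpha>))"
    unfolding sum0 by (simp add: lin_app_zero)
  also have "\<dots> = (\<Sum>\<beta>\<in>T. c \<beta> * (d \<beta> * basis_fun (idx_of (?ps \<beta>)) (idx_of (?ps \<alpha>))))"
    using T(1) by (simp add: lin_app_sum lin_app_sc d(2))
  also have "\<dots> = (\<Sum>\<beta>\<in>{\<alpha>}. c \<beta> * (d \<beta> * basis_fun (idx_of (?ps \<beta>)) (idx_of (?ps \<alpha>))))"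
  proof (rule sum.mono_neutral_right)
    show "\<forall>\<beta>\<in>T - {\<alpha>}. c \<beta> * (d \<beta> * basis_fun (idx_of (?ps \<beta>)) (idx_of (?ps \<alpha>))) = 0"
      using inj[OF \<alpha>] by (auto simp: basis_fun_def)
  qed (use T \<alpha> in auto)
  also have "\<dots> = c \<alpha> * d \<alpha>" by (simp add: basis_fun_def)
  finally show "c \<alpha> = 0" using d(1) by simp
qed

interpretation P: pbw_quotient "Uq_gens N" "Uq_ideal q N" "Uq_ideal' q N" nr root_vec_at letter_weight Fs
proof (intro pbw_quotient.intro free_quotient.intro pbw_quotient_axioms.intro straightening_root_vec_at)
  show "ideal (Uq_ideal q N) (free_algebra (Uq_gens N))" by (rule Uq_ideal_ideal)
  show "Fs \<subseteq> Uq_gens N" by (rule Fs_gens)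
  show "p \<in> Uq_ideal' q N \<longleftrightarrow> p \<in> Uq_ideal q N" if "p \<in> carrier (free_algebra (Uq_gens N))" for p
    using that by (rule Uq_ideal'_iff)
  show "root_vec_at k \<in> carrier (free_algebra Fs)" if "k < nr" for k using that by (rule root_vec_at_closed)
  show "0 < letter_weight k" if "k < nr" for k
    using pair_of_Lambda[OF that] by (auto simp: letter_weight_def Lambda_def root_weight_def split: prod.splits)
  show "\<exists>i<nr. gen g = root_vec_at i" if "g \<in> Fs" for g
  proof -
    obtain i where i: "g = GF i" "i \<in> {1..N}" using \<open>g \<in> Fs\<close> by (auto simp: Fs_def)
    then obtain k where "k < nr" "pair_of k = (i, Suc i)" using ex_index[of i "Suc i"] by (auto simp: Lambda_def)
    thus ?thesis using i by (intro exI[of _ k]) (simp add: root_vec_at_def)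
  qed
  show "c \<alpha> = 0" if "finite T" "T \<subseteq> {\<alpha>. length \<alpha> = nr}"
    "(\<Sum>\<alpha>\<in>T. scal (c \<alpha>) (St.M \<alpha>)) \<in> Uq_ideal' q N" "\<alpha> \<in> T" for T c \<alpha>
    using that by (rule root_vec_at_indep)
qed

lemma Uq_minus_eq: "Uq_minus q N = P.sub P.S"
proof -
  have "Uq_F q N ` {1..N} = P.cls ` gen ` Fs"
    unfolding image_image Fs_def by (intro image_cong) (simp_all add: Uq_F_def P.cls_def)
  thus ?thesis
    unfolding Uq_minus_def Uq_def using P.subalgebra_generated_gens[OF Fs_gens] by simp
qed

definition jimbo_gen :: "nat \<Rightarrow> nat \<Rightarrow> 'k Uq_free set" where
  "jimbo_gen i j = P.cls (J.Y i j)"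

lemma jimbo_generators_jimbo_gen: "jimbo_generators q N jimbo_gen"
proof -
  have qp: "q powi (-2) = J.p * J.p" using q by (simp add: J.p_def power_int_minus power2_eq_square)
  have Y: "J.Y i j \<in> P.S" if "(i, j) \<in> Lambda N" for i j
    using that by (intro Y_closed) (auto simp: Lambda_def)
  have minus: "P.cls p \<ominus>\<^bsub>P.sub P.S\<^esub> P.cls r = P.cls (p - r)" if "p \<in> P.S" "r \<in> P.S" for p r
  proof -
    have "\<ominus>\<^bsub>P.sub P.S\<^esub> P.cls r = P.cls (- r)"
      using that FA_minus[of r Fs]
      by (intro P.V.minus_equality) (auto simp: P.sub_simps P.Q_add P.SA)
    thus ?thesis using that FA_minus[of r Fs] by (simp add: a_minus_def P.sub_simps P.Q_add P.SA)
  qed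
  have main: "((i = m \<and> m < j \<and> j < n) \<or> (i < m \<and> m < j \<and> j = n) \<longrightarrow>
          jimbo_gen m n \<otimes>\<^bsub>P.sub P.S\<^esub> jimbo_gen i j = q powi (-2) \<odot>\<^bsub>P.sub P.S\<^esub> (jimbo_gen i j \<otimes>\<^bsub>P.sub P.S\<^esub> jimbo_gen m n)) \<and>
       ((i < m \<and> m < n \<and> n < j) \<or> (i < j \<and> j < m \<and> m < n) \<longrightarrow>
          jimbo_gen m n \<otimes>\<^bsub>P.sub P.S\<^esub> jimbo_gen i j = jimbo_gen i j \<otimes>\<^bsub>P.sub P.S\<^esub> jimbo_gen m n) \<and>
       (i < m \<and> m < j \<and> j < n \<longrightarrow>
          jimbo_gen m n \<otimes>\<^bsub>P.sub P.S\<^esub> jimbo_gen i j = jimbo_gen i j \<otimes>\<^bsub>P.sub P.S\<^esub> jimbo_gen m n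
            \<ominus>\<^bsub>P.sub P.S\<^esub> (q\<^sup>2 - q powi (-2)) \<odot>\<^bsub>P.sub P.S\<^esub> (jimbo_gen i n \<otimes>\<^bsub>P.sub P.S\<^esub> jimbo_gen m j)) \<and>
       (i < j \<and> j = m \<and> m < n \<longrightarrow>
          jimbo_gen m n \<otimes>\<^bsub>P.sub P.S\<^esub> jimbo_gen i j = q\<^sup>2 \<odot>\<^bsub>P.sub P.S\<^esub> (jimbo_gen i j \<otimes>\<^bsub>P.sub P.S\<^esub> jimbo_gen m n) \<ominus>\<^bsub>P.sub P.S\<^esub> q \<odot>\<^bsub>P.sub P.S\<^esub> jimbo_gen i n)"
    if ij: "(i, j) \<in> Lambda N" and mn: "(m, n) \<in> Lambda N" for i j m n
  proof -
    have bounds: "1 \<le> i" "i < j" "j \<le> N + 1" "1 \<le> m" "m < n" "n \<le> N + 1"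
      using ij mn by (auto simp: Lambda_def)
    have mult: "jimbo_gen a b \<otimes>\<^bsub>P.sub P.S\<^esub> jimbo_gen c d = P.cls (J.Y a b * J.Y c d)" if "(a, b) \<in> Lambda N" "(c, d) \<in> Lambda N" for a b c d
      using Y[OF that(1)] Y[OF that(2)] by (simp add: jimbo_gen_def P.sub_simps P.Q_mult P.SA)
    have smult: "c \<odot>\<^bsub>P.sub P.S\<^esub> P.cls p = P.cls (scal c p)" if "p \<in> P.S" for c p
      using that by (simp add: P.sub_simps P.Q_smult P.SA)
    have YY: "J.Y a b * J.Y c d \<in> P.S" if "(a, b) \<in> Lambda N" "(c, d) \<in> Lambda N" for a b c d
      using Y[OF that(1)] Y[OF that(2)] by (rule FA_mult)
    have eq: "P.cls p = P.cls r" if "J.eqv p r" "p \<in> P.S" "r \<in> P.S" for p r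
      using that by (intro P.cls_eqI) (simp_all add: J.eqv_def)
    show ?thesis
    proof (intro conjI impI)
      assume "(i = m \<and> m < j \<and> j < n) \<or> (i < m \<and> m < j \<and> j = n)"
      hence "J.qcomm (J.p * J.p) (J.Y m n) (J.Y i j)"
        using J.Y_same_row[of i j n] J.Y_same_column[of i m j] bounds by auto
      thus "jimbo_gen m n \<otimes>\<^bsub>P.sub P.S\<^esub> jimbo_gen i j = q powi (-2) \<odot>\<^bsub>P.sub P.S\<^esub> (jimbo_gen i j \<otimes>\<^bsub>P.sub P.S\<^esub> jimbo_gen m n)"
        unfolding mult[OF ij mn] mult[OF mn ij] smult[OF YY[OF ij mn]] qp J.qcomm_def
        by (intro eq YY FA_scal ij mn)
    next
      assume "(i < m \<and> m < n \<and> n < j) \<or> (i < j \<and> j < m \<and> m < n)"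
      hence "J.qcomm 1 (J.Y m n) (J.Y i j)"
        using J.Y_nested[of i m n j] J.Y_comm_Y[of i j m n] bounds by auto
      thus "jimbo_gen m n \<otimes>\<^bsub>P.sub P.S\<^esub> jimbo_gen i j = jimbo_gen i j \<otimes>\<^bsub>P.sub P.S\<^esub> jimbo_gen m n"
        unfolding mult[OF ij mn] mult[OF mn ij] J.qcomm_def free.sc_one
        by (intro eq YY ij mn)
    next
      assume *: "i < m \<and> m < j \<and> j < n"
      hence l: "(i, n) \<in> Lambda N" "(m, j) \<in> Lambda N" using bounds by (auto simp: Lambda_def)
      have "J.eqv (J.Y m n * J.Y i j) (J.Y i j * J.Y m n - scal (q * q - J.p * J.p) (J.Y i n * J.Y m j))"
        using J.Y_crossing[of i m j n] * bounds by simp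
      thus "jimbo_gen m n \<otimes>\<^bsub>P.sub P.S\<^esub> jimbo_gen i j = jimbo_gen i j \<otimes>\<^bsub>P.sub P.S\<^esub> jimbo_gen m n
            \<ominus>\<^bsub>P.sub P.S\<^esub> (q\<^sup>2 - q powi (-2)) \<odot>\<^bsub>P.sub P.S\<^esub> (jimbo_gen i n \<otimes>\<^bsub>P.sub P.S\<^esub> jimbo_gen m j)"
        unfolding mult[OF ij mn] mult[OF mn ij] mult[OF l] smult[OF YY[OF l]] qp power2_eq_square
          minus[OF YY[OF ij mn] FA_scal[OF YY[OF l]]]
        by (intro eq YY FA_diff FA_scal ij mn l)
    next
      assume *: "i < j \<and> j = m \<and> m < n"
      hence l: "(i, n) \<in> Lambda N" using bounds by (auto simp: Lambda_def)
      have "J.eqv (J.Y m n * J.Y i j) (scal (q * q) (J.Y i j * J.Y m n) - scal q (J.Y i n))"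
        using J.Y_adjacent[of i j n] * bounds by simp
      thus "jimbo_gen m n \<otimes>\<^bsub>P.sub P.S\<^esub> jimbo_gen i j = q\<^sup>2 \<odot>\<^bsub>P.sub P.S\<^esub> (jimbo_gen i j \<otimes>\<^bsub>P.sub P.S\<^esub> jimbo_gen m n) \<ominus>\<^bsub>P.sub P.S\<^esub> q \<odot>\<^bsub>P.sub P.S\<^esub> jimbo_gen i n"
        unfolding mult[OF ij mn] mult[OF mn ij] jimbo_gen_def[of i n] smult[OF YY[OF ij mn]] smult[OF Y[OF l]] power2_eq_square
          minus[OF FA_scal[OF YY[OF ij mn]] FA_scal[OF Y[OF l]]]
        by (intro eq YY Y FA_diff FA_scal ij mn l)
    qed
  qed
  show ?thesis
    unfolding jimbo_generators_def Let_def Uq_minus_eq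
  proof (intro conjI)
    show "\<forall>(i, j)\<in>Lambda N. jimbo_gen i j \<in> carrier (P.sub P.S)"
      using Y by (auto simp: jimbo_gen_def P.sub_simps)
    show "\<forall>i\<in>{1..N}. jimbo_gen i (i + 1) = Uq_F q N i"
      by (simp add: jimbo_gen_def Uq_F_def P.cls_def)
  qed (use main in blast)
qed

lemma solvable_Uq_minus:
  "solvable_polynomial_algebra class_ring (Uq_minus q N) (map (\<lambda>(i, j). jimbo_gen i j) (Lambda_list N))"
proof -
  have "map (\<lambda>(i, j). jimbo_gen i j) (Lambda_list N) = map (\<lambda>k. P.cls (root_vec_at k)) [0..<nr]"
    by (rule nth_equalityI) (simp_all add: jimbo_gen_def root_vec_at_def pair_of_def split: prod.splits)
  thus ?thesis using P.solvable by (simp add: Uq_minus_eq)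
qed

end

theorem theorem2p4:
  fixes q :: "'k::field_char_0" and N :: nat
  assumes "N \<ge> 1" and "q \<noteq> 0" and "q ^ 8 \<noteq> 1"
  shows "\<exists>y. jimbo_generators q N y \<and>
    solvable_polynomial_algebra class_ring (Uq_minus q N)
      (map (\<lambda>(i, j). y i j) (Lambda_list N))"
  using jimbo_generators_jimbo_gen[OF assms(2,3)] solvable_Uq_minus[OF assms(2,3)] by blast

end
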